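(* For every $a\ge h^*$, as $t\to\infty$, $$P_a\big[|\mathcal C_o^{h^*}\cap\mathbb T^+|>t\big]=C_1\chi(a)\,t^{-1/2}(1+o(1)),\qquad P_a\big[|\mathcal C_o^{h^*}|>t\big]=C_1\frac{d+1}{d}\chi(a)\,t^{-1/2}(1+o(1)),$$ where $$C_1=\frac1{\Gamma(1/2)}\sqrt{\frac{2d}{d-1}\cdot\frac{\langle 1,\chi\rangle_\nu}{\langle\chi,\chi^2\rangle_\nu}}$$ and $\langle\cdot,\cdot\rangle_\nu$ is the scalar product of $L^2(\nu)$.
   Context: Let $d\ge 2$ and let $\mathbb T$ be the infinite $(d+1)$-regular tree rooted at $o$, $\bar o$ a fixed neighbour of $o$, $\mathbb T^+:=\{x:\bar o\text{ not on the geodesic from }o\text{ to }x\}$. Let $\phi$ be the Gaussian free field on $\mathbb T$ (centred Gaussian, covariance equal to the Green function $g(x,y)=\frac1{d+1}\mathbb E_x[\sum_{k\ge0}1_{X_k=y}]$ of simple random walk), law $P$, and $P_a:=P[\cdot\mid\phi_o=a]$; equivalently under $P_a$, $\phi_o=a$ and $\phi_x=\frac1d\phi_{\bar x}+Y_x$ for $x\neq o$ ($\bar x$ the parent of $x$ towards $o$, $(Y_x)$ i.i.d. $\mathcal N(0,\frac{d+1}d)$). $\mathcal C_o^h$ is the connected component of $o$ in $\{x:\phi_x\ge h\}$, and $h^*:=\inf\{h:P[|\mathcal C_o^h|=\infty]=0\}$. Spectral objects: $\sigma_\nu^2=\frac d{d-1}$, $\sigma_Y^2=\frac{d+1}d$,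 $\nu=\mathcal N(0,\sigma_\nu^2)$, $\rho_Y$ the density of $\mathcal N(0,\sigma_Y^2)$. For $h\in\mathbb R$ the operator $L_h$ on $L^2(\nu)$ is $L_h[f](a)=1_{[h,\infty)}(a)\,d\int_h^\infty f(x)\rho_Y(x-\frac ad)\,dx$. It is known that $L_h$ is self-adjoint, nonnegative and Hilbert–Schmidt, its norm $\lambda_h$ is a simple eigenvalue with a unique eigenfunction $\chi_h\ge0$ of unit $L^2(\nu)$-norm, which is continuous, strictly positive on $[h,\infty)$ and zero on $(-\infty,h)$, and $h^*$ is the unique $h$ with $\lambda_h=1$. Write $\chi:=\chi_{h^*}$.
   Formalization: The stated Green function with factor 1/(d+1) gives Var(φ_o)=d/((d+1)(d-1)), which clashes with σ_Y²=(d+1)/d and σ_ν²=d/(d-1); the field is taken with φ_o~ν and the recursion φ_x=φ_{x̄}/d+Y_x, Y_x~N(0,(d+1)/d), i.e. without the factor 1/(d+1). *)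

theory Defs
  imports "HOL-Probability.Probability" "HOL-Library.Landau_Symbols"
begin

text \<open>Vertices of the (d+1)-regular tree rooted at o, encoded as the reversed path
  from the root: [] is o, and (i # x) is the i-th child of x. The root has the children
  [0],...,[d]; every other vertex has the children j # x with j < d. The fixed neighbour
  obar of o is [d].\<close>
type_synonym vertex = "nat list"

definition is_vertex :: "nat \<Rightarrow> vertex \<Rightarrow> bool" where
  "is_vertex d x \<longleftrightarrow> x = [] \<or> (last x \<le> d \<and> (\<forall>i\<in>set (butlast x). i < d))"

definition tree_adj :: "nat \<Rightarrow> vertex \<Rightarrow> vertex \<Rightarrow> bool" where
  "tree_adj d x y \<longleftrightarrow> is_vertex d x \<and> is_vertex d y \<and>
     ((\<exists>i. y = i # x) \<or> (\<exists>i. x = i # y))"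

definition root_bar :: "nat \<Rightarrow> vertex" where
  "root_bar d = [d]"

text \<open>T^+: vertices x such that obar = [d] is not on the geodesic from o to x.\<close>
definition T_plus :: "nat \<Rightarrow> vertex set" where
  "T_plus d = {x. is_vertex d x \<and> (x = [] \<or> last x \<noteq> d)}"

definition sigma_nu2 :: "nat \<Rightarrow> real" where
  "sigma_nu2 d = real d / (real d - 1)"

definition sigma_Y2 :: "nat \<Rightarrow> real" where
  "sigma_Y2 d = (real d + 1) / real d"

definition nu :: "nat \<Rightarrow> real measure" where
  "nu d = density lborel (normal_density 0 (sqrt (sigma_nu2 d)))"

definition rho_Y :: "nat \<Rightarrow> real \<Rightarrow> real" where
  "rho_Y d = normal_density 0 (sqrt (sigma_Y2 d))"

text \<open>Sample space: independent variables Y_x, x a vertex; Y_[] ~ nu (used as the root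
  value under the unconditioned law P), Y_x ~ N(0, sigma_Y^2) for x \<noteq> [].\<close>
definition field_space :: "nat \<Rightarrow> (vertex \<Rightarrow> real) measure" where
  "field_space d = (\<Pi>\<^sub>M x\<in>UNIV. if x = [] then nu d else density lborel (rho_Y d))"

fun phi :: "nat \<Rightarrow> real \<Rightarrow> (vertex \<Rightarrow> real) \<Rightarrow> vertex \<Rightarrow> real" where
  "phi d a Y [] = a"
| "phi d a Y (i # x) = phi d a Y x / real d + Y (i # x)"

definition cluster :: "nat \<Rightarrow> real \<Rightarrow> (vertex \<Rightarrow> real) \<Rightarrow> vertex set" where
  "cluster d h \<phi> = {x. h \<le> \<phi> [] \<and>
     (\<lambda>u v. tree_adj d u v \<and> h \<le> \<phi> u \<and> h \<le> \<phi> v)\<^sup>*\<^sup>* [] x}"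

definition size_gt :: "'a set \<Rightarrow> real \<Rightarrow> bool" where
  "size_gt A t \<longleftrightarrow> infinite A \<or> t < real (card A)"

definition Pa :: "nat \<Rightarrow> real \<Rightarrow> ((vertex \<Rightarrow> real) \<Rightarrow> bool) \<Rightarrow> real" where
  "Pa d a E = measure (field_space d) {Y \<in> space (field_space d). E (phi d a Y)}"

definition Pfree :: "nat \<Rightarrow> ((vertex \<Rightarrow> real) \<Rightarrow> bool) \<Rightarrow> real" where
  "Pfree d E = measure (field_space d) {Y \<in> space (field_space d). E (phi d (Y []) Y)}"

definition h_star :: "nat \<Rightarrow> real" where
  "h_star d = Inf {h. Pfree d (\<lambda>\<phi>. infinite (cluster d h \<phi>)) = 0}"

definition L_op :: "nat \<Rightarrow> real \<Rightarrow> (real \<Rightarrow> real) \<Rightarrow> real \<Rightarrow> real" where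
  "L_op d h f a = indicator {h..} a * real d *
     (LINT x:{h..}|lborel. f x * rho_Y d (x - a / real d))"

definition L2nu :: "nat \<Rightarrow> (real \<Rightarrow> real) \<Rightarrow> bool" where
  "L2nu d f \<longleftrightarrow> f \<in> borel_measurable borel \<and> integrable (nu d) (\<lambda>x. (f x)\<^sup>2)"

definition norm_nu :: "nat \<Rightarrow> (real \<Rightarrow> real) \<Rightarrow> real" where
  "norm_nu d f = sqrt (\<integral>x. (f x)\<^sup>2 \<partial>nu d)"

definition lambda_h :: "nat \<Rightarrow> real \<Rightarrow> real" where
  "lambda_h d h = Sup {norm_nu d (L_op d h f) | f. L2nu d f \<and> norm_nu d f = 1}"

text \<open>The nonnegative unit eigenfunction for lambda_h (the representative satisfying
  the eigen-equation pointwise).\<close>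
definition chi_h :: "nat \<Rightarrow> real \<Rightarrow> real \<Rightarrow> real" where
  "chi_h d h = (THE f. L2nu d f \<and> (\<forall>a. 0 \<le> f a) \<and> norm_nu d f = 1 \<and>
       (\<forall>a. L_op d h f a = lambda_h d h * f a))"

definition chi :: "nat \<Rightarrow> real \<Rightarrow> real" where
  "chi d = chi_h d (h_star d)"

definition C1 :: "nat \<Rightarrow> real" where
  "C1 d = 1 / Gamma (1/2) *
     sqrt (2 * real d / (real d - 1) *
       ((\<integral>x. chi d x \<partial>nu d) / (\<integral>x. chi d x * (chi d x)\<^sup>2 \<partial>nu d)))"

end

theory Submission
  imports Defs "HOL-Real_Asymp.Real_Asymp"
begin

text \<open>
  Under \<open>P_a\<close> the cluster in \<open>T^+\<close> is a branching process with types in \<open>[h, \<infinity>)\<close>, and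
  \<open>u_s(a) = 1 - E_a[exp (- s |C|)]\<close> solves \<open>u = 1 - exp (- s) (1 - Q u)^d\<close> with \<open>L_h = d Q\<close>.
  The critical level enters through two perturbation arguments: a nonzero survival probability
  at \<open>h*\<close> would survive a small increase of the level, and a finite solution of \<open>g = 1 + L g\<close>
  (the expected cluster size) a small decrease. Hence \<open>u_s\<close> tends to 0 but is not of order \<open>s\<close>.
  The functions \<open>u_s\<close> are increasing and, after normalisation, dominated by a multiple of
  \<open>1 + x^2\<close>, so Helly's theorem yields limits \<open>f\<close> with \<open>f = L f\<close>. Such a positive fixed point of the
  symmetric kernel forces \<open>\<lambda> = 1\<close> by the Schur test and is unique up to scaling; therefore
  \<open>f\<close> is a multiple of \<open>\<chi>\<close>. Integrating the equation for \<open>u_s\<close> against \<open>f\<close> cancels the linear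
  term, and the quadratic term gives the constant in \<open>u_s ~ const \<chi> sqrt s\<close>. Karamata's
  Tauberian theorem turns this into the tail of \<open>|C|\<close>.
\<close>

section \<open>A Tauberian theorem\<close>

text \<open>\<open>h_star\<close> is given by percolation only, so the eigenvalue 1 and the definite
  description behind \<open>chi\<close> must both come out of the asymptotic analysis, through the
  limit \<open>f\<close>. The obstacle is the unbounded type space. It is met by the weight
  \<open>1 + x^2\<close>: a step takes \<open>a\<close> to \<open>a / d\<close> plus noise, so
  \<open>d Q\<close> sends the weight to at most \<open>2 d + 1 + a^2 / d\<close>, a contraction far
  out; the same bound gives supersolutions at high levels. Compactness yields limits along
  subsequences only. With \<open>I1\<close>, \<open>I3\<close> the integrals of \<open>f\<close>,
  \<open>f^3\<close> over \<open>[h, \<infinity>)\<close>, the quantity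
  \<open>f(a) sqrt (I1 / I3)\<close> is invariant under scaling of \<open>f\<close>, so the constant
  is the same for all subsequences. If \<open>m\<close> is the value of \<open>u_s\<close> at the
  normalisation point, the balance reads \<open>s I1 ~ m^2 (d - 1) / (2 d) I3\<close>; here
  \<open>(d - 1) / (2 d)\<close> is \<open>d (d - 1) / 2\<close> divided by \<open>d^2\<close>, the
  square coming from \<open>Q f = f / d\<close>. The factor \<open>(d + 1) / d\<close> arises
  because to first order the tail is linear in the number of children of the root.\<close>

lemma weak_convergence_of_moments:
  fixes M :: "'i \<Rightarrow> 'a measure" and N :: "'a measure" and X :: "'a \<Rightarrow> real"
  assumes fin: "eventually (\<lambda>i. finite_measure (M i)) F" "finite_measure N"
    and meas: "\<And>i. X \<in> borel_measurable (M i)" "X \<in> borel_measurable N"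
    and range: "\<And>x. X x \<in> {0..1}"
    and moments: "\<And>k. ((\<lambda>i. \<integral>x. X x ^ k \<partial>M i) \<longlongrightarrow> (\<integral>x. X x ^ k \<partial>N)) F"
    and cont: "continuous_on {0..1} (\<phi> :: real \<Rightarrow> real)"
  shows "((\<lambda>i. \<integral>x. \<phi> (X x) \<partial>M i) \<longlongrightarrow> (\<integral>x. \<phi> (X x) \<partial>N)) F"
proof (rule tendstoI)
  fix e :: real assume "e > 0"
  define c where "c = measure N (space N)"
  have c: "c \<ge> 0" by (simp add: c_def)
  \<comment> \<open>Three errors are added below: \<open>\<epsilon> (c + 1)\<close> for
    \<open>M i\<close>, \<open>\<epsilon>\<close> for the moments and \<open>\<epsilon> c\<close>
    for \<open>N\<close>; each is at most \<open>e / 3\<close>.\<close>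
  define \<epsilon> where "\<epsilon> = e / (3 * (c + 1))"
  have \<epsilon>: "\<epsilon> > 0" using \<open>e > 0\<close> c by (simp add: \<epsilon>_def)
  \<comment> \<open>Weierstrass: as \<open>X\<close> takes values in \<open>[0, 1]\<close>,
    polynomials, hence moments, control every continuous test function.\<close>
  obtain p where p: "real_polynomial_function p" "\<And>x. x \<in> {0..1} \<Longrightarrow> \<bar>\<phi> x - p x\<bar> < \<epsilon>"
    using Stone_Weierstrass_real_polynomial_function[of "{0..1::real}" \<phi> \<epsilon>] cont \<epsilon> by auto
  obtain b n where pn: "p = (\<lambda>x. \<Sum>i\<le>n. b i * x ^ i)"
    using p(1) real_polynomial_function_iff_sum by blast
  obtain B where B: "\<And>x. x \<in> {0..1} \<Longrightarrow> \<bar>\<phi> x\<bar> \<le> B"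
    using compact_imp_bounded[OF compact_continuous_image[OF cont]] unfolding bounded_iff by fastforce
  have \<phi>_meas: "(\<lambda>x. \<phi> (X x)) \<in> borel_measurable K" if "X \<in> borel_measurable K" for K
  proof -
    have "(\<lambda>x. indicat_real {0..1} x *\<^sub>R \<phi> x) \<in> borel_measurable borel"
      using borel_measurable_continuous_on_indicator[OF _ cont] by simp
    then have "(\<lambda>x. indicat_real {0..1} (X x) *\<^sub>R \<phi> (X x)) \<in> borel_measurable K"
      using that by (rule measurable_compose_rev)
    then show ?thesis using range by simp
  qed
  have int: "integrable K (\<lambda>x. \<phi> (X x))" "integrable K (\<lambda>x. X x ^ k)"
    "\<bar>(\<integral>x. \<phi> (X x) \<partial>K) - (\<integral>x. p (X x) \<partial>K)\<bar> \<le> \<epsilon> * measure K (space K)"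
    if K: "finite_measure K" "X \<in> borel_measurable K" for K k
  proof -
    interpret finite_measure K by fact
    show 1: "integrable K (\<lambda>x. \<phi> (X x))"
      by (rule integrable_const_bound[of _ B]) (use range B \<phi>_meas K in auto)
    show 2: "integrable K (\<lambda>x. X x ^ k)" for k
      by (rule integrable_const_bound[of _ 1]) (use range K in \<open>auto intro!: power_le_one\<close>)
    have 3: "integrable K (\<lambda>x. p (X x))" unfolding pn using 2 by auto
    have "\<bar>(\<integral>x. \<phi> (X x) \<partial>K) - (\<integral>x. p (X x) \<partial>K)\<bar> = \<bar>\<integral>x. \<phi> (X x) - p (X x) \<partial>K\<bar>"
      using 1 3 by simp
    also have "\<dots> \<le> (\<integral>x. \<epsilon> \<partial>K)"
      by (rule order_trans[OF integral_abs_bound], rule integral_mono)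
        (use 1 3 p(2) range in \<open>auto intro: less_imp_le\<close>)
    finally show "\<bar>(\<integral>x. \<phi> (X x) \<partial>K) - (\<integral>x. p (X x) \<partial>K)\<bar> \<le> \<epsilon> * measure K (space K)"
      by (simp add: mult.commute)
  qed
  have p_int: "(\<integral>x. p (X x) \<partial>K) = (\<Sum>i\<le>n. b i * (\<integral>x. X x ^ i \<partial>K))"
    if "finite_measure K" "X \<in> borel_measurable K" for K
    unfolding pn using int[OF that] by simp
  have "((\<lambda>i. \<Sum>k\<le>n. b k * (\<integral>x. X x ^ k \<partial>M i)) \<longlongrightarrow> (\<Sum>k\<le>n. b k * (\<integral>x. X x ^ k \<partial>N))) F"
    by (intro tendsto_intros moments)
  then have ev1: "eventually (\<lambda>i. \<bar>(\<Sum>k\<le>n. b k * (\<integral>x. X x ^ k \<partial>M i)) - (\<integral>x. p (X x) \<partial>N)\<bar> < \<epsilon>) F"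
    using \<epsilon> fin(2) meas(2) p_int[of N] by (auto simp: tendsto_iff dist_real_def)
  \<comment> \<open>The total masses are not fixed; the moment of order 0 bounds them
    eventually.\<close>
  have ev2: "eventually (\<lambda>i. measure (M i) (space (M i)) < c + 1) F"
    using moments[of 0] by (intro order_tendstoD(2)[of _ c]) (simp_all add: c_def)
  show "eventually (\<lambda>i. dist (\<integral>x. \<phi> (X x) \<partial>M i) (\<integral>x. \<phi> (X x) \<partial>N) < e) F"
    using ev1 ev2 fin(1)
  proof eventually_elim
    case (elim i)
    have "\<bar>(\<integral>x. \<phi> (X x) \<partial>M i) - (\<integral>x. p (X x) \<partial>M i)\<bar> \<le> \<epsilon> * measure (M i) (space (M i))"
      by (rule int) (use elim meas in auto)
    also have "\<dots> \<le> \<epsilon> * (c + 1)" using elim \<epsilon> by (intro mult_left_mono) auto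
    finally have 1: "\<bar>(\<integral>x. \<phi> (X x) \<partial>M i) - (\<integral>x. p (X x) \<partial>M i)\<bar> \<le> \<epsilon> * (c + 1)" .
    have 2: "\<bar>(\<integral>x. \<phi> (X x) \<partial>N) - (\<integral>x. p (X x) \<partial>N)\<bar> \<le> \<epsilon> * c"
      unfolding c_def by (rule int) (use fin meas in auto)
    have 3: "\<bar>(\<integral>x. p (X x) \<partial>M i) - (\<integral>x. p (X x) \<partial>N)\<bar> < \<epsilon>"
      using elim p_int[of "M i"] meas by simp
    have "3 * (\<epsilon> * (c + 1)) = e" using c by (simp add: \<epsilon>_def field_simps)
    moreover have "\<epsilon> \<le> \<epsilon> * (c + 1)" "\<epsilon> * c \<le> \<epsilon> * (c + 1)" using c \<epsilon> by (auto simp: algebra_simps)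
    ultimately show ?case using 1 2 3 unfolding dist_real_def by linarith
  qed
qed

section \<open>Gamma integrals and Karamata's theorem with exponent 1/2\<close>

lemma exp_integral_Ioi:
  fixes u :: real assumes "u > 0"
  shows "integrable lborel (\<lambda>x. indicator {0<..} x * exp (- (u * x)))"
    and "(\<integral>x. indicator {0<..} x * exp (- (u * x)) \<partial>lborel) = 1 / u"
  using integrable_I0i_exp_mscale[OF assms] LBINT_I0i_exp_mscale[OF assms]
  by (simp_all add: set_integrable_def set_lebesgue_integral_def mult.commute
      interval_lebesgue_integral_0_infty)

text \<open>Euler's integral for Gamma(1/2) after the substitution \<open>t = u x\<close>; it
  evaluates the moments of the limit measure in Karamata's argument.\<close>

lemma gamma_half_integral:
  fixes u :: real assumes u: "u > 0"
  shows "has_bochner_integral lborel (\<lambda>x. indicator {0<..} x * exp (- (u * x)) * x powr (-1/2)) (sqrt pi / sqrt u)"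
proof -
  have "ennreal (sqrt pi) = (\<integral>\<^sup>+t. ennreal (indicator {0..} t * t powr (1/2 - 1) / exp t) \<partial>lborel)"
    using Gamma_conv_nn_integral_real[of "1/2"] by (simp add: Gamma_one_half_real)
  also have "\<dots> = (\<integral>\<^sup>+t. ennreal (indicator {0<..} t * exp (- t) * t powr (-1/2)) \<partial>lborel)"
    by (intro nn_integral_cong arg_cong[where f=ennreal]) (auto simp: indicator_def exp_minus field_simps)
  also have "\<dots> = ennreal u * (\<integral>\<^sup>+t. ennreal (indicator {0<..} (u * t) * exp (- (u * t)) * (u * t) powr (-1/2)) \<partial>lborel)"
    by (subst nn_integral_real_affine[of _ u 0]) (use u in auto)
  also have "\<dots> = ennreal u * (\<integral>\<^sup>+t. ennreal (u powr (-1/2)) * ennreal (indicator {0<..} t * exp (- (u * t)) * t powr (-1/2)) \<partial>lborel)"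
    using u by (intro arg_cong2[where f="(*)"] nn_integral_cong refl)
      (auto simp: indicator_def powr_mult zero_less_mult_iff ennreal_mult'[symmetric] mult_ac)
  also have "\<dots> = ennreal (sqrt u) * (\<integral>\<^sup>+t. ennreal (indicator {0<..} t * exp (- (u * t)) * t powr (-1/2)) \<partial>lborel)"
  proof -
    have "u * u powr (-1/2) = sqrt u"
      using u powr_mult_base[of u "-1/2"] by (simp add: powr_half_sqrt)
    then show ?thesis using u
      by (subst nn_integral_cmult) (auto simp: ennreal_mult'[symmetric] mult.assoc[symmetric])
  qed
  finally have eq: "ennreal (sqrt pi) = ennreal (sqrt u) * (\<integral>\<^sup>+t. ennreal (indicator {0<..} t * exp (- (u * t)) * t powr (-1/2)) \<partial>lborel)" .
  have "(\<integral>\<^sup>+t. ennreal (indicator {0<..} t * exp (- (u * t)) * t powr (-1/2)) \<partial>lborel)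
      = ennreal (1 / sqrt u) * (ennreal (sqrt u) * (\<integral>\<^sup>+t. ennreal (indicator {0<..} t * exp (- (u * t)) * t powr (-1/2)) \<partial>lborel))"
    using u by (simp add: mult.assoc[symmetric] ennreal_mult'[symmetric])
  also have "\<dots> = ennreal (sqrt pi / sqrt u)"
    unfolding eq[symmetric] using u by (simp add: ennreal_mult'[symmetric])
  finally show ?thesis
    using u by (intro has_bochner_integral_nn_integral) auto
qed

text \<open>Karamata's method: after rescaling by \<open>s\<close>, the moments of
  \<open>exp (- v)\<close> are Laplace transforms at the points \<open>(k + 1) s\<close>, so the
  hypothesis determines all limiting moments. Monotonicity of \<open>T\<close> then allows passing
  from averages of \<open>T\<close> to \<open>T\<close> itself.\<close>

lemma karamata_tauberian_half:
  fixes T :: "real \<Rightarrow> real"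
  assumes T: "\<And>x y. 0 \<le> x \<Longrightarrow> x \<le> y \<Longrightarrow> T y \<le> T x" "\<And>x. 0 \<le> T x" "\<And>x. T x \<le> 1"
      and Tm[measurable]: "T \<in> borel_measurable borel"
      and C: "C > 0"
      and lim: "((\<lambda>s. sqrt s * (\<integral>t. indicator {0<..} t * exp (- (s * t)) * T t \<partial>lborel)) \<longlongrightarrow> C) (at_right 0)"
  shows "((\<lambda>t. sqrt t * T t) \<longlongrightarrow> C / sqrt pi) at_top"
proof -
  define c where "c = C / sqrt pi"
  have c: "c > 0" using C by (simp add: c_def)
  \<comment> \<open>The weight \<open>exp (- v)\<close> makes the measure finite and shifts the
    exponent \<open>k\<close> to \<open>k + 1\<close>, so that the moment of order 0 is a Laplace
    transform too.\<close>
  define M where "M s = density lborel (\<lambda>v. ennreal (indicator {0<..} v * exp (- v) * (T (v / s) / sqrt s)))" for s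
  define N where "N = density lborel (\<lambda>v. ennreal (c * (indicator {0<..} v * exp (- v) * v powr (-1/2))))"
  define X :: "real \<Rightarrow> real" where "X v = (if v > 0 then exp (- v) else 0)" for v
  have [measurable]: "X \<in> borel_measurable borel" unfolding X_def by measurable
  have [simp]: "sets (M s) = sets borel" "sets N = sets borel" "space (M s) = UNIV" for s
    by (auto simp: M_def N_def)
  have [simp]: "f \<in> borel_measurable (M s) \<longleftrightarrow> f \<in> borel_measurable borel"
     "f \<in> borel_measurable N \<longleftrightarrow> f \<in> borel_measurable borel" for s and f :: "real \<Rightarrow> real"
    by (auto simp: measurable_def N_def M_def)
  have intM: "(\<integral>v. f v \<partial>M s) = (\<integral>v. indicator {0<..} v * exp (- v) * (T (v / s) / sqrt s) * f v \<partial>lborel)"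
    if "s > 0" "f \<in> borel_measurable borel" for s and f :: "real \<Rightarrow> real"
    unfolding M_def by (subst integral_density) (use that T in auto)
  have intN: "(\<integral>v. f v \<partial>N) = (\<integral>v. c * (indicator {0<..} v * exp (- v) * v powr (-1/2)) * f v \<partial>lborel)"
    if "f \<in> borel_measurable borel" for f :: "real \<Rightarrow> real"
    unfolding N_def by (subst integral_density) (use that c in auto)
  have base: "integrable lborel (\<lambda>v. indicator {0<..} v * exp (- v) * (T (v / s) / sqrt s))" if "s > 0" for s
  proof (rule Bochner_Integration.integrable_bound)
    show "integrable lborel (\<lambda>x. (1 / sqrt s) * (indicator {0<..} x * exp (- (1 * x))))"
      by (intro integrable_mult_right exp_integral_Ioi) auto
    show "AE x in lborel. norm (indicator {0<..} x * exp (- x) * (T (x / s) / sqrt s))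
        \<le> norm ((1 / sqrt s) * (indicator {0<..} x * exp (- (1 * x))))"
      using T(2,3) that by (intro AE_I2) (auto simp: indicator_def field_simps abs_mult)
  qed simp
  have finM: "finite_measure (M s)" if "s > 0" for s
  proof (rule finite_measureI)
    have "emeasure (M s) (space (M s)) = (\<integral>\<^sup>+v. ennreal (indicator {0<..} v * exp (- v) * (T (v / s) / sqrt s)) \<partial>lborel)"
      unfolding M_def by (subst emeasure_density) auto
    then show "emeasure (M s) (space (M s)) \<noteq> \<infinity>"
      using base[OF that] T that by (subst (asm) nn_integral_eq_integral) auto
  qed
  have finN: "finite_measure N"
  proof (rule finite_measureI)
    have "emeasure N (space N) = (\<integral>\<^sup>+v. ennreal (c * (indicator {0<..} v * exp (- v) * v powr (-1/2))) \<partial>lborel)"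
      unfolding N_def by (subst emeasure_density) auto
    then show "emeasure N (space N) \<noteq> \<infinity>"
      using gamma_half_integral[of 1] c by (subst (asm) nn_integral_eq_integral) (auto simp: has_bochner_integral_iff)
  qed
  have pos: "eventually (\<lambda>s::real. s > 0) (at_right 0)" by (simp add: eventually_at_right_less)
  have momM: "(\<integral>v. X v ^ k \<partial>M s) = (sqrt (real (Suc k) * s) *
      (\<integral>t. indicator {0<..} t * exp (- ((real (Suc k) * s) * t)) * T t \<partial>lborel)) / sqrt (real (Suc k))" if "s > 0" for s k
  proof -
    have "(\<integral>v. X v ^ k \<partial>M s) = (\<integral>v. indicator {0<..} v * exp (- (real (Suc k) * v)) * (T (v / s) / sqrt s) \<partial>lborel)"
      by (subst intM[OF that], simp, intro Bochner_Integration.integral_cong refl)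
         (auto simp: X_def indicator_def exp_of_nat_mult[symmetric] mult_exp_exp algebra_simps)
    also have "\<dots> = s * (\<integral>t. indicator {0<..} (s*t) * exp (- (real (Suc k) * (s*t))) * (T t / sqrt s) \<partial>lborel)"
      by (subst lborel_integral_real_affine[of s _ 0]) (use that in auto)
    also have "\<dots> = s * (\<integral>t. (1 / sqrt s) * (indicator {0<..} t * exp (- ((real (Suc k) * s) * t)) * T t) \<partial>lborel)"
      using that by (intro arg_cong2[where f="(*)" and a=s] refl Bochner_Integration.integral_cong)
         (auto simp: indicator_def zero_less_mult_iff mult_ac)
    also have "\<dots> = sqrt s * (\<integral>t. (indicator {0<..} t * exp (- ((real (Suc k) * s) * t)) * T t) \<partial>lborel)"
      using that real_div_sqrt[of s]
      by (subst integral_mult_right_zero) (simp only: mult.assoc[symmetric], simp)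
    finally show ?thesis by (simp add: real_sqrt_mult)
  qed
  have momN: "(\<integral>v. X v ^ k \<partial>N) = C / sqrt (real (Suc k))" for k
  proof -
    have "(\<integral>v. X v ^ k \<partial>N) = (\<integral>v. c * (indicator {0<..} v * exp (- (real (Suc k) * v)) * v powr (-1/2)) \<partial>lborel)"
      by (subst intN, simp, intro Bochner_Integration.integral_cong refl)
         (auto simp: X_def indicator_def exp_of_nat_mult[symmetric] mult_exp_exp algebra_simps)
    also have "\<dots> = c * (sqrt pi / sqrt (real (Suc k)))"
      using gamma_half_integral[of "real (Suc k)"]
      by (subst integral_mult_right_zero) (simp add: has_bochner_integral_iff)
    finally show ?thesis by (simp add: c_def)
  qed
  have scaled: "filterlim (\<lambda>s. real (Suc k) * s) (at_right 0) (at_right 0)" for k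
    by real_asymp
  have conv: "((\<lambda>s. \<integral>v. \<phi> (X v) \<partial>M s) \<longlongrightarrow> (\<integral>v. \<phi> (X v) \<partial>N)) (at_right 0)"
    if "continuous_on {0..1} \<phi>" for \<phi> :: "real \<Rightarrow> real"
  proof (rule weak_convergence_of_moments[OF _ finN _ _ _ _ that])
    show "eventually (\<lambda>s. finite_measure (M s)) (at_right 0)"
      using pos by eventually_elim (rule finM)
    show "((\<lambda>s. \<integral>v. X v ^ k \<partial>M s) \<longlongrightarrow> (\<integral>v. X v ^ k \<partial>N)) (at_right 0)" for k
      unfolding momN
      by (rule Lim_transform_eventually[OF tendsto_divide[OF filterlim_compose[OF lim scaled] tendsto_const]])
        (use pos in \<open>auto elim!: eventually_mono simp: momM\<close>)
    show "X v \<in> {0..1}" for v by (auto simp: X_def)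
  qed auto
  text \<open>Testing against a bump supported on the image of \<open>[a, b]\<close> sandwiches \<open>T\<close>.\<close>
  have bump: "\<exists>K>0. \<exists>J. c * K / sqrt b \<le> J \<and> J \<le> c * K / sqrt a \<and>
      (\<exists>I. (I \<longlongrightarrow> J) (at_right 0) \<and>
        (\<forall>s>0. K * (T (b / s) / sqrt s) \<le> I s \<and> I s \<le> K * (T (a / s) / sqrt s)))"
    if ab: "0 < a" "a < b" for a b :: real
  proof -
    \<comment> \<open>As a function of \<open>x = exp (- v)\<close> this is positive exactly for
      \<open>a < v < b\<close>, that is, for \<open>x\<close> strictly between
      \<open>exp (- b)\<close> and \<open>exp (- a)\<close>.\<close>
    define \<phi> where "\<phi> x = max 0 ((x - exp (- b)) * (exp (- a) - x))" for x :: real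
    have \<phi>c: "continuous_on UNIV \<phi>" unfolding \<phi>_def by (intro continuous_intros)
    have [measurable]: "\<phi> \<in> borel_measurable borel"
      using \<phi>c by (rule borel_measurable_continuous_onI)
    have \<phi>0: "\<phi> x \<ge> 0" for x by (simp add: \<phi>_def)
    have \<phi>1: "\<phi> (exp (-v)) = 0" if "v \<notin> {a..b}" for v
    proof -
      from that have "v < a \<or> v > b" by auto
      then have "(exp (-v) - exp (- b)) * (exp (- a) - exp (-v)) \<le> 0"
        using ab by (auto simp: mult_le_0_iff)
      then show ?thesis by (simp add: \<phi>_def)
    qed
    have \<phi>pos: "\<phi> (exp (-v)) > 0" if "v \<in> {a<..<b}" for v
      using that by (auto simp: \<phi>_def intro!: less_max_iff_disj[THEN iffD2])
    have \<phi>le: "\<phi> (exp (-v)) \<le> 1" for v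
    proof (cases "v \<in> {a..b}")
      case True
      then have "(exp (-v) - exp (- b)) * (exp (- a) - exp (-v)) \<le> 1 * 1"
        using ab by (intro mult_mono) (auto intro: order_trans[of _ "exp(-v)"] order_trans[of _ "exp (-a)"] simp: le_diff_eq diff_le_eq add_increasing2)
      then show ?thesis by (simp add: \<phi>_def)
    qed (simp add: \<phi>1)
    define \<psi> where "\<psi> v = indicator {0<..} v * exp (- v) * \<phi> (exp (- v))" for v :: real
    have \<psi>m[measurable]: "\<psi> \<in> borel_measurable borel" unfolding \<psi>_def by measurable
    have \<psi>0: "\<psi> v \<ge> 0" for v by (simp add: \<psi>_def \<phi>0)
    have \<psi>1: "\<psi> v = 0" if "v \<notin> {a..b}" for v using \<phi>1[OF that] by (simp add: \<psi>_def)
    have \<psi>int: "integrable lborel \<psi>"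
    proof (rule Bochner_Integration.integrable_bound)
      show "integrable lborel (\<lambda>x. indicat_real {0<..} x * exp (- (1 * x)))"
        by (intro exp_integral_Ioi) auto
      show "AE x in lborel. norm (\<psi> x) \<le> norm (indicator {0<..} x * exp (- (1 * x)) :: real)"
        using \<phi>0 \<phi>le by (intro AE_I2) (auto simp: \<psi>_def indicator_def abs_mult)
    qed simp
    define K where "K = (\<integral>v. \<psi> v \<partial>lborel)"
    have "K > 0"
    proof (rule ccontr)
      assume "\<not> K > 0"
      moreover have "K \<ge> 0" unfolding K_def by (rule integral_nonneg_AE) (simp add: \<psi>0)
      ultimately have "K = 0" by linarith
      then have "AE v in lborel. \<psi> v = 0"
        using integral_nonneg_eq_0_iff_AE[OF \<psi>int] \<psi>0 by (simp add: K_def)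
      then have "AE v in lborel. v \<notin> {a<..<b}"
        by eventually_elim (use \<phi>pos ab in \<open>force simp: \<psi>_def\<close>)
      then have "emeasure lborel {a<..<b} = 0"
        by (subst (asm) AE_iff_measurable[of "{a<..<b}"]) auto
      then show False using ab by simp
    qed
    have \<psi>X: "indicator {0<..} v * exp (- v) * r * \<phi> (X v) = \<psi> v * r" for v r
      by (auto simp: \<psi>_def X_def indicator_def)
    define J where "J = (\<integral>v. \<phi> (X v) \<partial>N)"
    define I where "I s = (\<integral>v. \<phi> (X v) \<partial>M s)" for s
    have Jeq: "J = (\<integral>v. \<psi> v * (c * v powr (-1/2)) \<partial>lborel)"
      unfolding J_def by (subst intN, simp, rule Bochner_Integration.integral_cong)
        (simp_all add: \<psi>X[symmetric] mult_ac)
    have Ieq: "I s = (\<integral>v. \<psi> v * (T (v / s) / sqrt s) \<partial>lborel)" if "s > 0" for s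
      unfolding I_def by (subst intM[OF that], simp) (simp add: \<psi>X)
    have sand: "K * l \<le> (\<integral>v. \<psi> v * g v \<partial>lborel) \<and> (\<integral>v. \<psi> v * g v \<partial>lborel) \<le> K * u"
      if g: "g \<in> borel_measurable borel" "\<And>v. v \<in> {a..b} \<Longrightarrow> l \<le> g v \<and> g v \<le> u" for g l u
    proof -
      have bd: "\<psi> v * l \<le> \<psi> v * g v" "\<psi> v * g v \<le> \<psi> v * u" for v
        using g(2)[of v] \<psi>0[of v] \<psi>1[of v] by (cases "v \<in> {a..b}"; auto intro!: mult_left_mono)+
      have int: "integrable lborel (\<lambda>v. \<psi> v * g v)"
      proof (rule Bochner_Integration.integrable_bound)
        show "integrable lborel (\<lambda>v. \<psi> v * (\<bar>l\<bar> + \<bar>u\<bar>))" using \<psi>int by simp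
        show "AE v in lborel. norm (\<psi> v * g v) \<le> norm (\<psi> v * (\<bar>l\<bar> + \<bar>u\<bar>))"
        proof (intro AE_I2)
          fix v
          have "\<psi> v * \<bar>g v\<bar> \<le> \<psi> v * (\<bar>l\<bar> + \<bar>u\<bar>)"
            using g(2)[of v] \<psi>0[of v] \<psi>1[of v] by (cases "v \<in> {a..b}"; auto intro!: mult_left_mono)
          then show "norm (\<psi> v * g v) \<le> norm (\<psi> v * (\<bar>l\<bar> + \<bar>u\<bar>))" using \<psi>0[of v] by (simp add: abs_mult)
        qed
      qed (use g in measurable)
      have "(\<integral>v. \<psi> v * l \<partial>lborel) \<le> (\<integral>v. \<psi> v * g v \<partial>lborel)" "(\<integral>v. \<psi> v * g v \<partial>lborel) \<le> (\<integral>v. \<psi> v * u \<partial>lborel)"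
        by ((rule integral_mono; use bd int \<psi>int in simp))+
      then show ?thesis by (simp add: K_def)
    qed
    have "K * (c / sqrt b) \<le> J \<and> J \<le> K * (c / sqrt a)"
      unfolding Jeq using ab c
      by (intro sand) (auto simp: powr_minus powr_half_sqrt field_simps)
    moreover have "K * (T (b / s) / sqrt s) \<le> I s \<and> I s \<le> K * (T (a / s) / sqrt s)" if "s > 0" for s
      unfolding Ieq[OF that] using ab that
      by (intro sand) (auto intro!: divide_right_mono T(1))
    moreover have "(I \<longlongrightarrow> J) (at_right 0)"
      unfolding I_def J_def by (rule conv) (rule continuous_on_subset[OF \<phi>c], simp)
    ultimately show ?thesis using \<open>K > 0\<close>
      by (intro exI[of _ K] conjI exI[of _ J] exI[of _ I]) (auto simp: mult.commute)
  qed
  \<comment> \<open>\<open>T\<close> is antitone, so averaging over \<open>[1, b]\<close> with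
    \<open>b > 1\<close> bounds \<open>T (1 / s)\<close> from below, with constant
    \<open>c / sqrt b\<close>; nothing is lost as \<open>b\<close> tends to 1. The upper bound
    averages over \<open>[b, 1]\<close> with \<open>b < 1\<close>.\<close>
  have low: "eventually (\<lambda>s. l < T (1 / s) / sqrt s) (at_right 0)" if "l < c" for l
  proof -
    have "((\<lambda>b. c / sqrt b) \<longlongrightarrow> c / sqrt 1) (at_right 1)" by (intro tendsto_intros) auto
    then have "eventually (\<lambda>b. l < c / sqrt b) (at_right 1)" using that by (intro order_tendstoD(1)) auto
    moreover have "eventually (\<lambda>b::real. b > 1) (at_right 1)" by (simp add: eventually_at_right_less)
    ultimately have "eventually (\<lambda>b. l < c / sqrt b \<and> b > 1) (at_right 1)" by eventually_elim simp
    from eventually_happens'[OF _ this] obtain b where b: "b > 1" "l < c / sqrt b"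
      by (auto simp: trivial_limit_at_right_real)
    obtain K J I where KJ: "K > 0" "c * K / sqrt b \<le> J" "(I \<longlongrightarrow> J) (at_right 0)"
      "\<And>s. s > 0 \<Longrightarrow> I s \<le> K * (T (1 / s) / sqrt s)" using bump[of 1 b] b by auto
    have "K * l < J" using KJ(1,2) mult_strict_left_mono[OF b(2) KJ(1)] by (simp add: mult_ac)
    then have "eventually (\<lambda>s. K * l < I s) (at_right 0)" using KJ(3) by (rule order_tendstoD(1)[rotated])
    then show ?thesis using pos
    proof eventually_elim
      case (elim s)
      then have "K * l < K * (T (1 / s) / sqrt s)" using KJ(4)[of s] by linarith
      then show ?case using KJ(1) by (simp only: mult_less_cancel_left_pos)
    qed
  qed
  have up: "eventually (\<lambda>s. T (1 / s) / sqrt s < u) (at_right 0)" if "c < u" for u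
  proof -
    have "((\<lambda>b. c / sqrt b) \<longlongrightarrow> c / sqrt 1) (at_left 1)" by (intro tendsto_intros) auto
    then have "eventually (\<lambda>b. c / sqrt b < u) (at_left 1)" using that by (intro order_tendstoD(2)) auto
    moreover have "eventually (\<lambda>b::real. b \<in> {0<..<1}) (at_left 1)" by (rule eventually_at_leftI[of 0]) auto
    ultimately have "eventually (\<lambda>b. c / sqrt b < u \<and> b \<in> {0<..<1}) (at_left 1)" by eventually_elim simp
    from eventually_happens'[OF _ this] obtain b where b: "0 < b" "b < 1" "c / sqrt b < u"
      by (auto simp: trivial_limit_at_left_real)
    obtain K J I where KJ: "K > 0" "J \<le> c * K / sqrt b" "(I \<longlongrightarrow> J) (at_right 0)"
      "\<And>s. s > 0 \<Longrightarrow> K * (T (1 / s) / sqrt s) \<le> I s" using bump[of b 1] b by auto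
    have "J < K * u" using KJ(1,2) mult_strict_left_mono[OF b(3) KJ(1)] by (simp add: mult_ac)
    then have "eventually (\<lambda>s. I s < K * u) (at_right 0)" using KJ(3) by (rule order_tendstoD(2)[rotated])
    then show ?thesis using pos
    proof eventually_elim
      case (elim s)
      then have "K * (T (1 / s) / sqrt s) < K * u" using KJ(4)[of s] by linarith
      then show ?case using KJ(1) by (simp only: mult_less_cancel_left_pos)
    qed
  qed
  have "((\<lambda>s. T (1 / s) / sqrt s) \<longlongrightarrow> c) (at_right 0)"
    using low up by (auto simp: order_tendsto_iff)
  then have "((\<lambda>t. T (1 / inverse t) / sqrt (inverse t)) \<longlongrightarrow> c) at_top"
    by (rule filterlim_compose[OF _ filterlim_inverse_at_right_top])
  then show ?thesis
    by (simp add: real_sqrt_inverse c_def divide_inverse mult.commute)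
qed

section \<open>The Gaussian transition operator\<close>

locale tree_degree =
  fixes d :: nat
  assumes d_ge_2: "2 \<le> d"
begin

lemma d_pos [simp]: "0 < d" "d \<noteq> 0" using d_ge_2 by auto

text \<open>One step of the autoregression started at \<open>a\<close> and killed below
  \<open>h\<close>. Unlike \<open>L_op\<close> it has no cutoff in \<open>a\<close>, so that
  \<open>Q h f\<close> can be monotone and continuous across \<open>h\<close>.\<close>

definition Q :: "real \<Rightarrow> (real \<Rightarrow> real) \<Rightarrow> real \<Rightarrow> real" where
  "Q h f a = (LINT x:{h..}|lborel. f x * rho_Y d (x - a / real d))"

definition noise :: "real measure" where
  "noise = density lborel (rho_Y d)"

text \<open>A growth class on which Gaussian steps converge. Only values on
  \<open>[h, \<infinity>)\<close> are constrained because \<open>Q h\<close> sees no others.\<close>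

definition adm :: "real \<Rightarrow> real \<Rightarrow> (real \<Rightarrow> real) \<Rightarrow> bool" where
  "adm h B f \<longleftrightarrow> f \<in> borel_measurable borel \<and> (\<forall>x\<ge>h. 0 \<le> f x \<and> f x \<le> B * (1 + x\<^sup>2))"

section \<open>The Gaussian density and the law of the increments\<close>

lemma sigma_pos: "sigma_Y2 d > 0" "sigma_nu2 d > 0" "sqrt (sigma_Y2 d) > 0" "sqrt (sigma_nu2 d) > 0"
  using d_ge_2 by (auto simp: sigma_Y2_def sigma_nu2_def)

lemma rho_measurable [measurable]: "rho_Y d \<in> borel_measurable borel"
  by (simp add: rho_Y_def)

lemma rho_pos: "0 < rho_Y d x" and rho_nonneg [simp]: "0 \<le> rho_Y d x"
  using normal_density_pos[OF sigma_pos(3)] by (auto simp: rho_Y_def intro: less_imp_le)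

lemma rho_shift: "rho_Y d (x - m) = normal_density m (sqrt (sigma_Y2 d)) x"
  by (simp add: rho_Y_def normal_density_def)

text \<open>Both \<open>2 pi\<close> and the variance are at least 1. The bound makes the cost of
  moving the level proportional to the distance between the levels.\<close>

lemma rho_le: "rho_Y d x \<le> 1"
proof -
  have "sqrt 1 \<le> sqrt (2 * pi * sigma_Y2 d)"
  proof (rule real_sqrt_le_mono)
    have "1 \<le> 2 * pi" using pi_ge_two by linarith
    moreover have "1 \<le> sigma_Y2 d" using d_ge_2 by (simp add: sigma_Y2_def)
    ultimately show "1 \<le> 2 * pi * sigma_Y2 d" using mult_mono[of 1 "2*pi" 1 "sigma_Y2 d"] by simp
  qed
  then have "1 / sqrt (2 * pi * sigma_Y2 d) \<le> 1" by simp
  moreover have "exp (- x\<^sup>2 / (2 * sigma_Y2 d)) \<le> 1" using sigma_pos by simp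
  ultimately have "1 / sqrt (2 * pi * sigma_Y2 d) * exp (- x\<^sup>2 / (2 * sigma_Y2 d)) \<le> 1 * 1"
    by (intro mult_mono) auto
  then show ?thesis using sigma_pos by (simp add: rho_Y_def normal_density_def)
qed

lemma integrable_rho: "integrable lborel (\<lambda>x. rho_Y d (x - m))"
  unfolding rho_shift using sigma_pos(3) by simp

lemma integral_rho: "(\<integral>x. rho_Y d (x - m) \<partial>lborel) = 1"
  unfolding rho_shift using sigma_pos(3) by simp

text \<open>Expansion of \<open>1 + x^2\<close> around the mean \<open>m\<close>. For
  \<open>m = a / d\<close> the square is divided by \<open>d^2\<close>, which outweighs the factor
  \<open>d\<close> in \<open>L_op\<close>: the source of the contraction estimates.\<close>

lemma rho_weight: "has_bochner_integral lborel (\<lambda>x. (1 + x\<^sup>2) * rho_Y d (x - m)) (1 + sigma_Y2 d + m\<^sup>2)"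
proof -
  let ?n = "normal_density m (sqrt (sigma_Y2 d))"
  note s = sigma_pos(3)
  have 0: "has_bochner_integral lborel ?n 1"
    using s by (simp add: has_bochner_integral_iff)
  have 1: "has_bochner_integral lborel (\<lambda>x. ?n x * (x - m)) 0"
    using normal_moment_odd[OF s, of m 0] by simp
  have 2: "has_bochner_integral lborel (\<lambda>x. ?n x * (x - m)\<^sup>2) (sigma_Y2 d)"
    using normal_moment_even[OF s, of m 1] sigma_pos by (simp add: fact_numeral)
  have "has_bochner_integral lborel (\<lambda>x. ?n x * (x - m)\<^sup>2 + (2 * m) * (?n x * (x - m)) + (1 + m\<^sup>2) * ?n x)
      (sigma_Y2 d + (2 * m) * 0 + (1 + m\<^sup>2) * 1)"
    by (intro has_bochner_integral_add has_bochner_integral_mult_right 0 1 2)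
  then show ?thesis
    unfolding rho_shift by (rule has_bochner_integral_cong[THEN iffD1, rotated 3])
      (auto simp: power2_eq_square algebra_simps)
qed

lemma prob_noise: "prob_space noise"
  unfolding noise_def rho_Y_def by (rule prob_space_normal_density[OF sigma_pos(3)])

lemma sets_noise [simp, measurable_cong]: "sets noise = sets borel"
  by (simp add: noise_def)

lemma space_noise [simp]: "space noise = UNIV"
  by (simp add: noise_def)

lemma integral_noise:
  fixes g :: "real \<Rightarrow> real"
  assumes [measurable]: "g \<in> borel_measurable borel"
  shows "(\<integral>y. g (m + y) \<partial>noise) = (\<integral>x. g x * rho_Y d (x - m) \<partial>lborel)"
    and "integrable noise (\<lambda>y. g (m + y)) \<longleftrightarrow> integrable lborel (\<lambda>x. g x * rho_Y d (x - m))"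
proof -
  have "(\<integral>y. g (m + y) \<partial>noise) = (\<integral>y. rho_Y d y * g (m + y) \<partial>lborel)"
    unfolding noise_def by (subst integral_density) auto
  also have "\<dots> = (\<integral>x. g x * rho_Y d (x - m) \<partial>lborel)"
    by (subst lborel_integral_real_affine[of 1 _ "- m"]) (auto simp: mult.commute)
  finally show "(\<integral>y. g (m + y) \<partial>noise) = (\<integral>x. g x * rho_Y d (x - m) \<partial>lborel)" .
  have "integrable noise (\<lambda>y. g (m + y)) \<longleftrightarrow> integrable lborel (\<lambda>y. rho_Y d y * g (m + y))"
    unfolding noise_def by (subst integrable_density) auto
  also have "\<dots> \<longleftrightarrow> integrable lborel (\<lambda>x. g x * rho_Y d (x - m))"
    by (subst lborel_integrable_real_affine_iff[of 1 _ "- m", symmetric]) (auto simp: mult.commute)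
  finally show "integrable noise (\<lambda>y. g (m + y)) \<longleftrightarrow> integrable lborel (\<lambda>x. g x * rho_Y d (x - m))" .
qed

lemma AE_noise_shift:
  assumes "AE x in lborel. P x" shows "AE y in noise. P (m + y)"
proof -
  have "AE y in lborel. P (m + y)"
  proof -
    have "AE x in distr lborel borel ((+) m). P x"
      using assms unfolding lborel_distr_plus .
    then show ?thesis by (rule AE_distrD[rotated]) simp
  qed
  then show ?thesis unfolding noise_def by (subst AE_density) auto
qed

section \<open>The truncated operator on functions of quadratic growth\<close>

lemma adm_measurable: "adm h B f \<Longrightarrow> f \<in> borel_measurable borel"
  by (simp add: adm_def)

lemma Q_integrable_abs:
  assumes [measurable]: "f \<in> borel_measurable borel" and "\<And>x. h \<le> x \<Longrightarrow> \<bar>f x\<bar> \<le> B * (1 + x\<^sup>2)"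
  shows "integrable lborel (\<lambda>x. indicator {h..} x * f x * rho_Y d (x - m))"
proof (rule Bochner_Integration.integrable_bound)
  show "integrable lborel (\<lambda>x. \<bar>B\<bar> * ((1 + x\<^sup>2) * rho_Y d (x - m)))"
    using rho_weight by (intro integrable_mult_right) (auto simp: has_bochner_integral_iff)
  show "AE x in lborel. norm (indicator {h..} x * f x * rho_Y d (x - m)) \<le> norm (\<bar>B\<bar> * ((1 + x\<^sup>2) * rho_Y d (x - m)))"
  proof (intro AE_I2)
    fix x
    have "\<bar>f x\<bar> * rho_Y d (x - m) \<le> \<bar>B\<bar> * (1 + x\<^sup>2) * rho_Y d (x - m)" if "h \<le> x"
    proof (rule mult_right_mono)
      show "\<bar>f x\<bar> \<le> \<bar>B\<bar> * (1 + x\<^sup>2)"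
        using assms(2)[OF that] by (rule order_trans) (intro mult_right_mono, auto)
    qed simp
    then show "norm (indicator {h..} x * f x * rho_Y d (x - m)) \<le> norm (\<bar>B\<bar> * ((1 + x\<^sup>2) * rho_Y d (x - m)))"
      by (auto simp: indicator_def abs_mult mult.assoc)
  qed
qed measurable

lemma Q_integrable:
  "adm h B f \<Longrightarrow> integrable lborel (\<lambda>x. indicator {h..} x * f x * rho_Y d (x - m))"
  by (rule Q_integrable_abs[of _ _ B]) (auto simp: adm_def)

lemma Q_eq: "Q h f a = (\<integral>x. indicator {h..} x * f x * rho_Y d (x - a / real d) \<partial>lborel)"
  by (simp add: Q_def set_lebesgue_integral_def mult.assoc)

lemma Q_eq_noise:
  assumes [measurable]: "f \<in> borel_measurable borel"
  shows "Q h f a = (\<integral>y. indicator {h..} (a / real d + y) * f (a / real d + y) \<partial>noise)"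
  unfolding Q_eq by (subst integral_noise) simp_all

lemma noise_integrable:
  assumes "adm h B f"
  shows "integrable noise (\<lambda>y. indicator {h..} (m + y) * f (m + y))"
proof -
  have [measurable]: "f \<in> borel_measurable borel" using assms by (simp add: adm_def)
  show ?thesis
    using integral_noise(2)[of "\<lambda>x. indicator {h..} x * f x" m] Q_integrable[OF assms, of m] by simp
qed

lemma Q_mono:
  assumes "adm h B f" "adm h B' g" "\<And>x. h \<le> x \<Longrightarrow> f x \<le> g x"
  shows "Q h f a \<le> Q h g a"
  unfolding Q_eq by (rule integral_mono[OF Q_integrable Q_integrable])
    (use assms in \<open>auto simp: indicator_def intro!: mult_right_mono\<close>)

lemma Q_nonneg: "adm h B f \<Longrightarrow> 0 \<le> Q h f a"
  unfolding Q_eq by (rule integral_nonneg_AE) (auto simp: adm_def indicator_def)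

lemma Q_cong:
  assumes "\<And>x. h \<le> x \<Longrightarrow> f x = g x" shows "Q h f a = Q h g a"
  unfolding Q_eq using assms by (intro Bochner_Integration.integral_cong) (auto simp: indicator_def)

lemma Q_cong_AE:
  assumes [measurable]: "f \<in> borel_measurable borel" "g \<in> borel_measurable borel"
    and "AE x in lborel. h \<le> x \<longrightarrow> f x = g x"
  shows "Q h f a = Q h g a"
  unfolding Q_eq
proof (rule integral_cong_AE)
  show "AE x in lborel. indicator {h..} x * f x * rho_Y d (x - a / real d) = indicator {h..} x * g x * rho_Y d (x - a / real d)"
    using assms(3) by eventually_elim (auto simp: indicator_def)
qed measurable

lemma Q_cmult: "Q h (\<lambda>x. c * f x) a = c * Q h f a"
  unfolding Q_eq by (subst integral_mult_right_zero[symmetric]) (simp add: mult_ac)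

lemma Q_divide: "Q h (\<lambda>x. f x / c) a = Q h f a / c"
  using Q_cmult[of h "1 / c" f a] by simp

lemma Q_weight_le: "Q h (\<lambda>x. 1 + x\<^sup>2) a \<le> 1 + sigma_Y2 d + (a / real d)\<^sup>2"
proof -
  have "adm h 1 (\<lambda>x. 1 + x\<^sup>2)" by (simp add: adm_def)
  then have "Q h (\<lambda>x. 1 + x\<^sup>2) a \<le> (\<integral>x. (1 + x\<^sup>2) * rho_Y d (x - a / real d) \<partial>lborel)"
    unfolding Q_eq using rho_weight[of "a / real d"]
    by (intro integral_mono[OF Q_integrable]) (auto simp: has_bochner_integral_iff indicator_def)
  then show ?thesis using rho_weight[of "a / real d"] by (simp add: has_bochner_integral_iff)
qed

lemma Q_le_const:
  assumes "adm h B f" "\<And>x. h \<le> x \<Longrightarrow> f x \<le> c" "0 \<le> c"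
  shows "Q h f a \<le> c"
proof -
  have "Q h f a \<le> (\<integral>x. c * rho_Y d (x - a / real d) \<partial>lborel)"
    unfolding Q_eq by (intro integral_mono[OF Q_integrable[OF assms(1)]])
      (use assms integrable_rho in \<open>auto simp: indicator_def intro!: mult_right_mono\<close>)
  then show ?thesis by (simp add: integral_rho)
qed

lemma Q_le_weight:
  assumes "adm h B f" shows "Q h f a \<le> B * (1 + sigma_Y2 d + (a / real d)\<^sup>2)"
proof -
  have B: "0 \<le> B"
  proof -
    have "0 \<le> B * (1 + h\<^sup>2)" using assms unfolding adm_def by fastforce
    moreover have "1 + h\<^sup>2 > 0" by (simp add: add_pos_nonneg)
    ultimately show ?thesis by (simp add: zero_le_mult_iff)
  qed
  have "Q h f a \<le> Q h (\<lambda>x. B * (1 + x\<^sup>2)) a"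
    by (rule Q_mono[OF assms, of B]) (use assms B in \<open>auto simp: adm_def\<close>)
  also have "\<dots> \<le> B * (1 + sigma_Y2 d + (a / real d)\<^sup>2)"
    unfolding Q_cmult using Q_weight_le B by (intro mult_left_mono) auto
  finally show ?thesis .
qed

lemma Q_tendsto:
  assumes f: "\<And>n::nat. adm h B (f n)" and g: "g \<in> borel_measurable borel"
    and lim: "AE x in lborel. h \<le> x \<longrightarrow> (\<lambda>n. f n x) \<longlonglongrightarrow> g x"
  shows "(\<lambda>n. Q h (f n) a) \<longlonglongrightarrow> Q h g a"
  unfolding Q_eq
proof (rule integral_dominated_convergence)
  have [measurable]: "f n \<in> borel_measurable borel" for n using f by (simp add: adm_def)
  note [measurable] = g
  show "(\<lambda>x. indicator {h..} x * g x * rho_Y d (x - a / real d)) \<in> borel_measurable lborel"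
    "\<And>n. (\<lambda>x. indicator {h..} x * f n x * rho_Y d (x - a / real d)) \<in> borel_measurable lborel" by measurable
  show "integrable lborel (\<lambda>x. \<bar>B\<bar> * ((1 + x\<^sup>2) * rho_Y d (x - a / real d)))"
    using rho_weight by (intro integrable_mult_right) (auto simp: has_bochner_integral_iff)
  show "AE x in lborel. (\<lambda>n. indicator {h..} x * f n x * rho_Y d (x - a / real d)) \<longlonglongrightarrow> indicator {h..} x * g x * rho_Y d (x - a / real d)"
    using lim by eventually_elim (auto simp: indicator_def intro!: tendsto_intros)
  show "AE x in lborel. norm (indicator {h..} x * f n x * rho_Y d (x - a / real d)) \<le> \<bar>B\<bar> * ((1 + x\<^sup>2) * rho_Y d (x - a / real d))" for n
  proof (intro AE_I2)
    fix x
    have "f n x * rho_Y d (x - a / real d) \<le> \<bar>B\<bar> * (1 + x\<^sup>2) * rho_Y d (x - a / real d)" if "h \<le> x"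
    proof (rule mult_right_mono)
      have "f n x \<le> B * (1 + x\<^sup>2)" using f[of n] that by (simp add: adm_def)
      also have "\<dots> \<le> \<bar>B\<bar> * (1 + x\<^sup>2)" by (intro mult_right_mono) auto
      finally show "f n x \<le> \<bar>B\<bar> * (1 + x\<^sup>2)" .
    qed simp
    then show "norm (indicator {h..} x * f n x * rho_Y d (x - a / real d)) \<le> \<bar>B\<bar> * ((1 + x\<^sup>2) * rho_Y d (x - a / real d))"
      using f[of n] by (auto simp: indicator_def abs_mult mult.assoc adm_def)
  qed
qed

text \<open>Coupling: both starting points use the same increment \<open>y\<close>, and the
  truncated function is still increasing because \<open>f\<close> is nonnegative on
  \<open>[h, \<infinity>)\<close>.\<close>

lemma Q_mono_arg:
  assumes f: "adm h B f" and m: "\<And>x y. h \<le> x \<Longrightarrow> x \<le> y \<Longrightarrow> f x \<le> f y" and "a \<le> b"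
  shows "Q h f a \<le> Q h f b"
  unfolding Q_eq_noise[OF adm_measurable[OF f]]
proof (rule integral_mono[OF noise_integrable[OF f] noise_integrable[OF f]])
  fix y
  have "a / real d + y \<le> b / real d + y" using \<open>a \<le> b\<close> by (simp add: divide_right_mono)
  then show "indicator {h..} (a / real d + y) * f (a / real d + y) \<le> indicator {h..} (b / real d + y) * f (b / real d + y)"
    using m[of "a / real d + y" "b / real d + y"] f by (auto simp: indicator_def adm_def)
qed

text \<open>The truncation of \<open>f\<close> is monotone, hence discontinuous at countably many
  points only, and the Gaussian increment hits these with probability 0.\<close>

lemma Q_isCont:
  assumes fm: "f \<in> borel_measurable borel" and f01: "\<And>x. h \<le> x \<Longrightarrow> 0 \<le> f x \<and> f x \<le> 1"
    and m: "\<And>x y. h \<le> x \<Longrightarrow> x \<le> y \<Longrightarrow> f x \<le> f y"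
  shows "isCont (Q h f) a"
proof -
  define F where "F x = indicator {h..} x * f x" for x
  have [measurable]: "F \<in> borel_measurable borel" unfolding F_def using fm by measurable
  have "mono F" unfolding F_def
  proof (rule monoI)
    fix x y :: real assume "x \<le> y"
    then show "indicator {h..} x * f x \<le> indicator {h..} y * f y"
      using m[of x y] f01[of y] by (auto simp: indicator_def)
  qed
  then have "countable {x. \<not> isCont F x}" by (rule mono_ctble_discont)
  then have "AE x in lborel. x \<notin> {x. \<not> isCont F x}"
    by (intro AE_not_in countable_imp_null_set_lborel)
  then have cont: "AE y in noise. isCont F (a / real d + y)"
    by (intro AE_noise_shift) simp
  have Qeq: "Q h f b = (\<integral>y. F (b / real d + y) \<partial>noise)" for b
    unfolding Q_eq_noise[OF fm] F_def ..
  interpret prob_space noise by (rule prob_noise)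
  show ?thesis
  proof (rule continuous_at_sequentiallyI)
    fix u :: "nat \<Rightarrow> real" assume u: "u \<longlonglongrightarrow> a"
    show "(\<lambda>n. Q h f (u n)) \<longlonglongrightarrow> Q h f a"
      unfolding Qeq
    proof (rule integral_dominated_convergence)
      show "integrable noise (\<lambda>_. 1::real)" by simp
      show "AE y in noise. (\<lambda>n. F (u n / real d + y)) \<longlonglongrightarrow> F (a / real d + y)"
        using cont
      proof eventually_elim
        case (elim y)
        show ?case by (rule isCont_tendsto_compose[OF elim]) (intro tendsto_intros u, simp)
      qed
      show "AE y in noise. norm (F (u n / real d + y)) \<le> 1" for n
        using f01 by (auto simp: F_def indicator_def)
    qed measurable
  qed
qed

text \<open>The Gaussian kernel is strictly positive, so a zero of \<open>Q h f\<close> at a single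
  point already decides \<open>f\<close> almost everywhere above \<open>h\<close>.\<close>

lemma Q_eq_0_AE:
  assumes f: "adm h B f" and 0: "Q h f a = 0"
  shows "AE x in lborel. h \<le> x \<longrightarrow> f x = 0"
proof -
  have "AE x in lborel. indicator {h..} x * f x * rho_Y d (x - a / real d) = 0"
    using 0 f unfolding Q_eq
    by (subst (asm) integral_nonneg_eq_0_iff_AE[OF Q_integrable[OF f]]) (auto simp: adm_def indicator_def)
  then show ?thesis
    by eventually_elim (auto simp: indicator_def rho_pos[THEN less_imp_neq, THEN not_sym])
qed

lemma Q_pos:
  assumes f: "adm h B f" and "\<And>x. c \<le> x \<Longrightarrow> 0 < f x"
  shows "0 < Q h f a"
proof (rule ccontr)
  assume "\<not> 0 < Q h f a"
  then have "Q h f a = 0" using Q_nonneg[OF f, of a] by linarith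
  then have "AE x in lborel. h \<le> x \<longrightarrow> f x = 0" by (rule Q_eq_0_AE[OF f])
  then have "AE x in lborel. x \<notin> {max h c..max h c + 1}"
    by eventually_elim (use assms(2) in force)
  then have "emeasure lborel {max h c..max h c + 1} = 0"
    by (subst (asm) AE_iff_measurable[of "{max h c..max h c + 1}"]) auto
  then show False by simp
qed

text \<open>On the strip between the levels the integrand is at most \<open>K\<close>, the density
  being at most 1. Both perturbation arguments at the critical level rest on this stability.\<close>

lemma Q_change_level:
  assumes f: "adm h' B f" and h: "h' \<le> h" and K: "\<And>x. h' \<le> x \<Longrightarrow> x \<le> h \<Longrightarrow> f x \<le> K"
  shows "Q h f a \<le> Q h' f a" "Q h' f a \<le> Q h f a + (h - h') * K"
proof -
  have f': "adm h B f" using f h by (auto simp: adm_def)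
  have K0: "K \<ge> 0" using K[of h'] h f by (force simp: adm_def)
  show "Q h f a \<le> Q h' f a" unfolding Q_eq
    by (rule integral_mono[OF Q_integrable[OF f'] Q_integrable[OF f]])
       (use h f in \<open>auto simp: indicator_def adm_def\<close>)
  have "Q h' f a \<le> (\<integral>x. indicator {h..} x * f x * rho_Y d (x - a / real d) + indicator {h'..h} x * K \<partial>lborel)"
    unfolding Q_eq
  proof (rule integral_mono[OF Q_integrable[OF f]])
    show "integrable lborel (\<lambda>x. indicator {h..} x * f x * rho_Y d (x - a / real d) + indicator {h'..h} x * K)"
      by (intro Bochner_Integration.integrable_add Q_integrable[OF f'] integrable_mult_left integrable_real_indicator) (auto simp: emeasure_lborel_Icc_eq)
    fix x
    have "f x * rho_Y d (x - a / real d) \<le> K * 1" if "h' \<le> x" "x \<le> h"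
      using K[OF that] rho_le K0 by (intro mult_mono) auto
    then show "indicator {h'..} x * f x * rho_Y d (x - a / real d) \<le> indicator {h..} x * f x * rho_Y d (x - a / real d) + indicator {h'..h} x * K"
      using h K0 by (auto simp: indicator_def)
  qed
  also have "\<dots> = Q h f a + (h - h') * K"
    unfolding Q_eq using h
    by (subst Bochner_Integration.integral_add[OF Q_integrable[OF f']]) auto
  finally show "Q h' f a \<le> Q h f a + (h - h') * K" .
qed

text \<open>Detailed balance of the autoregressive kernel with respect to the stationary law.\<close>
lemma kernel_symmetric:
  "normal_density 0 (sqrt (sigma_nu2 d)) a * rho_Y d (x - a / real d)
   = normal_density 0 (sqrt (sigma_nu2 d)) x * rho_Y d (a - x / real d)"
proof -
  define D where "D = real d"
  have D: "D \<ge> 2" using d_ge_2 by (simp add: D_def)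
  have e: "- a\<^sup>2 / (2 * (D / (D - 1))) + - (x - a / D)\<^sup>2 / (2 * ((D + 1) / D))
     = - x\<^sup>2 / (2 * (D / (D - 1))) + - (a - x / D)\<^sup>2 / (2 * ((D + 1) / D))"
  proof -
    \<comment> \<open>The exponent is brought to a form symmetric in \<open>u\<close> and
      \<open>v\<close>, so exchanging \<open>a\<close> and \<open>x\<close> changes nothing.\<close>
    have *: "- u\<^sup>2 / (2 * (D / (D - 1))) + - (v - u / D)\<^sup>2 / (2 * ((D + 1) / D))
      = - (D * u\<^sup>2 + D * v\<^sup>2 - 2 * u * v) / (2 * (D + 1))" for u v
    proof -
      have 1: "- u\<^sup>2 / (2 * (D / (D - 1))) = - (u\<^sup>2 * (D - 1) * (D + 1)) / (2 * D * (D + 1))"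
        using D by (simp add: divide_simps)
      have "(v - u / D) = (D * v - u) / D" using D by (simp add: field_simps)
      then have 2: "- (v - u / D)\<^sup>2 / (2 * ((D + 1) / D)) = - (D * v - u)\<^sup>2 / (2 * D * (D + 1))"
        using D by (simp add: power_divide power2_eq_square divide_simps) (simp add: algebra_simps)
      have 3: "- (D * u\<^sup>2 + D * v\<^sup>2 - 2 * u * v) / (2 * (D + 1)) = - (D * (D * u\<^sup>2 + D * v\<^sup>2 - 2 * u * v)) / (2 * D * (D + 1))"
        using D by (simp add: divide_simps)
      show ?thesis unfolding 1 2 3 add_divide_distrib[symmetric]
        by (rule arg_cong2[where f="(/)"]) (simp_all add: power2_eq_square algebra_simps)
    qed
    show ?thesis unfolding * by (simp add: algebra_simps)
  qed
  have s: "(sqrt (sigma_Y2 d))\<^sup>2 = (D + 1) / D" "(sqrt (sigma_nu2 d))\<^sup>2 = D / (D - 1)"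
    using D by (simp_all add: sigma_Y2_def sigma_nu2_def D_def)
  have *: "c * u * (c' * v) = c * u' * (c' * v')" if "u * v = u' * v'" for c c' u v u' v' :: real
    using that by algebra
  show ?thesis
    unfolding rho_Y_def normal_density_def s D_def[symmetric]
    by (rule *) (simp only: exp_add[symmetric] e diff_zero)
qed

section \<open>Moments of the stationary law and self-adjointness of \<open>Q\<close>\<close>

lemma sets_nu [simp, measurable_cong]: "sets (nu d) = sets borel"
  by (simp add: nu_def)

lemma space_nu [simp]: "space (nu d) = UNIV"
  by (simp add: nu_def)

lemma prob_nu: "prob_space (nu d)"
  unfolding nu_def by (rule prob_space_normal_density[OF sigma_pos(4)])

text \<open>Higher powers are needed because the quadratic term leads to the integral of
  \<open>f^3\<close>, where \<open>f\<close> has quadratic growth.\<close>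

lemma integrable_nu_weight: "integrable (nu d) (\<lambda>x. (1 + x\<^sup>2) ^ k)"
proof -
  have "integrable lborel (\<lambda>x. \<Sum>j\<le>k. (of_nat (k choose j)) * (normal_density 0 (sqrt (sigma_nu2 d)) x * (x - 0) ^ (2 * (k - j))))"
    by (intro Bochner_Integration.integrable_sum integrable_mult_right integrable_normal_moment sigma_pos)
  also have "(\<lambda>x. \<Sum>j\<le>k. (of_nat (k choose j)) * (normal_density 0 (sqrt (sigma_nu2 d)) x * (x - 0) ^ (2 * (k - j))))
     = (\<lambda>x. normal_density 0 (sqrt (sigma_nu2 d)) x * (1 + x\<^sup>2) ^ k)"
    by (auto simp: binomial_ring sum_distrib_left power_mult intro!: ext sum.cong)
  finally show ?thesis unfolding nu_def by (subst integrable_density) auto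
qed

lemma nu_AE_iff: "(AE x in nu d. P x) \<longleftrightarrow> (AE x in lborel. P x)"
  unfolding nu_def using normal_density_pos[OF sigma_pos(4)]
  by (subst AE_density) auto

lemma Q_measurable [measurable]:
  assumes [measurable]: "f \<in> borel_measurable borel" shows "Q h f \<in> borel_measurable borel"
  unfolding Q_eq[abs_def] by measurable

lemma nn_integral_Q:
  assumes f: "adm h B f"
  shows "ennreal (Q h f a) = (\<integral>\<^sup>+x. ennreal (indicator {h..} x * f x * rho_Y d (x - a / real d)) \<partial>lborel)"
  unfolding Q_eq using f
  by (subst nn_integral_eq_integral[OF Q_integrable[OF f]]) (auto simp: adm_def indicator_def)

text \<open>Tonelli combined with detailed balance. Nonnegative extended integrals keep the identity
  valid without growth bounds, as the \<open>L^2\<close> arguments require.\<close>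

lemma kernel_swap:
  assumes [measurable]: "f \<in> borel_measurable borel" "g \<in> borel_measurable borel"
    and "\<And>x. 0 \<le> f x" "\<And>x. 0 \<le> g x"
  shows "(\<integral>\<^sup>+a. ennreal (f a) * (\<integral>\<^sup>+x. ennreal (g x * rho_Y d (x - a / real d)) \<partial>lborel) \<partial>nu d)
       = (\<integral>\<^sup>+a. ennreal (g a) * (\<integral>\<^sup>+x. ennreal (f x * rho_Y d (x - a / real d)) \<partial>lborel) \<partial>nu d)"
proof -
  let ?n = "normal_density 0 (sqrt (sigma_nu2 d))"
  have eq: "(\<integral>\<^sup>+a. ennreal (f a) * (\<integral>\<^sup>+x. ennreal (g x * rho_Y d (x - a / real d)) \<partial>lborel) \<partial>nu d)
     = (\<integral>\<^sup>+a. (\<integral>\<^sup>+x. ennreal (f a * g x * (?n a * rho_Y d (x - a / real d))) \<partial>lborel) \<partial>lborel)"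
    if [measurable]: "f \<in> borel_measurable borel" "g \<in> borel_measurable borel"
      and nn: "\<And>x. 0 \<le> f x" "\<And>x. 0 \<le> g x" for f g :: "real \<Rightarrow> real"
    unfolding nu_def using nn
    by (subst nn_integral_density; simp add: nn_integral_cmult[symmetric] ennreal_mult'[symmetric] mult_ac)
  show ?thesis
    unfolding eq[OF assms] eq[OF assms(2,1,4,3)]
  proof (subst lborel_pair.Fubini')
    show "(\<integral>\<^sup>+x. (\<integral>\<^sup>+a. ennreal (f a * g x * (?n a * rho_Y d (x - a / real d))) \<partial>lborel) \<partial>lborel)
       = (\<integral>\<^sup>+a. (\<integral>\<^sup>+x. ennreal (g a * f x * (?n a * rho_Y d (x - a / real d))) \<partial>lborel) \<partial>lborel)"
      by (intro nn_integral_cong arg_cong[where f=ennreal])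
         (subst kernel_symmetric, simp add: mult_ac)
  qed measurable
qed

lemma Q_symmetric:
  assumes f: "adm h B f" and g: "adm h B' g"
  shows "(\<integral>a. indicator {h..} a * (f a * Q h g a) \<partial>nu d) = (\<integral>a. indicator {h..} a * (g a * Q h f a) \<partial>nu d)"
proof -
  have [measurable]: "f \<in> borel_measurable borel" "g \<in> borel_measurable borel"
    using f g by (auto simp: adm_def)
  have *: "(\<integral>a. indicator {h..} a * (f a * Q h g a) \<partial>nu d)
      = enn2real (\<integral>\<^sup>+a. ennreal (indicator {h..} a * f a) * (\<integral>\<^sup>+x. ennreal (indicator {h..} x * g x * rho_Y d (x - a / real d)) \<partial>lborel) \<partial>nu d)"
    if f: "adm h B f" and g: "adm h B' g" for f g B B'
  proof -
    have [measurable]: "f \<in> borel_measurable borel" "g \<in> borel_measurable borel"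
      using f g by (auto simp: adm_def)
    have "(\<integral>a. indicator {h..} a * (f a * Q h g a) \<partial>nu d) = enn2real (\<integral>\<^sup>+a. ennreal (indicator {h..} a * (f a * Q h g a)) \<partial>nu d)"
      using Q_nonneg[OF g] f by (intro integral_eq_nn_integral) (auto simp: indicator_def adm_def)
    also have "(\<integral>\<^sup>+a. ennreal (indicator {h..} a * (f a * Q h g a)) \<partial>nu d)
       = (\<integral>\<^sup>+a. ennreal (indicator {h..} a * f a) * ennreal (Q h g a) \<partial>nu d)"
      using Q_nonneg[OF g] by (intro nn_integral_cong) (simp add: ennreal_mult''[symmetric] mult.assoc)
    finally show ?thesis unfolding nn_integral_Q[OF g] .
  qed
  have nn: "0 \<le> indicator {h..} x * f x" "0 \<le> indicator {h..} x * g x" for x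
    using f g by (auto simp: adm_def indicator_def)
  show ?thesis unfolding *[OF f g] *[OF g f]
    by (subst kernel_swap) (auto simp: nn)
qed

end

section \<open>The branching structure of the field\<close>

context tree_degree
begin

section \<open>Product structure of the sample space\<close>

abbreviation cfg :: "(vertex \<Rightarrow> real) measure" where
  "cfg \<equiv> Pi\<^sub>M UNIV (\<lambda>_. borel)"

definition coord :: "vertex \<Rightarrow> real measure" where
  "coord x = (if x = [] then nu d else noise)"

lemma field_space_eq: "field_space d = Pi\<^sub>M UNIV coord"
  unfolding field_space_def coord_def noise_def ..

lemma prob_coord: "prob_space (coord x)"
  by (simp add: coord_def prob_nu prob_noise)

lemma sets_coord [simp]: "sets (coord x) = sets borel"
  by (simp add: coord_def)

lemma sets_field [simp, measurable_cong]: "sets (field_space d) = sets cfg"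
  unfolding field_space_eq by (rule sets_PiM_cong) auto

lemma space_field [simp]: "space (field_space d) = UNIV"
  using sets_eq_imp_space_eq[OF sets_field] by (simp add: space_PiM)

lemma prob_field: "prob_space (field_space d)"
  unfolding field_space_eq by (rule prob_space_PiM) (rule prob_coord)

text \<open>Vertices are reversed paths, so the first step from the root stands at the end of the
  list: \<open>x @ [i]\<close> is the vertex \<open>x\<close> of the subtree at child
  \<open>i\<close>. The root coordinate of the shifted family is the increment
  \<open>Y [i]\<close>.\<close>

definition shift :: "nat \<Rightarrow> (vertex \<Rightarrow> real) \<Rightarrow> vertex \<Rightarrow> real" where
  "shift i Y x = Y (x @ [i])"

lemma shift_measurable [measurable]: "shift i \<in> measurable cfg cfg"
proof (rule measurable_PiM_single')
  show "(\<lambda>\<omega>. shift i \<omega> x) \<in> borel_measurable cfg" for x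
    unfolding shift_def by measurable
qed (simp add: space_PiM)

lemma indep_coordinates:
  "prob_space.indep_vars (field_space d) coord (\<lambda>x Y. Y x) UNIV"
proof -
  interpret prob_space "field_space d" by (rule prob_field)
  have "distr (field_space d) (Pi\<^sub>M UNIV coord) (\<lambda>Y. \<lambda>x\<in>UNIV. Y x) = field_space d"
    by (simp add: field_space_eq restrict_UNIV distr_id)
  moreover have "Pi\<^sub>M UNIV (\<lambda>x. distr (field_space d) (coord x) (\<lambda>Y. Y x)) = field_space d"
    unfolding field_space_eq by (intro PiM_cong refl distr_PiM_component prob_coord) auto
  ultimately show ?thesis
    by (subst indep_vars_iff_distr_eq_PiM') (auto simp: field_space_eq)
qed

definition nonroot :: "(vertex \<Rightarrow> real) measure" where
  "nonroot = Pi\<^sub>M (UNIV - {[]}) (\<lambda>_. noise)"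

lemma prob_nonroot: "prob_space nonroot"
  unfolding nonroot_def by (rule prob_space_PiM) (rule prob_noise)

lemma upd_root_measurable [measurable]:
  "(\<lambda>(r, X). X([] := r)) \<in> measurable (borel \<Otimes>\<^sub>M nonroot) cfg"
proof (rule measurable_PiM_single')
  fix x :: vertex
  have sub: "sets nonroot = sets (Pi\<^sub>M (UNIV - {[]}) (\<lambda>_. borel :: real measure))"
    unfolding nonroot_def by (rule sets_PiM_cong) auto
  show "(\<lambda>\<omega>. (case \<omega> of (r, X) \<Rightarrow> X([] := r)) x) \<in> borel_measurable (borel \<Otimes>\<^sub>M nonroot)"
  proof (cases "x = []")
    case False
    have "(\<lambda>X. X x) \<in> borel_measurable nonroot"
      unfolding measurable_cong_sets[OF sub refl]
      by (rule measurable_component_singleton) (use False in auto)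
    then show ?thesis using False by (simp add: case_prod_beta)
  qed (simp add: case_prod_beta)
qed (auto simp: space_PiM)

text \<open>The root law \<open>N\<close> is left general because two occur: \<open>nu d\<close> for
  the field itself and the noise for a shifted subtree.\<close>

lemma root_split:
  assumes "prob_space N" "sets N = sets borel"
    and M: "M = Pi\<^sub>M UNIV (\<lambda>x::vertex. if x = [] then N else noise)"
    and [measurable]: "F \<in> borel_measurable cfg" and bd: "\<And>Y. \<bar>F Y\<bar> \<le> (1::real)"
  shows "(\<integral>Y. F Y \<partial>M) = (\<integral>r. (\<integral>X. F (X([] := r)) \<partial>nonroot) \<partial>N)"
proof -
  let ?M = "\<lambda>x::vertex. if x = [] then N else noise"
  have nr: "nonroot = Pi\<^sub>M (UNIV - {[]}) ?M"
    unfolding nonroot_def by (rule PiM_cong) auto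
  have "distr (?M [] \<Otimes>\<^sub>M Pi\<^sub>M (UNIV - {[]}) ?M) (Pi\<^sub>M (insert [] (UNIV - {[]})) ?M) (\<lambda>(x, X). X([] := x))
      = Pi\<^sub>M (insert [] (UNIV - {[]})) ?M"
    by (rule distr_pair_PiM_eq_PiM) (use assms(1) prob_noise in auto)
  then have eq: "M = distr (N \<Otimes>\<^sub>M nonroot) M (\<lambda>(x, X). X([] := x))"
    unfolding nr M by (simp add: insert_absorb)
  have sM: "sets M = sets cfg" unfolding M by (rule sets_PiM_cong) (use assms(2) in auto)
  interpret N: prob_space N by fact
  interpret R: prob_space nonroot by (rule prob_nonroot)
  interpret P: pair_prob_space N nonroot by unfold_locales
  have sN: "sets (N \<Otimes>\<^sub>M nonroot) = sets (borel \<Otimes>\<^sub>M nonroot)"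
    by (rule sets_pair_measure_cong) (use assms(2) in auto)
  have m1: "(\<lambda>(r, X). X([] := r)) \<in> measurable (N \<Otimes>\<^sub>M nonroot) M"
    using upd_root_measurable unfolding measurable_cong_sets[OF sN sM] .
  have m2: "F \<in> borel_measurable M"
    using assms(4) unfolding measurable_cong_sets[OF sM refl] .
  have "(\<integral>Y. F Y \<partial>M) = (\<integral>p. F (case p of (r, X) \<Rightarrow> X([] := r)) \<partial>(N \<Otimes>\<^sub>M nonroot))"
    by (subst eq, subst integral_distr[OF m1 m2]) simp
  also have "\<dots> = (\<integral>p. (case p of (r, X) \<Rightarrow> F (X([] := r))) \<partial>(N \<Otimes>\<^sub>M nonroot))"
    by (simp add: case_prod_beta)
  also have "\<dots> = (\<integral>r. (\<integral>X. F (X([] := r)) \<partial>nonroot) \<partial>N)"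
  proof -
    have "integrable (N \<Otimes>\<^sub>M nonroot) (\<lambda>(r, X). F (X([] := r)))"
    proof (rule P.integrable_const_bound[of _ 1])
      show "(\<lambda>(r, X). F (X([] := r))) \<in> borel_measurable (N \<Otimes>\<^sub>M nonroot)"
        using measurable_compose[OF m1 m2] by (simp add: case_prod_beta)
    qed (use bd in auto)
    from P.integral_fst'[OF this] show ?thesis by simp
  qed
  finally show ?thesis .
qed

lemma root_irrelevant:
  assumes F: "F \<in> borel_measurable cfg" "\<And>Y. \<bar>F Y\<bar> \<le> (1::real)" "\<And>r Y. F (Y([] := r)) = F Y"
  shows "(\<integral>Y. F Y \<partial>field_space d) = (\<integral>X. F (X([] := r)) \<partial>nonroot)"
proof -
  interpret N: prob_space "nu d" by (rule prob_nu)
  have "(\<integral>Y. F Y \<partial>field_space d) = (\<integral>r. (\<integral>X. F (X([] := r)) \<partial>nonroot) \<partial>nu d)"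
    by (rule root_split[OF prob_nu sets_nu]) (auto simp: field_space_eq coord_def[abs_def] assms)
  also have "\<dots> = (\<integral>r'. (\<integral>X. F (X([] := r)) \<partial>nonroot) \<partial>nu d)"
    using F(3) by simp
  finally show ?thesis using N.prob_space by simp
qed

text \<open>The shifted configuration carries the noise law at its root instead of
  \<open>nu d\<close>. Splitting off this coordinate turns it into the increment \<open>y\<close>;
  as \<open>H b\<close> ignores the root coordinate, \<open>nu d\<close> may be put back
  there.\<close>

lemma subtree_law:
  assumes H: "case_prod H \<in> borel_measurable (borel \<Otimes>\<^sub>M cfg)" "\<And>b Y. \<bar>H b Y\<bar> \<le> (1::real)"
    "\<And>b r Y. H b (Y([] := r)) = H b Y"
  shows "(\<integral>Y. H (m + Y [i]) (shift i Y) \<partial>field_space d)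
       = (\<integral>y. (\<integral>Y. H (m + y) Y \<partial>field_space d) \<partial>noise)"
proof -
  let ?N = "Pi\<^sub>M UNIV (\<lambda>_::vertex. noise)"
  have sN: "sets ?N = sets cfg" by (rule sets_PiM_cong) auto
  note [measurable] = H(1)
  have Hm: "(\<lambda>Y. H (m + Y x) Y) \<in> borel_measurable cfg" for x
    by measurable
  have eq: "distr (field_space d) ?N (shift i) = ?N"
  proof -
    have "distr (Pi\<^sub>M UNIV coord) (Pi\<^sub>M UNIV (\<lambda>x. coord (x @ [i]))) (\<lambda>\<omega>. \<lambda>x\<in>UNIV. \<omega> (x @ [i]))
       = Pi\<^sub>M UNIV (\<lambda>x. coord (x @ [i]))"
      by (rule distr_PiM_reindex) (auto simp: prob_coord inj_on_def)
    moreover have "(\<lambda>\<omega>. \<lambda>x\<in>UNIV. \<omega> (x @ [i])) = shift i"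
      by (auto simp: shift_def fun_eq_iff)
    ultimately show ?thesis by (simp add: field_space_eq coord_def)
  qed
  have "(\<integral>Y. H (m + Y [i]) (shift i Y) \<partial>field_space d) = (\<integral>Y. H (m + shift i Y []) (shift i Y) \<partial>field_space d)"
    by (simp add: shift_def)
  also have "\<dots> = (\<integral>Y. H (m + Y []) Y \<partial>distr (field_space d) ?N (shift i))"
  proof (rule integral_distr[symmetric])
    show "shift i \<in> measurable (field_space d) ?N"
      unfolding measurable_cong_sets[OF sets_field sN] by simp
    show "(\<lambda>Y. H (m + Y []) Y) \<in> borel_measurable ?N"
      unfolding measurable_cong_sets[OF sN refl] by (rule Hm)
  qed
  also have "\<dots> = (\<integral>Y. H (m + Y []) Y \<partial>?N)" unfolding eq ..
  also have "\<dots> = (\<integral>y. (\<integral>X. H (m + (X([] := y)) []) (X([] := y)) \<partial>nonroot) \<partial>noise)"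
    by (rule root_split[OF prob_noise sets_noise]) (use H Hm in auto)
  also have "\<dots> = (\<integral>y. (\<integral>Y. H (m + y) Y \<partial>field_space d) \<partial>noise)"
  proof (rule Bochner_Integration.integral_cong[OF refl])
    fix y
    have "(\<lambda>Y. H (m + y) Y) \<in> borel_measurable cfg" by measurable
    then show "(\<integral>X. H (m + (X([] := y)) []) (X([] := y)) \<partial>nonroot) = (\<integral>Y. H (m + y) Y \<partial>field_space d)"
      using H by (subst root_irrelevant[where r=y]) auto
  qed
  finally show ?thesis .
qed

text \<open>Subtree \<open>i\<close> uses exactly the coordinates whose list ends in
  \<open>i\<close>; these index sets are disjoint for different \<open>i\<close>.\<close>

lemma subtrees_independent:
  assumes H: "case_prod H \<in> borel_measurable (borel \<Otimes>\<^sub>M cfg)" "\<And>b Y. \<bar>H b Y\<bar> \<le> (1::real)"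
  shows "(\<integral>Y. (\<Prod>i<k. H (m + Y [i]) (shift i Y)) \<partial>field_space d)
       = (\<Prod>i<k. \<integral>Y. H (m + Y [i]) (shift i Y) \<partial>field_space d)"
proof -
  interpret prob_space "field_space d" by (rule prob_field)
  define K where "K i = range (\<lambda>x::vertex. x @ [i])" for i :: nat
  note [measurable] = H(1)
  have Hm: "(\<lambda>Y. H (m + Y [i]) (shift i Y)) \<in> borel_measurable cfg" for i
    by measurable
  have "indep_vars (\<lambda>i. Pi\<^sub>M (K i) coord) (\<lambda>i Y. restrict (\<lambda>x. Y x) (K i)) {..<k}"
    by (rule indep_vars_restrict[OF indep_coordinates]) (auto simp: K_def disjoint_family_on_def)
  then have "indep_vars (\<lambda>_. borel) (\<lambda>i Y. H (m + restrict (\<lambda>x. Y x) (K i) [i]) (\<lambda>x. restrict (\<lambda>x. Y x) (K i) (x @ [i]))) {..<k}"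
  proof (rule indep_vars_compose2)
    fix i
    have "(\<lambda>\<omega>. \<omega> [i]) \<in> borel_measurable (Pi\<^sub>M (K i) coord)"
      using measurable_component_singleton[of "[i]" "K i" coord]
      by (auto simp: K_def image_iff measurable_cong_sets[OF refl sets_coord])
    moreover have "(\<lambda>\<omega> x. \<omega> (x @ [i])) \<in> measurable (Pi\<^sub>M (K i) coord) cfg"
    proof (rule measurable_PiM_single')
      show "(\<lambda>\<omega>. \<omega> (x @ [i])) \<in> borel_measurable (Pi\<^sub>M (K i) coord)" for x
        using measurable_component_singleton[of "x @ [i]" "K i" coord]
        by (auto simp: K_def image_iff measurable_cong_sets[OF refl sets_coord])
    qed (simp add: space_PiM)
    ultimately show "(\<lambda>\<omega>. H (m + \<omega> [i]) (\<lambda>x. \<omega> (x @ [i]))) \<in> borel_measurable (Pi\<^sub>M (K i) coord)"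
      by measurable
  qed
  moreover have "[i] \<in> K i" "x @ [i] \<in> K i" for i x by (auto simp: K_def image_iff)
  ultimately have ind: "indep_vars (\<lambda>_. borel) (\<lambda>i Y. H (m + Y [i]) (shift i Y)) {..<k}"
    by (simp add: shift_def[abs_def])
  show ?thesis
  proof (rule indep_vars_lebesgue_integral[OF _ ind])
    show "integrable (field_space d) (\<lambda>Y. H (m + Y [i]) (shift i Y))" for i
      using Hm[of i] by (intro integrable_const_bound[of _ 1]) (use H in auto)
  qed simp
qed

text \<open>The root has \<open>k\<close> children and every other vertex \<open>d\<close>:
  \<open>k = d\<close> describes the part in \<open>T_plus\<close>, \<open>k = Suc d\<close> the
  full cluster. The lists \<open>drop j x\<close> run through \<open>x\<close> and its
  ancestors.\<close>

definition branch :: "nat \<Rightarrow> real \<Rightarrow> real \<Rightarrow> (vertex \<Rightarrow> real) \<Rightarrow> vertex set" where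
  "branch k h a Y = {x. (x = [] \<or> (last x < k \<and> set (butlast x) \<subseteq> {..<d})) \<and>
      (\<forall>j\<le>length x. h \<le> phi d a Y (drop j x))}"

text \<open>\<open>phi\<close> recurses at the leaf end of a path, whereas the branching recursion
  removes the step at the root; this is the Markov property at the first generation.\<close>

lemma phi_append: "phi d a Y (x @ [i]) = phi d (a / real d + Y [i]) (shift i Y) x"
  by (induction x) (auto simp: shift_def)

lemma branch_Nil: "[] \<in> branch k h a Y \<longleftrightarrow> h \<le> a"
  by (simp add: branch_def)

lemma branch_snoc:
  "x @ [i] \<in> branch k h a Y \<longleftrightarrow> h \<le> a \<and> i < k \<and> x \<in> branch d h (a / real d + Y [i]) (shift i Y)"
proof -
  have 1: "(\<forall>j\<le>length (x @ [i]). h \<le> phi d a Y (drop j (x @ [i]))) \<longleftrightarrow>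
     h \<le> a \<and> (\<forall>j\<le>length x. h \<le> phi d (a / real d + Y [i]) (shift i Y) (drop j x))"
    (is "?l \<longleftrightarrow> ?r")
  proof
    assume l: ?l
    have "h \<le> a" using l[rule_format, of "length x + 1"] by simp
    moreover have "h \<le> phi d (a / real d + Y [i]) (shift i Y) (drop j x)" if "j \<le> length x" for j
      using l[rule_format, of j] that by (simp add: phi_append)
    ultimately show ?r by simp
  next
    assume r: ?r
    show ?l
    proof (intro allI impI)
      fix j assume "j \<le> length (x @ [i])"
      then consider "j \<le> length x" | "j = Suc (length x)" by fastforce
      then show "h \<le> phi d a Y (drop j (x @ [i]))"
        using r by cases (auto simp: phi_append)
    qed
  qed
  have 2: "set x \<subseteq> {..<d} \<longleftrightarrow> x = [] \<or> (last x < d \<and> set (butlast x) \<subseteq> {..<d})"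
    by (cases x rule: rev_cases) auto
  show ?thesis unfolding branch_def mem_Collect_eq 1 using 2 by auto
qed

lemma branch_rec:
  assumes "h \<le> a"
  shows "branch k h a Y = insert [] (\<Union>i<k. (\<lambda>x. x @ [i]) ` branch d h (a / real d + Y [i]) (shift i Y))"
proof (intro equalityI subsetI)
  fix x assume "x \<in> branch k h a Y"
  then show "x \<in> insert [] (\<Union>i<k. (\<lambda>x. x @ [i]) ` branch d h (a / real d + Y [i]) (shift i Y))"
    by (cases x rule: rev_cases) (auto simp: branch_snoc)
qed (use assms in \<open>auto simp: branch_snoc branch_Nil\<close>)

lemma branch_empty: "a < h \<Longrightarrow> branch k h a Y = {}"
  by (auto simp: branch_def dest!: spec[of _ "length _"])

lemma finite_branch_level: "finite {x \<in> branch k h a Y. length x < n}"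
proof (rule finite_subset)
  show "{x \<in> branch k h a Y. length x < n} \<subseteq> {x. set x \<subseteq> {..<k + d} \<and> length x \<le> n}"
  proof safe
    fix x i assume x: "x \<in> branch k h a Y" "i \<in> set x"
    then show "i < k + d"
      by (cases x rule: rev_cases) (auto simp: branch_def)
  qed auto
qed (simp add: finite_lists_length_le)

lemma finite_branch_level': "finite {x \<in> branch k h a Y. length x = n}"
  by (rule finite_subset[OF _ finite_branch_level[of k h a Y "Suc n"]]) auto

text \<open>Weight \<open>z\<close> per vertex of generation less than \<open>n\<close>, and
  \<open>c\<close> per vertex of generation \<open>n\<close>. For \<open>c = 1\<close> its mean is
  the generating function of the truncated size; for \<open>z = 1\<close> and \<open>c = 0\<close>
  it is the indicator that generation \<open>n\<close> is empty, thanks to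
  \<open>0 ^ 0 = 1\<close>.\<close>

definition genf :: "real \<Rightarrow> real \<Rightarrow> nat \<Rightarrow> real \<Rightarrow> nat \<Rightarrow> real \<Rightarrow> (vertex \<Rightarrow> real) \<Rightarrow> real" where
  "genf z c k h n a Y = z ^ card {x \<in> branch k h a Y. length x < n} * c ^ card {x \<in> branch k h a Y. length x = n}"

lemma genf_0: "genf z c k h 0 a Y = (if h \<le> a then c else 1)"
proof -
  have "{x \<in> branch k h a Y. length x = 0} = (if h \<le> a then {[]} else {})"
    by (auto simp: branch_Nil)
  then show ?thesis by (simp add: genf_def)
qed

lemma genf_Suc:
  "genf z c k h (Suc n) a Y =
     (if h \<le> a then z * (\<Prod>i<k. genf z c d h n (a / real d + Y [i]) (shift i Y)) else 1)"
proof (cases "h \<le> a")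
  case True
  define B where "B i = branch d h (a / real d + Y [i]) (shift i Y)" for i
  have lt: "{x \<in> branch k h a Y. length x < Suc n} = insert [] (\<Union>i<k. (\<lambda>x. x @ [i]) ` {x \<in> B i. length x < n})"
    unfolding branch_rec[OF True] B_def by auto
  have eq: "{x \<in> branch k h a Y. length x = Suc n} = (\<Union>i<k. (\<lambda>x. x @ [i]) ` {x \<in> B i. length x = n})"
    unfolding branch_rec[OF True] B_def by auto
  have fin: "finite {x \<in> B i. length x < n}" "finite {x \<in> B i. length x = n}" for i
    unfolding B_def by (rule finite_branch_level finite_branch_level')+
  have inj: "inj_on (\<lambda>x::vertex. x @ [i]) A" for i A by (auto simp: inj_on_def)
  have card_UN: "card (\<Union>i<k. (\<lambda>x. x @ [i]) ` A i) = (\<Sum>i<k. card (A i))"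
    if "\<And>i. finite (A i)" for A :: "nat \<Rightarrow> vertex set"
    by (subst card_UN_disjoint) (use that in \<open>auto simp: card_image[OF inj]\<close>)
  have "card {x \<in> branch k h a Y. length x < Suc n} = Suc (\<Sum>i<k. card {x \<in> B i. length x < n})"
    unfolding lt using fin by (subst card_insert_disjoint) (auto simp: card_UN)
  moreover have "card {x \<in> branch k h a Y. length x = Suc n} = (\<Sum>i<k. card {x \<in> B i. length x = n})"
    unfolding eq using fin by (simp add: card_UN)
  ultimately show ?thesis
    using True by (simp add: genf_def power_sum prod.distrib B_def)
qed (simp add: genf_def branch_empty)

lemma genf_bounds:
  assumes "0 \<le> z" "z \<le> 1" "0 \<le> c" "c \<le> 1"
  shows "0 \<le> genf z c k h n a Y" "genf z c k h n a Y \<le> 1" "\<bar>genf z c k h n a Y\<bar> \<le> 1"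
proof -
  show 1: "0 \<le> genf z c k h n a Y" using assms by (simp add: genf_def)
  show 2: "genf z c k h n a Y \<le> 1" using assms by (auto simp: genf_def intro!: mult_le_one power_le_one)
  show "\<bar>genf z c k h n a Y\<bar> \<le> 1" using 1 2 by simp
qed

lemma genf_root: "genf z c k h n a (Y([] := r)) = genf z c k h n a Y"
proof -
  have "shift i (Y([] := r)) = shift i Y" for i by (auto simp: shift_def)
  then show ?thesis by (cases n) (simp_all add: genf_0 genf_Suc)
qed

lemma genf_measurable: "(\<lambda>(a, Y). genf z c k h n a Y) \<in> borel_measurable (borel \<Otimes>\<^sub>M cfg)"
proof (induction n arbitrary: k)
  case 0
  then show ?case by (simp add: genf_0)
next
  case (Suc n)
  note [measurable] = Suc
  have [measurable]: "(\<lambda>p. genf z c d h n (fst p / real d + snd p [i]) (shift i (snd p))) \<in> borel_measurable (borel \<Otimes>\<^sub>M cfg)" for i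
  proof -
    have "(\<lambda>p. (fst p / real d + snd p [i], shift i (snd p))) \<in> measurable (borel \<Otimes>\<^sub>M cfg) (borel \<Otimes>\<^sub>M cfg)"
      by measurable
    from measurable_compose[OF this Suc[of d]] show ?thesis by simp
  qed
  show ?case unfolding genf_Suc case_prod_beta by measurable
qed

lemma genf_measurable' [measurable]: "genf z c k h n a \<in> borel_measurable cfg"
proof -
  have "Pair a \<in> measurable cfg (borel \<Otimes>\<^sub>M cfg)" by simp
  from measurable_compose[OF this genf_measurable] show ?thesis by simp
qed

text \<open>Indexing the recursion by all real \<open>a\<close>, with the level entering only through \<open>Q\<close>, keeps the
  iterates monotone and continuous across \<open>h\<close>.\<close>
primrec U :: "real \<Rightarrow> real \<Rightarrow> real \<Rightarrow> nat \<Rightarrow> real \<Rightarrow> real" where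
  "U z c h 0 = (\<lambda>a. 1 - c)"
| "U z c h (Suc n) = (\<lambda>a. 1 - z * (1 - Q h (U z c h n) a) ^ d)"

text \<open>Branching property: independence turns the product over the children into a
  \<open>k\<close>-th power. A child below \<open>h\<close> has an empty subtree and weight 1, which
  is why \<open>U\<close> enters through the truncated operator. Only the root sees
  \<open>k\<close>; the induction runs with \<open>d\<close> children.\<close>

lemma genf_expectation_aux:
  assumes zc: "0 \<le> z" "z \<le> 1" "0 \<le> c" "c \<le> 1"
    and U: "U z c h n \<in> borel_measurable borel"
    and IH: "\<And>b. h \<le> b \<Longrightarrow> (\<integral>Y. genf z c d h n b Y \<partial>field_space d) = 1 - U z c h n b"
    and bd: "\<And>x. h \<le> x \<Longrightarrow> 0 \<le> U z c h n x \<and> U z c h n x \<le> 1"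
    and a: "h \<le> a"
  shows "(\<integral>Y. genf z c k h (Suc n) a Y \<partial>field_space d) = z * (1 - Q h (U z c h n) a) ^ k"
proof -
  interpret F: prob_space "field_space d" by (rule prob_field)
  interpret N: prob_space noise by (rule prob_noise)
  let ?H = "genf z c d h n"
  note Hb = genf_bounds(3)[OF zc]
  have "(\<integral>Y. ?H (a / real d + Y [i]) (shift i Y) \<partial>field_space d) = 1 - Q h (U z c h n) a" for i
  proof -
    have adm: "adm h 1 (U z c h n)"
      unfolding adm_def using U bd by (auto intro: order_trans[of _ 1])
    have "(\<integral>Y. ?H (a / real d + Y [i]) (shift i Y) \<partial>field_space d)
       = (\<integral>y. (\<integral>Y. ?H (a / real d + y) Y \<partial>field_space d) \<partial>noise)"
      by (rule subtree_law[OF genf_measurable Hb genf_root])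
    also have "\<dots> = (\<integral>y. 1 - indicator {h..} (a / real d + y) * U z c h n (a / real d + y) \<partial>noise)"
    proof (rule Bochner_Integration.integral_cong[OF refl])
      fix y
      show "(\<integral>Y. ?H (a / real d + y) Y \<partial>field_space d) = 1 - indicator {h..} (a / real d + y) * U z c h n (a / real d + y)"
      proof (cases "h \<le> a / real d + y")
        case False
        then have "?H (a / real d + y) Y = 1" for Y by (cases n) (simp_all add: genf_0 genf_Suc)
        then show ?thesis using False F.prob_space by simp
      qed (simp add: IH)
    qed
    also have "\<dots> = 1 - Q h (U z c h n) a"
      using noise_integrable[OF adm] N.prob_space
      by (subst Bochner_Integration.integral_diff) (auto simp: Q_eq_noise[OF U])
    finally show ?thesis .
  qed
  then have "(\<integral>Y. (\<Prod>i<k. ?H (a / real d + Y [i]) (shift i Y)) \<partial>field_space d) = (1 - Q h (U z c h n) a) ^ k"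
    by (subst subtrees_independent[OF genf_measurable Hb]) simp
  then show ?thesis using a by (simp add: genf_Suc)
qed

lemma U_props:
  assumes zc: "0 \<le> z" "z \<le> 1" "0 \<le> c" "c \<le> 1"
  shows "U z c h n \<in> borel_measurable borel \<and> (\<forall>x. 0 \<le> U z c h n x \<and> U z c h n x \<le> 1) \<and>
    (\<forall>x y. x \<le> y \<longrightarrow> U z c h n x \<le> U z c h n y)"
proof (induction n)
  case (Suc n)
  let ?U = "U z c h n"
  have adm: "adm h 1 ?U"
    unfolding adm_def using Suc by (auto intro: order_trans[of _ 1])
  have q: "0 \<le> Q h ?U x" "Q h ?U x \<le> 1" for x
    using Q_nonneg[OF adm] Q_le_const[OF adm, of 1] Suc by auto
  have p: "0 \<le> (1 - Q h ?U x) ^ d" "(1 - Q h ?U x) ^ d \<le> 1" for x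
    using q[of x] by (auto intro!: power_le_one)
  have [measurable]: "?U \<in> borel_measurable borel" using Suc by simp
  have m: "z * (1 - Q h ?U y) ^ d \<le> z * (1 - Q h ?U x) ^ d" if "x \<le> y" for x y
    using Q_mono_arg[OF adm _ that] Suc q[of y] zc by (intro mult_left_mono power_mono) auto
  have "z * (1 - Q h ?U x) ^ d \<le> 1" for x
    using p[of x] zc by (intro mult_le_one) auto
  then show ?case using m p zc by auto
qed (use zc in auto)

lemma adm_U: "0 \<le> z \<Longrightarrow> z \<le> 1 \<Longrightarrow> 0 \<le> c \<Longrightarrow> c \<le> 1 \<Longrightarrow> adm h 1 (U z c h n)"
  using U_props[of z c h n] by (auto simp: adm_def intro: order_trans[of _ 1])

lemma genf_expectation:
  assumes zc: "0 \<le> z" "z \<le> 1" "0 \<le> c" "c \<le> 1" and a: "h \<le> a"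
  shows "(\<integral>Y. genf z c k h (Suc n) a Y \<partial>field_space d) = z * (1 - Q h (U z c h n) a) ^ k"
proof -
  have *: "(\<integral>Y. genf z c d h n b Y \<partial>field_space d) = 1 - U z c h n b" if "h \<le> b" for n b
    using that
  proof (induction n arbitrary: b)
    case 0
    interpret F: prob_space "field_space d" by (rule prob_field)
    show ?case using 0 F.prob_space by (simp add: genf_0)
  next
    case (Suc n)
    show ?case
      by (subst genf_expectation_aux[OF zc _ Suc.IH _ Suc.prems]) (use U_props[OF zc] in auto)
  qed
  show ?thesis
    by (rule genf_expectation_aux[OF zc _ * _ a]) (use U_props[OF zc] in auto)
qed

end

section \<open>Generating functions and the cluster\<close>

lemma exp_integral_Ioo:
  fixes s N :: real assumes "s > 0" "N \<ge> 0"
  shows "(\<integral>\<^sup>+t. ennreal (indicator {0<..} t * (s * exp (- (s * t))) * (if t < N then 1 else 0)) \<partial>lborel) = ennreal (1 - exp (- (s * N)))"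
proof -
  have "(\<integral>\<^sup>+t. ennreal (indicator {0<..} t * (s * exp (- (s * t))) * (if t < N then 1 else 0)) \<partial>lborel)
    = (\<integral>\<^sup>+t. ennreal (s * exp (- (s * t))) * indicator {0..N} t \<partial>lborel)"
  proof (rule nn_integral_cong_AE)
    have "AE t in lborel. t \<notin> {0, N}"
      by (intro AE_not_in countable_imp_null_set_lborel) auto
    then show "AE t in lborel. ennreal (indicator {0<..} t * (s * exp (- (s * t))) * (if t < N then 1 else 0)) = ennreal (s * exp (- (s * t))) * indicator {0..N} t"
      by eventually_elim (auto simp: indicator_def)
  qed
  also have "\<dots> = ennreal (- exp (- (s * N)) - (- exp (- (s * 0))))"
  proof (rule nn_integral_FTC_Icc)
    show "((\<lambda>t. - exp (- (s * t))) has_real_derivative s * exp (- (s * x))) (at x)" for x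
      by (auto intro!: derivative_eq_intros)
  qed (use assms in auto)
  finally show ?thesis by simp
qed

context tree_degree
begin

section \<open>Limits of the iterated generating functions\<close>

definition Ulim :: "real \<Rightarrow> real \<Rightarrow> real \<Rightarrow> real \<Rightarrow> real" where
  "Ulim z c h a = lim (\<lambda>n. U z c h n a)"

text \<open>The iteration starts at the constant \<open>1 - c\<close>, an extreme value of
  \<open>[0, 1]\<close>, so the first step can go one way only; monotonicity of the map propagates
  its direction.\<close>

lemma U_step_mono:
  assumes zc: "0 \<le> z" "z \<le> 1" and c: "c \<in> {0, 1}"
  shows "c = 1 \<Longrightarrow> U z c h n a \<le> U z c h (Suc n) a"
    and "c = 0 \<Longrightarrow> U z c h (Suc n) a \<le> U z c h n a"
proof -
  have zc': "0 \<le> c" "c \<le> 1" using c by auto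
  note zc = zc zc'
  note P = U_props[OF zc]
  have q: "Q h (U z c h n) x \<le> 1" for n x
    by (rule Q_le_const[OF adm_U[OF zc]]) (use P in auto)
  have step: "U z c h (Suc n) a \<le> U z c h (Suc m) a" if "\<And>a. U z c h n a \<le> U z c h m a" for n m a
    using Q_mono[OF adm_U[OF zc] adm_U[OF zc], of h n m a] that q[of m a] zc
    by (auto intro!: mult_left_mono power_mono)
  show "U z c h n a \<le> U z c h (Suc n) a" if "c = 1"
  proof (induction n arbitrary: a)
    case 0 show ?case using P[of h "Suc 0"] that by simp
  qed (rule step)
  show "U z c h (Suc n) a \<le> U z c h n a" if "c = 0"
  proof (induction n arbitrary: a)
    case 0 show ?case using P[of h "Suc 0"] that by simp
  qed (rule step)
qed

lemma U_tendsto: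
  assumes zc: "0 \<le> z" "z \<le> 1" and c: "c \<in> {0, 1}"
  shows "(\<lambda>n. U z c h n a) \<longlonglongrightarrow> Ulim z c h a"
proof -
  have P: "0 \<le> U z c h n a \<and> U z c h n a \<le> 1" for n
    using U_props[of z c h n] zc c by auto
  have "monoseq (\<lambda>n. U z c h n a)"
    using U_step_mono[OF zc c] c unfolding monoseq_Suc by auto
  moreover have "Bseq (\<lambda>n. U z c h n a)" using P by (intro BseqI'[of _ 1]) auto
  ultimately show ?thesis
    unfolding Ulim_def by (metis Bseq_monoseq_convergent convergent_LIMSEQ_iff)
qed

lemma Ulim_props:
  assumes zc: "0 \<le> z" "z \<le> 1" and c: "c \<in> {0, 1}"
  shows Ulim_measurable: "Ulim z c h \<in> borel_measurable borel"
    and Ulim_bounds: "0 \<le> Ulim z c h a" "Ulim z c h a \<le> 1"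
    and Ulim_mono: "a \<le> b \<Longrightarrow> Ulim z c h a \<le> Ulim z c h b"
    and adm_Ulim: "adm h 1 (Ulim z c h)"
    and Q_U_tendsto: "(\<lambda>n. Q h (U z c h n) a) \<longlonglongrightarrow> Q h (Ulim z c h) a"
    and Ulim_fixed: "Ulim z c h a = 1 - z * (1 - Q h (Ulim z c h) a) ^ d"
    and Q_Ulim_bounds: "0 \<le> Q h (Ulim z c h) a" "Q h (Ulim z c h) a \<le> 1"
proof -
  have zc': "0 \<le> c" "c \<le> 1" using c by auto
  note P = U_props[OF zc zc']
  note lim = U_tendsto[OF zc c]
  show m: "Ulim z c h \<in> borel_measurable borel"
    by (rule borel_measurable_LIMSEQ_real[OF lim]) (use P in auto)
  show b: "0 \<le> Ulim z c h a" "Ulim z c h a \<le> 1" for a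
    using P by (auto intro: LIMSEQ_le_const[OF lim] LIMSEQ_le_const2[OF lim])
  show "a \<le> b \<Longrightarrow> Ulim z c h a \<le> Ulim z c h b"
    by (rule LIMSEQ_le[OF lim lim]) (use P in auto)
  show adm: "adm h 1 (Ulim z c h)"
    using m b by (auto simp: adm_def intro: order_trans[of _ 1])
  show Qlim: "(\<lambda>n. Q h (U z c h n) a) \<longlonglongrightarrow> Q h (Ulim z c h) a"
    by (rule Q_tendsto[OF adm_U[OF zc zc'] m]) (simp add: lim)
  have "(\<lambda>n. U z c h (Suc n) a) \<longlonglongrightarrow> 1 - z * (1 - Q h (Ulim z c h) a) ^ d"
    unfolding U.simps by (intro tendsto_intros Qlim)
  with LIMSEQ_Suc[OF lim] show "Ulim z c h a = 1 - z * (1 - Q h (Ulim z c h) a) ^ d"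
    by (rule LIMSEQ_unique)
  show "0 \<le> Q h (Ulim z c h) a" by (rule Q_nonneg[OF adm])
  show "Q h (Ulim z c h) a \<le> 1" by (rule Q_le_const[OF adm]) (use b in auto)
qed

text \<open>For \<open>a\<close> at or above \<open>h\<close>, \<open>surv\<close> is the survival
  probability in \<open>T_plus\<close> and \<open>lap s\<close> the function \<open>u_s\<close>.
  Below \<open>h\<close> both are continuations by the recursion, not quantities of the then empty
  cluster.\<close>

abbreviation surv :: "real \<Rightarrow> real \<Rightarrow> real" where "surv \<equiv> Ulim 1 0"
abbreviation lap :: "real \<Rightarrow> real \<Rightarrow> real \<Rightarrow> real" where "lap s \<equiv> Ulim (exp (- s)) 1"

section \<open>Measurability and Laplace transform of the size tail\<close>

lemma genf_card: "genf z 1 k h n a Y = z ^ card {x \<in> branch k h a Y. length x < n}"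
  by (simp add: genf_def)

text \<open>The cardinality is recovered as \<open>- ln\<close> of \<open>genf\<close> at
  \<open>z = exp (- 1)\<close>, whose measurability is already known.\<close>

lemma card_measurable [measurable]:
  "(\<lambda>Y. real (card {x \<in> branch k h a Y. length x < n})) \<in> borel_measurable cfg"
proof -
  have "(\<lambda>Y. real (card {x \<in> branch k h a Y. length x < n})) = (\<lambda>Y. - ln (genf (exp (- 1)) 1 k h n a Y))"
    by (simp add: genf_card ln_realpow)
  then show ?thesis by simp
qed

lemma card_level_incseq:
  "m \<le> n \<Longrightarrow> card {x \<in> branch k h a Y. length x < m} \<le> card {x \<in> branch k h a Y. length x < n}"
  by (intro card_mono finite_branch_level) auto

text \<open>Truncations at a generation are always finite, so the event becomes a countable union
  that also covers infinite clusters.\<close>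

lemma size_gt_iff:
  "size_gt (branch k h a Y) t \<longleftrightarrow> (\<exists>n. t < real (card {x \<in> branch k h a Y. length x < n}))"
proof (cases "finite (branch k h a Y)")
  case True
  then obtain m where m: "\<forall>x\<in>branch k h a Y. length x < m"
    using finite_nat_set_iff_bounded[of "length ` branch k h a Y"] by auto
  then have "{x \<in> branch k h a Y. length x < m} = branch k h a Y" by auto
  moreover have "card {x \<in> branch k h a Y. length x < n} \<le> card (branch k h a Y)" for n
    using True by (intro card_mono) auto
  ultimately show ?thesis using True
    by (auto simp: size_gt_def intro: exI[of _ m] order_less_le_trans)
next
  case False
  obtain N :: nat where N: "t < real N" using reals_Archimedean2 by blast
  obtain F where F: "finite F" "card F = N" "F \<subseteq> branch k h a Y"
    using infinite_arbitrarily_large[OF False] by blast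
  obtain m where m: "\<forall>x\<in>F. length x < m"
    using finite_nat_set_iff_bounded[of "length ` F"] F(1) by auto
  have "N \<le> card {x \<in> branch k h a Y. length x < m}"
    unfolding F(2)[symmetric] by (intro card_mono finite_branch_level) (use F m in auto)
  then show ?thesis using N False by (auto simp: size_gt_def intro!: exI[of _ m])
qed

definition tail :: "nat \<Rightarrow> real \<Rightarrow> real \<Rightarrow> real \<Rightarrow> real" where
  "tail k h a t = measure (field_space d) {Y. size_gt (branch k h a Y) t}"

lemma size_gt_measurable [measurable]: "{Y. size_gt (branch k h a Y) t} \<in> sets cfg"
proof -
  have "Measurable.pred cfg (\<lambda>Y. \<exists>n. t < real (card {x \<in> branch k h a Y. length x < n}))"
    by measurable
  then have "{Y \<in> space cfg. \<exists>n. t < real (card {x \<in> branch k h a Y. length x < n})} \<in> sets cfg"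
    by measurable
  then show ?thesis unfolding size_gt_iff by (simp add: space_PiM)
qed

lemma tail_props:
  shows tail_antimono: "t \<le> t' \<Longrightarrow> tail k h a t' \<le> tail k h a t"
    and tail_bounds: "0 \<le> tail k h a t" "tail k h a t \<le> 1"
    and tail_measurable: "tail k h a \<in> borel_measurable borel"
proof -
  interpret prob_space "field_space d" by (rule prob_field)
  show 1: "tail k h a t' \<le> tail k h a t" if "t \<le> t'" for t t'
    unfolding tail_def
  proof (rule finite_measure_mono)
    show "{Y. size_gt (branch k h a Y) t'} \<subseteq> {Y. size_gt (branch k h a Y) t}"
      using that by (auto simp: size_gt_def)
  qed simp
  show "0 \<le> tail k h a t" "tail k h a t \<le> 1" by (auto simp: tail_def)
  have "mono (\<lambda>t. - tail k h a t)" using 1 by (intro monoI) auto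
  then have "(\<lambda>t. - tail k h a t) \<in> borel_measurable borel" by (rule borel_measurable_mono)
  then show "tail k h a \<in> borel_measurable borel" by simp
qed

text \<open>Tonelli: integrating \<open>s exp (- s t)\<close> over \<open>0 < t < N\<close> gives
  \<open>1 - exp (- s N)\<close>, so the left side is one minus the expected \<open>genf\<close>
  with \<open>c = 1\<close>.\<close>

lemma tail_laplace_level:
  assumes s: "s > 0" and a: "h \<le> a"
  shows "(\<integral>t. indicator {0<..} t * (s * exp (- (s * t))) *
      measure (field_space d) {Y. t < real (card {x \<in> branch k h a Y. length x < Suc n})} \<partial>lborel)
    = 1 - exp (- s) * (1 - Q h (U (exp (- s)) 1 h n) a) ^ k"
proof -
  interpret prob_space "field_space d" by (rule prob_field)
  interpret P: pair_sigma_finite lborel "field_space d" by unfold_locales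
  define N where "N Y = real (card {x \<in> branch k h a Y. length x < Suc n})" for Y
  have [measurable]: "N \<in> borel_measurable cfg" unfolding N_def by measurable
  let ?e = "\<lambda>t. indicator {0<..} t * (s * exp (- (s * t))) :: real"
  have e0: "0 \<le> ?e t" for t using s by simp
  have meas: "measure (field_space d) {Y. t < N Y} = enn2real (\<integral>\<^sup>+Y. (if t < N Y then 1 else 0) \<partial>field_space d)" for t
  proof -
    have "{Y. t < N Y} \<in> sets (field_space d)"
      using measurable_sets[of N "field_space d" borel "{t<..}"] by (simp add: vimage_def)
    then have "emeasure (field_space d) {Y. t < N Y} = (\<integral>\<^sup>+Y. indicator {Y. t < N Y} Y \<partial>field_space d)" by simp
    also have "\<dots> = (\<integral>\<^sup>+Y. (if t < N Y then 1 else 0) \<partial>field_space d)"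
      by (intro nn_integral_cong) (auto simp: indicator_def)
    finally show ?thesis by (simp add: measure_def)
  qed
  have fin: "(\<integral>\<^sup>+Y. (if t < N Y then 1 else 0) \<partial>field_space d) \<noteq> \<infinity>" for t
  proof -
    have "(\<integral>\<^sup>+Y. (if t < N Y then 1 else 0) \<partial>field_space d) \<le> (\<integral>\<^sup>+Y. 1 \<partial>field_space d)"
      by (intro nn_integral_mono) auto
    moreover have "emeasure (field_space d) UNIV = 1" using emeasure_space_1 by simp
    ultimately show ?thesis by (auto simp: top_unique)
  qed
  have "(\<integral>\<^sup>+t. ennreal (?e t * measure (field_space d) {Y. t < N Y}) \<partial>lborel)
     = (\<integral>\<^sup>+t. (\<integral>\<^sup>+Y. ennreal (?e t * (if t < N Y then 1 else 0)) \<partial>field_space d) \<partial>lborel)"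
  proof (rule nn_integral_cong)
    fix t
    have "ennreal (?e t * measure (field_space d) {Y. t < N Y}) = ennreal (?e t) * (\<integral>\<^sup>+Y. (if t < N Y then 1 else 0) \<partial>field_space d)"
      unfolding meas using e0 fin[of t] by (subst ennreal_mult) (auto simp: top.not_eq_extremum)
    also have "\<dots> = (\<integral>\<^sup>+Y. ennreal (?e t) * (if t < N Y then 1 else 0) \<partial>field_space d)"
      by (subst nn_integral_cmult) auto
    also have "\<dots> = (\<integral>\<^sup>+Y. ennreal (?e t * (if t < N Y then 1 else 0)) \<partial>field_space d)"
      by (intro nn_integral_cong) auto
    finally show "ennreal (?e t * measure (field_space d) {Y. t < N Y}) = (\<integral>\<^sup>+Y. ennreal (?e t * (if t < N Y then 1 else 0)) \<partial>field_space d)" .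
  qed
  also have "\<dots> = (\<integral>\<^sup>+Y. (\<integral>\<^sup>+t. ennreal (?e t * (if t < N Y then 1 else 0)) \<partial>lborel) \<partial>field_space d)"
    by (rule P.Fubini'[symmetric]) measurable
  also have "\<dots> = (\<integral>\<^sup>+Y. ennreal (1 - exp (- (s * N Y))) \<partial>field_space d)"
    by (intro nn_integral_cong exp_integral_Ioo s) (simp add: N_def)
  also have "\<dots> = (\<integral>\<^sup>+Y. ennreal (1 - genf (exp (- s)) 1 k h (Suc n) a Y) \<partial>field_space d)"
    by (simp add: genf_card N_def exp_of_nat_mult[symmetric] mult.commute)
  finally have nn: "(\<integral>\<^sup>+t. ennreal (?e t * measure (field_space d) {Y. t < N Y}) \<partial>lborel)
     = (\<integral>\<^sup>+Y. ennreal (1 - genf (exp (- s)) 1 k h (Suc n) a Y) \<partial>field_space d)" .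
  have zc: "0 \<le> exp (- s)" "exp (- s) \<le> 1" "(0::real) \<le> 1" "(1::real) \<le> 1" using s by auto
  have int: "integrable (field_space d) (genf (exp (- s)) 1 k h (Suc n) a)"
    by (rule integrable_const_bound[of _ 1]) (use genf_bounds[OF zc] in auto)
  have tm[measurable]: "(\<lambda>t. measure (field_space d) {Y. t < N Y}) \<in> borel_measurable borel"
    unfolding meas by measurable
  have "(\<integral>t. ?e t * measure (field_space d) {Y. t < N Y} \<partial>lborel)
     = enn2real (\<integral>\<^sup>+Y. ennreal (1 - genf (exp (- s)) 1 k h (Suc n) a Y) \<partial>field_space d)"
    unfolding nn[symmetric] by (rule integral_eq_nn_integral) (use e0 in auto)
  also have "\<dots> = (\<integral>Y. 1 - genf (exp (- s)) 1 k h (Suc n) a Y \<partial>field_space d)"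
    by (rule integral_eq_nn_integral[symmetric]) (use genf_bounds[OF zc] in auto)
  also have "\<dots> = 1 - exp (- s) * (1 - Q h (U (exp (- s)) 1 h n) a) ^ k"
    using int prob_space genf_expectation[OF zc a] by simp
  finally show ?thesis by (simp add: N_def)
qed

lemma tail_laplace:
  assumes s: "s > 0" and a: "h \<le> a"
  shows "(\<integral>t. indicator {0<..} t * (s * exp (- (s * t))) * tail k h a t \<partial>lborel)
    = 1 - exp (- s) * (1 - Q h (lap s h) a) ^ k"
proof (rule LIMSEQ_unique)
  interpret prob_space "field_space d" by (rule prob_field)
  let ?A = "\<lambda>n t. {Y. t < real (card {x \<in> branch k h a Y. length x < Suc n})}"
  let ?e = "\<lambda>t. indicator {0<..} t * (s * exp (- (s * t))) :: real"
  have A: "?A n t \<in> sets (field_space d)" for n t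
    using measurable_sets[of "\<lambda>Y. real (card {x \<in> branch k h a Y. length x < Suc n})" "field_space d" borel "{t<..}"]
    by (simp add: vimage_def)
  show "(\<lambda>n. \<integral>t. ?e t * measure (field_space d) (?A n t) \<partial>lborel) \<longlonglongrightarrow> (\<integral>t. ?e t * tail k h a t \<partial>lborel)"
  proof (rule integral_dominated_convergence)
    have "integrable lborel (\<lambda>x. s * (indicator {0<..} x * exp (- (s * x))))"
      using exp_integral_Ioi(1)[OF s] by (rule integrable_mult_right)
    then show "integrable lborel ?e" by (simp add: mult_ac)
    note [measurable] = tail_measurable
    show "(\<lambda>t. ?e t * tail k h a t) \<in> borel_measurable lborel" by measurable
    show "(\<lambda>t. ?e t * measure (field_space d) (?A n t)) \<in> borel_measurable lborel" for n
    proof -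
      have "mono (\<lambda>t. - measure (field_space d) (?A n t))"
        using A by (intro monoI) (auto intro!: finite_measure_mono)
      then have "(\<lambda>t. - measure (field_space d) (?A n t)) \<in> borel_measurable borel" by (rule borel_measurable_mono)
      then have [measurable]: "(\<lambda>t. measure (field_space d) (?A n t)) \<in> borel_measurable borel" by simp
      show ?thesis by measurable
    qed
    show "AE t in lborel. norm (?e t * measure (field_space d) (?A n t)) \<le> ?e t" for n
      using s by (intro AE_I2) (auto simp: indicator_def abs_mult mult_left_le)
    show "AE t in lborel. (\<lambda>n. ?e t * measure (field_space d) (?A n t)) \<longlonglongrightarrow> ?e t * tail k h a t"
    proof (intro AE_I2 tendsto_intros)
      fix t
      have inc: "incseq (\<lambda>n. ?A n t)"
      proof (intro incseq_SucI subsetI CollectI)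
        fix n Y assume "Y \<in> ?A n t"
        then show "t < real (card {x \<in> branch k h a Y. length x < Suc (Suc n)})"
          using card_level_incseq[of "Suc n" "Suc (Suc n)" k h a Y] by simp
      qed
      have "(\<Union>n. ?A n t) = {Y. size_gt (branch k h a Y) t}"
      proof (intro equalityI subsetI)
        fix Y assume "Y \<in> {Y. size_gt (branch k h a Y) t}"
        then obtain n where "t < real (card {x \<in> branch k h a Y. length x < n})" by (auto simp: size_gt_iff)
        then have "t < real (card {x \<in> branch k h a Y. length x < Suc n})"
          using card_level_incseq[of n "Suc n" k h a Y] by linarith
        then show "Y \<in> (\<Union>n. ?A n t)" by blast
      qed (auto simp: size_gt_iff)
      then show "(\<lambda>n. measure (field_space d) (?A n t)) \<longlonglongrightarrow> tail k h a t"
        using finite_Lim_measure_incseq[OF _ inc] A by (auto simp: tail_def)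
    qed
  qed
  show "(\<lambda>n. \<integral>t. ?e t * measure (field_space d) (?A n t) \<partial>lborel) \<longlonglongrightarrow> 1 - exp (- s) * (1 - Q h (lap s h) a) ^ k"
    unfolding tail_laplace_level[OF s a] using s by (intro tendsto_intros Q_U_tendsto) auto
qed

text \<open>With \<open>c = 0\<close> any vertex of generation \<open>n\<close> makes the weight
  vanish. A branch is closed under ancestors and has finite generations, so it is infinite iff every
  generation is occupied.\<close>

lemma infinite_branch_tendsto:
  "(\<lambda>n. 1 - genf 1 0 k h n a Y) \<longlonglongrightarrow> (if infinite (branch k h a Y) then 1 else 0)"
proof (cases "finite (branch k h a Y)")
  case True
  then obtain m where m: "\<forall>x\<in>branch k h a Y. length x < m"
    using finite_nat_set_iff_bounded[of "length ` branch k h a Y"] by auto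
  have "genf 1 0 k h n a Y = 1" if "m \<le> n" for n
  proof -
    have "{x \<in> branch k h a Y. length x = n} = {}" using m that by auto
    then show ?thesis unfolding genf_def by (simp only: card.empty) simp
  qed
  then have "eventually (\<lambda>n. 1 - genf 1 0 k h n a Y = 0) sequentially"
    by (auto simp: eventually_sequentially)
  then show ?thesis using True by (simp add: tendsto_eventually)
next
  case False
  have "genf 1 0 k h n a Y = 0" for n
  proof -
    have "\<exists>x\<in>branch k h a Y. n \<le> length x"
    proof (rule ccontr)
      assume "\<not> ?thesis"
      then have "branch k h a Y = {x \<in> branch k h a Y. length x < n}" by auto
      then show False using False finite_branch_level[of k h a Y n] by simp
    qed
    then obtain x where x: "x \<in> branch k h a Y" "n \<le> length x" by blast
    \<comment> \<open>The ancestor of \<open>x\<close> in generation \<open>n\<close>: dropping from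
      the front removes the steps farthest from the root.\<close>
    define y where "y = drop (length x - n) x"
    have len: "length y = n" using x by (simp add: y_def)
    have "y \<in> branch k h a Y"
    proof -
      have "y = [] \<or> (last y < k \<and> set (butlast y) \<subseteq> {..<d})"
        using x(1) unfolding branch_def y_def
        by (auto simp: last_drop butlast_drop dest: in_set_dropD)
      moreover have "h \<le> phi d a Y (drop j y)" if "j \<le> length y" for j
        using x that by (simp add: branch_def y_def add.commute)
      ultimately show ?thesis by (simp add: branch_def)
    qed
    then have "card {x \<in> branch k h a Y. length x = n} \<noteq> 0"
      using len finite_branch_level'[of k h a Y n] by auto
    then show ?thesis by (simp add: genf_def)
  qed
  then show ?thesis using False by simp
qed

lemma prob_infinite:
  assumes a: "h \<le> a"
  shows "(\<integral>Y. (if infinite (branch k h a Y) then 1 else 0) \<partial>field_space d) = 1 - (1 - Q h (surv h) a) ^ k"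
proof (rule LIMSEQ_unique)
  interpret prob_space "field_space d" by (rule prob_field)
  have zc: "(0::real) \<le> 1" "(1::real) \<le> 1" "(0::real) \<le> 0" "(0::real) \<le> 1" by auto
  show "(\<lambda>n. \<integral>Y. 1 - genf 1 0 k h (Suc n) a Y \<partial>field_space d) \<longlonglongrightarrow> (\<integral>Y. (if infinite (branch k h a Y) then 1 else 0) \<partial>field_space d)"
  proof (rule integral_dominated_convergence)
    show "integrable (field_space d) (\<lambda>_. 1::real)" by simp
    show "AE Y in field_space d. (\<lambda>n. 1 - genf 1 0 k h (Suc n) a Y) \<longlonglongrightarrow> (if infinite (branch k h a Y) then 1 else 0)"
      by (intro AE_I2 LIMSEQ_Suc infinite_branch_tendsto)
    show "(\<lambda>Y. if infinite (branch k h a Y) then 1 else 0 :: real) \<in> borel_measurable (field_space d)"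
      by (rule borel_measurable_LIMSEQ_real[OF infinite_branch_tendsto]) simp
    show "AE Y in field_space d. norm (1 - genf 1 0 k h (Suc n) a Y) \<le> 1" for n
      using genf_bounds[OF zc] by auto
  qed simp
  have "integrable (field_space d) (genf 1 0 k h (Suc n) a)" for n
    by (rule integrable_const_bound[of _ 1]) (use genf_bounds[OF zc] in auto)
  then have "(\<integral>Y. 1 - genf 1 0 k h (Suc n) a Y \<partial>field_space d) = 1 - 1 * (1 - Q h (U 1 0 h n) a) ^ k" for n
    using genf_expectation[OF zc a] prob_space by simp
  then show "(\<lambda>n. \<integral>Y. 1 - genf 1 0 k h (Suc n) a Y \<partial>field_space d) \<longlonglongrightarrow> 1 - (1 - Q h (surv h) a) ^ k"
    by (auto intro!: tendsto_intros Q_U_tendsto)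
qed

section \<open>From clusters to branches, and from percolation to the fixed point\<close>

lemma is_vertex_iff: "is_vertex d x \<longleftrightarrow> x = [] \<or> (last x < Suc d \<and> set (butlast x) \<subseteq> {..<d})"
  by (auto simp: is_vertex_def)

text \<open>In a tree every connection from the root to \<open>x\<close> runs through all ancestors
  of \<open>x\<close>. Along a path, openness of all ancestors survives a step to a child, which
  adds one open vertex, and a step to the parent, which removes one.\<close>

lemma cluster_eq_branch: "cluster d h (phi d a Y) = branch (Suc d) h a Y"
proof (intro equalityI subsetI)
  let ?R = "\<lambda>u v. tree_adj d u v \<and> h \<le> phi d a Y u \<and> h \<le> phi d a Y v"
  fix x assume "x \<in> cluster d h (phi d a Y)"
  then have "h \<le> a" "?R\<^sup>*\<^sup>* [] x" by (auto simp: cluster_def)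
  from this(2) show "x \<in> branch (Suc d) h a Y"
  proof (induction rule: rtranclp_induct)
    case base show ?case using \<open>h \<le> a\<close> by (simp add: branch_Nil)
  next
    case (step u v)
    have u: "\<And>j. j \<le> length u \<Longrightarrow> h \<le> phi d a Y (drop j u)" using step.IH by (simp add: branch_def)
    have "h \<le> phi d a Y (drop j v)" if "j \<le> length v" for j
      using step.hyps(2) unfolding tree_adj_def
    proof (elim conjE disjE exE)
      fix i assume "v = i # u"
      then show ?thesis using u step.hyps(2) that by (cases j) auto
    next
      fix i assume "u = i # v"
      then show ?thesis using u[of "Suc j"] that by auto
    qed
    moreover have "is_vertex d v" using step.hyps(2) by (simp add: tree_adj_def)
    ultimately show ?case by (auto simp: branch_def is_vertex_iff)
  qed
next
  let ?R = "\<lambda>u v. tree_adj d u v \<and> h \<le> phi d a Y u \<and> h \<le> phi d a Y v"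
  have cons: "is_vertex d x" if "is_vertex d (i # x)" for i x
    using that by (cases "x = []") (auto simp: is_vertex_def)
  fix x assume x: "x \<in> branch (Suc d) h a Y"
  have "?R\<^sup>*\<^sup>* [] x" if "is_vertex d x" "\<forall>j\<le>length x. h \<le> phi d a Y (drop j x)" for x
    using that
  proof (induction x)
    case (Cons i x)
    have sx: "\<forall>j\<le>length x. h \<le> phi d a Y (drop j x)"
    proof (intro allI impI)
      fix j assume "j \<le> length x"
      then show "h \<le> phi d a Y (drop j x)" using Cons.prems(2)[rule_format, of "Suc j"] by simp
    qed
    have vx: "is_vertex d x" using Cons.prems(1) by (rule cons)
    have "?R x (i # x)"
      using vx Cons.prems sx[rule_format, of 0] Cons.prems(2)[rule_format, of 0]
      by (auto simp: tree_adj_def simp del: phi.simps)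
    with Cons.IH[OF vx sx] show ?case by (rule rtranclp.rtrancl_into_rtrancl)
  qed simp
  moreover have "is_vertex d x" "\<forall>j\<le>length x. h \<le> phi d a Y (drop j x)"
    using x by (auto simp: branch_def is_vertex_iff)
  moreover have "h \<le> phi d a Y []"
    using \<open>\<forall>j\<le>length x. h \<le> phi d a Y (drop j x)\<close>[rule_format, of "length x"] by simp
  ultimately show "x \<in> cluster d h (phi d a Y)" by (simp add: cluster_def del: phi.simps)
qed

lemma cluster_T_plus_eq_branch: "cluster d h (phi d a Y) \<inter> T_plus d = branch d h a Y"
  unfolding cluster_eq_branch by (auto simp: branch_def T_plus_def is_vertex_iff)

lemma Pa_cluster: "Pa d a (\<lambda>\<phi>. size_gt (cluster d h \<phi>) t) = tail (Suc d) h a t"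
  and Pa_cluster_T_plus: "Pa d a (\<lambda>\<phi>. size_gt (cluster d h \<phi> \<inter> T_plus d) t) = tail d h a t"
  by (simp add: Pa_def tail_def cluster_eq_branch, simp only: Pa_def tail_def cluster_T_plus_eq_branch, simp)

lemma branch_root: "branch k h a (Y([] := r)) = branch k h a Y"
proof -
  have "phi d a (Y([] := r)) x = phi d a Y x" for x by (induction x) auto
  then show ?thesis by (simp add: branch_def)
qed

lemma Pfree_infinite:
  "Pfree d (\<lambda>\<phi>. infinite (cluster d h \<phi>))
   = (\<integral>r. indicator {h..} r * (1 - (1 - Q h (surv h) r) ^ Suc d) \<partial>nu d)"
proof -
  interpret prob_space "field_space d" by (rule prob_field)
  let ?I = "\<lambda>a Y. if infinite (branch (Suc d) h a Y) then 1 else (0::real)"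
  have jm: "(\<lambda>p. ?I (fst p) (snd p)) \<in> borel_measurable (borel \<Otimes>\<^sub>M cfg)"
    by (rule borel_measurable_LIMSEQ_real[OF infinite_branch_tendsto])
       (use genf_measurable in \<open>simp add: case_prod_beta\<close>)
  have "(\<lambda>Y. (Y [], Y)) \<in> measurable cfg (borel \<Otimes>\<^sub>M cfg)" by measurable
  from measurable_compose[OF this jm]
  have m1: "(\<lambda>Y. ?I (Y []) Y) \<in> borel_measurable cfg" by simp
  have m2: "?I a \<in> borel_measurable cfg" for a
  proof -
    have "Pair a \<in> measurable cfg (borel \<Otimes>\<^sub>M cfg)" by simp
    from measurable_compose[OF this jm] show ?thesis by simp
  qed
  have "Pfree d (\<lambda>\<phi>. infinite (cluster d h \<phi>)) = measure (field_space d) {Y. infinite (branch (Suc d) h (Y []) Y)}"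
    by (simp add: Pfree_def cluster_eq_branch)
  also have "\<dots> = (\<integral>Y. indicator {Y. infinite (branch (Suc d) h (Y []) Y)} Y \<partial>field_space d)" by simp
  also have "\<dots> = (\<integral>Y. ?I (Y []) Y \<partial>field_space d)"
    by (intro Bochner_Integration.integral_cong) (auto simp: indicator_def)
  also have "\<dots> = (\<integral>r. (\<integral>X. ?I ((X([] := r)) []) (X([] := r)) \<partial>nonroot) \<partial>nu d)"
    by (rule root_split[OF prob_nu sets_nu]) (use m1 in \<open>auto simp: field_space_eq coord_def[abs_def]\<close>)
  also have "\<dots> = (\<integral>r. indicator {h..} r * (1 - (1 - Q h (surv h) r) ^ Suc d) \<partial>nu d)"
  proof (rule Bochner_Integration.integral_cong[OF refl])
    fix r
    have "(\<integral>X. ?I ((X([] := r)) []) (X([] := r)) \<partial>nonroot) = (\<integral>Y. ?I r Y \<partial>field_space d)"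
      by (subst root_irrelevant[OF m2, where r=r]) (auto simp: branch_root)
    also have "\<dots> = indicator {h..} r * (1 - (1 - Q h (surv h) r) ^ Suc d)"
    proof (cases "h \<le> r")
      case True
      then show ?thesis using prob_infinite[OF True] by simp
    qed (simp add: branch_empty)
    finally show "(\<integral>X. ?I ((X([] := r)) []) (X([] := r)) \<partial>nonroot) = indicator {h..} r * (1 - (1 - Q h (surv h) r) ^ Suc d)" .
  qed
  finally show ?thesis .
qed

text \<open>\<open>Q\<close> is blind to null sets, and the fixed-point equation returns the value
  at every \<open>a\<close>, including \<open>a < h\<close>.\<close>

lemma surv_zero_of_AE:
  assumes "AE x in lborel. h \<le> x \<longrightarrow> surv h x = 0" shows "surv h a = 0"
proof -
  have "Q h (surv h) a = Q h (\<lambda>_. 0) a"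
    by (rule Q_cong_AE) (use assms Ulim_measurable[of 1 0] in auto)
  then have "Q h (surv h) a = 0" by (simp add: Q_eq)
  then show ?thesis using Ulim_fixed[of 1 0 h a] by simp
qed

text \<open>Makes the critical level a statement about the fixed point alone. A vanishing average
  over the root forces \<open>Q h (surv h)\<close> to vanish at some point, hence
  \<open>surv h\<close> almost everywhere by positivity of the kernel.\<close>

lemma Pfree_infinite_eq_0_iff:
  "Pfree d (\<lambda>\<phi>. infinite (cluster d h \<phi>)) = 0 \<longleftrightarrow> (\<forall>a. surv h a = 0)"
proof
  assume "\<forall>a. surv h a = 0"
  then have "Q h (surv h) r = 0" for r by (simp add: Q_eq)
  then show "Pfree d (\<lambda>\<phi>. infinite (cluster d h \<phi>)) = 0" by (simp add: Pfree_infinite)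
next
  assume 0: "Pfree d (\<lambda>\<phi>. infinite (cluster d h \<phi>)) = 0"
  interpret prob_space "nu d" by (rule prob_nu)
  let ?f = "\<lambda>r. indicator {h..} r * (1 - (1 - Q h (surv h) r) ^ Suc d)"
  have q: "0 \<le> Q h (surv h) r" "Q h (surv h) r \<le> 1" for r using Q_Ulim_bounds[of 1 0] by auto
  have p: "0 \<le> (1 - Q h (surv h) r) ^ Suc d" "(1 - Q h (surv h) r) ^ Suc d \<le> 1" for r
    using q[of r] by (auto intro!: power_le_one simp del: power_Suc)
  have [measurable]: "surv h \<in> borel_measurable borel" by (rule Ulim_measurable) auto
  have int: "integrable (nu d) ?f"
    by (rule integrable_const_bound[of _ 1]) (use p in \<open>auto simp: indicator_def simp del: power_Suc\<close>)
  have "AE r in nu d. ?f r = 0"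
    using 0 p unfolding Pfree_infinite
    by (subst (asm) integral_nonneg_eq_0_iff_AE[OF int]) (auto simp: indicator_def simp del: power_Suc)
  then have "AE r in lborel. ?f r = 0" by (simp only: nu_AE_iff)
  have "\<exists>r\<ge>h. ?f r = 0"
  proof (rule ccontr)
    assume "\<not> ?thesis"
    then have "AE x in lborel. x \<notin> {h..h + 1}"
      by (intro eventually_mono[OF \<open>AE r in lborel. ?f r = 0\<close>]) auto
    then have "emeasure lborel {h..h + 1} = 0"
      by (subst (asm) AE_iff_measurable[of "{h..h + 1}"]) auto
    then show False by simp
  qed
  then obtain r where "h \<le> r" "?f r = 0" by blast
  then have "(1 - Q h (surv h) r) ^ Suc d = 1 ^ Suc d" by (simp del: power_Suc)
  then have "1 - Q h (surv h) r = 1"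
    using q[of r] power_eq_imp_eq_base[of "1 - Q h (surv h) r" "Suc d" 1] by (simp del: power_Suc)
  then have "AE x in lborel. h \<le> x \<longrightarrow> surv h x = 0"
    by (intro Q_eq_0_AE[OF adm_Ulim]) auto
  then show "\<forall>a. surv h a = 0" using surv_zero_of_AE by blast
qed

end

section \<open>The critical level\<close>

lemma power_diff_le:
  fixes x y :: real
  assumes "0 \<le> y" "y \<le> x" "x \<le> 1"
  shows "x ^ n - y ^ n \<le> real n * (x - y)"
proof (induction n)
  case (Suc n)
  have "x ^ Suc n - y ^ Suc n = x * (x ^ n - y ^ n) + (x - y) * y ^ n" by (simp add: algebra_simps)
  also have "\<dots> \<le> 1 * (x ^ n - y ^ n) + (x - y) * 1"
    using assms by (intro add_mono mult_right_mono mult_left_mono power_le_one) (auto intro: power_mono)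
  finally show ?case using Suc by (simp add: algebra_simps)
qed simp

text \<open>Quantitative strict concavity of \<open>1 - (1 - q)^n\<close>: at half the argument more
  than half the value is left, with a surplus of order \<open>q^2\<close>.\<close>

lemma half_power_gain:
  fixes q :: real
  assumes "0 \<le> q" "q \<le> 1" "2 \<le> n"
  shows "(1 - (1 - q) ^ n) / 2 + q\<^sup>2 / 4 \<le> 1 - (1 - q / 2) ^ n"
proof -
  have 1: "1 - (1 - q) ^ n = q * (\<Sum>i<n. (1 - q) ^ i)"
    using one_diff_power_eq[of "1 - q" n] by simp
  have 2: "1 - (1 - q / 2) ^ n = q / 2 * (\<Sum>i<n. (1 - q / 2) ^ i)"
    using one_diff_power_eq[of "1 - q / 2" n] by simp
  \<comment> \<open>All these differences are nonnegative; only the one at \<open>i = 1\<close> is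
    kept, which exists since \<open>n \<ge> 2\<close> and equals \<open>q / 2\<close>.\<close>
  have "(1 - q / 2) ^ 1 - (1 - q) ^ 1 \<le> (\<Sum>i<n. (1 - q / 2) ^ i - (1 - q) ^ i)"
    by (rule member_le_sum) (use assms in \<open>auto intro!: power_mono\<close>)
  then have "q / 2 * (q / 2) \<le> q / 2 * ((\<Sum>i<n. (1 - q / 2) ^ i) - (\<Sum>i<n. (1 - q) ^ i))"
    using assms by (intro mult_left_mono) (auto simp: sum_subtractf)
  then show ?thesis unfolding 1 2 by (simp add: algebra_simps power2_eq_square)
qed

context tree_degree
begin

section \<open>Sub- and supersolutions of the survival equation\<close>

lemma surv_bounds: "0 \<le> surv h a" "surv h a \<le> 1"
  by (rule Ulim_bounds; simp)+

lemma surv_mono: "a \<le> b \<Longrightarrow> surv h a \<le> surv h b"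
  by (rule Ulim_mono) auto

lemma surv_fixed: "surv h a = 1 - (1 - Q h (surv h) a) ^ d"
  using Ulim_fixed[of 1 0 h a] by simp

lemma adm_surv: "adm h 1 (surv h)"
  by (rule adm_Ulim) auto

lemma Q_surv_bounds: "0 \<le> Q h (surv h) a" "Q h (surv h) a \<le> 1"
  by (rule Q_Ulim_bounds; simp)+

text \<open>\<open>surv\<close> is the limit of iterates started at the constant 1, and the map is
  monotone, so a subsolution stays below every iterate.\<close>

lemma subsolution_le_surv:
  assumes [measurable]: "g \<in> borel_measurable borel"
    and g: "\<And>x. h \<le> x \<Longrightarrow> 0 \<le> g x \<and> g x \<le> 1"
    and sub: "\<And>x. h \<le> x \<Longrightarrow> g x \<le> 1 - (1 - Q h g x) ^ d"
    and "h \<le> x"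
  shows "g x \<le> surv h x"
proof -
  have adm: "adm h 1 g" using g by (auto simp: adm_def intro: order_trans[of _ 1])
  have "g x \<le> U 1 0 h n x" if "h \<le> x" for n x
    using that
  proof (induction n arbitrary: x)
    case (Suc n)
    have U: "adm h 1 (U 1 0 h n)" by (rule adm_U) auto
    have "Q h g x \<le> Q h (U 1 0 h n) x"
      using Suc.IH by (intro Q_mono[OF adm U])
    moreover have "Q h (U 1 0 h n) x \<le> 1"
      by (rule Q_le_const[OF U]) (use U_props[of 1 0 h n] in auto)
    ultimately have "(1 - Q h (U 1 0 h n) x) ^ d \<le> (1 - Q h g x) ^ d"
      by (intro power_mono) auto
    then show ?case using sub[OF Suc.prems] by simp
  qed (use g in simp)
  then show ?thesis
    using \<open>h \<le> x\<close> by (intro LIMSEQ_le_const[OF U_tendsto]) auto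
qed

lemma surv_le_linear: "surv h x \<le> real d * Q h (surv h) x"
  using Bernoulli_inequality[of "- Q h (surv h) x" d] Q_surv_bounds[of h x] surv_fixed[of h x] by simp

text \<open>\<open>g\<close> plays the role of a finite expected cluster size. With
  \<open>L = d Q\<close>, the bounds \<open>surv \<le> 1\<close> and
  \<open>surv \<le> L surv\<close> give
  \<open>(n + 1) surv \<le> 1 + L (n surv) \<le> 1 + L g \<le> g\<close> inductively, and a finite
  \<open>g\<close> cannot dominate all multiples of a positive number.\<close>

lemma surv_eq_0_if_supersolution:
  assumes adm: "adm h B g" and sup: "\<And>x. h \<le> x \<Longrightarrow> 1 + real d * Q h g x \<le> g x"
  shows "surv h a = 0"
proof -
  have le: "real n * surv h x \<le> g x" if "h \<le> x" for n x
    using that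
  proof (induction n arbitrary: x)
    case 0 then show ?case using adm by (simp add: adm_def)
  next
    case (Suc n)
    have "adm h (real n) (\<lambda>x. real n * surv h x)"
      using adm_surv[of h] by (auto simp: adm_def intro!: mult_left_mono)
    then have "real n * Q h (surv h) x \<le> Q h g x"
      unfolding Q_cmult[symmetric] by (rule Q_mono[OF _ adm]) (use Suc.IH in auto)
    then have "real n * (real d * Q h (surv h) x) \<le> real d * Q h g x"
      using mult_left_mono[of "real n * Q h (surv h) x" "Q h g x" "real d"] by (simp add: mult_ac)
    moreover have "real n * surv h x \<le> real n * (real d * Q h (surv h) x)"
      by (intro mult_left_mono surv_le_linear) auto
    ultimately have "real (Suc n) * surv h x \<le> 1 + real d * Q h g x"
      using surv_bounds(2)[of h x] by (simp only: of_nat_Suc distrib_right mult_1_left)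
    then show ?case using sup[OF Suc.prems] by linarith
  qed
  have "surv h x = 0" if "h \<le> x" for x
  proof (rule ccontr)
    assume "surv h x \<noteq> 0"
    then have "surv h x > 0" using surv_bounds(1)[of h x] by linarith
    then obtain n :: nat where "g x < real n * surv h x" using reals_Archimedean3 by blast
    then show False using le[OF that, of n] by linarith
  qed
  then show ?thesis by (intro surv_zero_of_AE) auto
qed

lemma surv_antimono_level:
  assumes "h \<le> h'" shows "surv h' a \<le> surv h a"
proof -
  have "U 1 0 h' n a \<le> U 1 0 h n a" for n a
  proof (induction n arbitrary: a)
    case (Suc n)
    have U: "adm h 1 (U 1 0 h n)" "adm h' 1 (U 1 0 h n)" "adm h' 1 (U 1 0 h' n)"
      using U_props[of 1 0 h n] U_props[of 1 0 h' n] by (auto simp: adm_def intro: order_trans[of _ 1])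
    have "Q h' (U 1 0 h' n) a \<le> Q h' (U 1 0 h n) a"
      by (rule Q_mono[OF U(3,2)]) (rule Suc.IH)
    also have "\<dots> \<le> Q h (U 1 0 h n) a"
      by (rule Q_change_level(1)[OF U(1) assms, of 1]) (use U_props[of 1 0 h n] in auto)
    finally have "Q h' (U 1 0 h' n) a \<le> Q h (U 1 0 h n) a" .
    moreover have "Q h (U 1 0 h n) a \<le> 1"
      by (rule Q_le_const[OF U(1)]) (use U_props[of 1 0 h n] in auto)
    ultimately show ?case by (auto intro!: power_mono)
  qed simp
  then show ?thesis by (intro LIMSEQ_le[OF U_tendsto U_tendsto]) auto
qed

section \<open>Finiteness of the critical level and behaviour at it\<close>

definition subcrit :: "real set" where "subcrit = {h. \<forall>a. surv h a = 0}"

lemma h_star_eq: "h_star d = Inf subcrit"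
  unfolding h_star_def subcrit_def Pfree_infinite_eq_0_iff ..

lemma subcrit_upward: "h \<in> subcrit \<Longrightarrow> h \<le> h' \<Longrightarrow> h' \<in> subcrit"
  unfolding subcrit_def using surv_antimono_level[of h h'] surv_bounds(1)[of h']
  by (auto simp: order_antisym_conv)

lemma subcrit_nonempty: "subcrit \<noteq> {}"
proof -
  \<comment> \<open>From this level on, \<open>2 d + 1 \<le> x^2 / 2\<close>, and always
    \<open>x^2 / d \<le> x^2 / 2\<close>, so \<open>1 + x^2\<close> is a supersolution.\<close>
  define h where "h = 2 * (2 * real d + 1)"
  have "surv h a = 0" for a
  proof (rule surv_eq_0_if_supersolution)
    show "adm h 1 (\<lambda>x. 1 + x\<^sup>2)" by (simp add: adm_def)
    fix x assume x: "h \<le> x"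
    have d: "real d \<ge> 2" using d_ge_2 by simp
    have "real d * Q h (\<lambda>x. 1 + x\<^sup>2) x \<le> real d * (1 + sigma_Y2 d + (x / real d)\<^sup>2)"
      using Q_weight_le by (intro mult_left_mono) auto
    also have "\<dots> = 2 * real d + 1 + x\<^sup>2 / real d"
      using d by (simp add: sigma_Y2_def field_simps power2_eq_square)
    also have "x\<^sup>2 / real d \<le> x\<^sup>2 / 2"
      using d by (intro divide_left_mono) auto
    also have "2 * real d + 1 \<le> x\<^sup>2 / 2"
    proof -
      have "1 \<le> x" "2 * (2 * real d + 1) \<le> x" using x d by (auto simp: h_def)
      then have "2 * (2 * real d + 1) \<le> x * x" using mult_mono[of 1 x "2 * (2 * real d + 1)" x] d by simp
      then show ?thesis by (simp add: power2_eq_square)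
    qed
    finally show "1 + real d * Q h (\<lambda>x. 1 + x\<^sup>2) x \<le> 1 + x\<^sup>2" by simp
  qed
  then show ?thesis by (auto simp: subcrit_def)
qed

text \<open>At a very low level half the indicator of \<open>[- M, M]\<close> is a subsolution:
  division by \<open>d\<close> at least halves the position, and the noise rarely exceeds
  \<open>M / 2\<close>.\<close>

lemma subcrit_bdd_below: "bdd_below subcrit"
proof -
  interpret N: prob_space noise by (rule prob_noise)
  have "(\<lambda>n. measure noise {- real n..real n}) \<longlonglongrightarrow> measure noise (\<Union>n. {- real n..real n})"
    by (rule N.finite_Lim_measure_incseq) (auto simp: incseq_def)
  moreover have "(\<Union>n. {- real n..real n}) = space noise"
  proof -
    have "\<exists>n. - real n \<le> x \<and> x \<le> real n" for x
    proof -
      obtain n where "\<bar>x\<bar> \<le> real n" using real_arch_simple by blast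
      then show ?thesis by (intro exI[of _ n]) auto
    qed
    then show ?thesis by auto
  qed
  ultimately have "(\<lambda>n. measure noise {- real n..real n}) \<longlonglongrightarrow> 1"
    using N.prob_space by simp
  \<comment> \<open>The threshold 3/4 suffices: halved it gives \<open>Q \<ge> 3 / 8\<close>, and
    \<open>(5 / 8)^2 \<le> 1 / 2\<close>.\<close>
  then have "eventually (\<lambda>n. 3 / 4 < measure noise {- real n..real n}) sequentially"
    by (rule order_tendstoD) simp
  then obtain n where n: "3 / 4 < measure noise {- real n..real n}"
    by (auto simp: eventually_sequentially)
  define M where "M = 2 * real n"
  define g :: "real \<Rightarrow> real" where "g x = indicator {-M..M} x / 2" for x
  have [measurable]: "g \<in> borel_measurable borel" unfolding g_def by measurable
  have adm: "adm (- M) 1 g"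
    unfolding adm_def g_def by (auto simp: indicator_def intro: order_trans[of _ 1])
  have "g x \<le> surv (- M) x" if "- M \<le> x" for x
  proof (rule subsolution_le_surv[OF _ _ _ that])
    show "0 \<le> g x \<and> g x \<le> 1" for x by (auto simp: g_def indicator_def)
    fix x assume "- M \<le> x"
    have q: "0 \<le> Q (- M) g x" "Q (- M) g x \<le> 1"
      by (rule Q_nonneg[OF adm], rule Q_le_const[OF adm]) (auto simp: g_def indicator_def)
    show "g x \<le> 1 - (1 - Q (- M) g x) ^ d"
    proof (cases "x \<le> M")
      case False
      then have "g x = 0" by (simp add: g_def)
      moreover have "(1 - Q (- M) g x) ^ d \<le> 1" using q by (intro power_le_one) auto
      ultimately show ?thesis by simp
    next
      case True
      have "\<bar>x / real d\<bar> \<le> M / 2"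
      proof -
        have "\<bar>x / real d\<bar> = \<bar>x\<bar> / real d" by simp
        also have "\<dots> \<le> \<bar>x\<bar> / 2" using d_ge_2 by (intro divide_left_mono) auto
        finally show ?thesis using True \<open>- M \<le> x\<close> by linarith
      qed
      then have le: "- M \<le> x / real d + y \<and> x / real d + y \<le> M" if "\<bar>y\<bar> \<le> real n" for y
        using that unfolding M_def by linarith
      have "(\<integral>y. indicator {- real n..real n} y / 2 \<partial>noise) \<le> Q (- M) g x"
        unfolding Q_eq_noise[OF adm_measurable[OF adm]]
      proof (intro integral_mono noise_integrable[OF adm] integrable_divide)
        show "integrable noise (indicat_real {- real n..real n})"
          by (rule integrable_real_indicator) (auto simp: N.emeasure_eq_measure)
        show "indicator {- real n..real n} y / 2 \<le> indicator {- M..} (x / real d + y) * g (x / real d + y)" for y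
          using le[of y] by (cases "\<bar>y\<bar> \<le> real n") (auto simp: g_def indicator_def)
      qed
      then have "3 / 8 \<le> Q (- M) g x" using n by simp
      then have "(1 - Q (- M) g x) ^ d \<le> (1 - 3 / 8) ^ d" using q by (intro power_mono) auto
      also have "\<dots> \<le> (1 - 3 / 8) ^ 2" using d_ge_2 by (intro power_decreasing) auto
      also have "\<dots> \<le> (1 / 2 :: real)" by (simp add: power2_eq_square)
      finally show ?thesis by (simp add: g_def indicator_def)
    qed
  qed simp
  moreover have "g 0 = 1 / 2" by (simp add: g_def M_def)
  moreover have "- M \<le> 0" by (simp add: M_def)
  ultimately have "1 / 2 \<le> surv (- M) 0" by metis
  then have "surv (- M) 0 \<noteq> 0" by linarith
  then have "- M \<notin> subcrit" by (auto simp: subcrit_def)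
  then have "- M \<le> h" if "h \<in> subcrit" for h
    using subcrit_upward[OF that, of "- M"] by linarith
  then show ?thesis by (rule bdd_belowI)
qed

text \<open>Survival at the critical level would persist at slightly higher levels, because half of a
  nontrivial fixed point is a strict subsolution.\<close>
lemma surv_h_star: "surv (h_star d) a = 0"
proof (rule ccontr)
  define h where "h = h_star d"
  assume a0: "surv (h_star d) a \<noteq> 0"
  \<comment> \<open>By monotonicity this is the minimum of \<open>Q h (surv h)\<close> on
    \<open>[h, \<infinity>)\<close>, which makes the quadratic gain uniform in
    \<open>x\<close>.\<close>
  define q0 where "q0 = Q h (surv h) h"
  have "q0 \<noteq> 0"
  proof
    assume "q0 = 0"
    then have "AE x in lborel. h \<le> x \<longrightarrow> surv h x = 0"
      unfolding q0_def by (rule Q_eq_0_AE[OF adm_surv])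
    then show False using surv_zero_of_AE[of h a] a0 by (simp add: h_def)
  qed
  then have q0: "0 < q0" "q0 \<le> 1" using Q_surv_bounds[of h h] by (auto simp: q0_def)
  have qx: "q0 \<le> Q h (surv h) x" if "h \<le> x" for x
    unfolding q0_def by (rule Q_mono_arg[OF adm_surv _ that]) (rule surv_mono)
  \<comment> \<open>Chosen so that the loss \<open>d \<epsilon> / 2\<close> from raising the level
    equals \<open>q0^2 / 4\<close>, the least gain from halving.\<close>
  define \<epsilon> where "\<epsilon> = q0\<^sup>2 / (2 * real d)"
  have \<epsilon>: "0 < \<epsilon>" using q0 by (simp add: \<epsilon>_def)
  define g where "g x = surv h x / 2" for x
  have [measurable]: "g \<in> borel_measurable borel"
    unfolding g_def using adm_measurable[OF adm_surv] by simp
  have g01: "0 \<le> g x \<and> g x \<le> 1 / 2" for x using surv_bounds[of h x] by (simp add: g_def)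
  have adm: "adm h 1 g"
    using g01 by (auto simp: adm_def intro: order_trans[of _ 1] order_trans[of _ "1 / 2"])
  have adm': "adm (h + \<epsilon>) 1 g" using adm \<epsilon> by (auto simp: adm_def)
  have "g x \<le> surv (h + \<epsilon>) x" if "h + \<epsilon> \<le> x" for x
  proof (rule subsolution_le_surv[OF _ _ _ that])
    show "0 \<le> g x \<and> g x \<le> 1" for x using g01[of x] by linarith
    fix x assume "h + \<epsilon> \<le> x"
    then have x: "h \<le> x" using \<epsilon> by linarith
    let ?q = "Q h (surv h) x"
    have q: "Q h g x = ?q / 2" unfolding g_def by (rule Q_divide)
    have lev: "Q (h + \<epsilon>) g x \<le> ?q / 2" "?q / 2 \<le> Q (h + \<epsilon>) g x + \<epsilon> * (1 / 2)"
      using Q_change_level[OF adm, of "h + \<epsilon>" "1 / 2" x] \<epsilon> g01 by (auto simp: q)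
    have q': "0 \<le> Q (h + \<epsilon>) g x" by (rule Q_nonneg[OF adm'])
    have "(1 - Q (h + \<epsilon>) g x) ^ d - (1 - ?q / 2) ^ d \<le> real d * ((1 - Q (h + \<epsilon>) g x) - (1 - ?q / 2))"
      using lev q' Q_surv_bounds[of h x] by (intro power_diff_le) auto
    also have "\<dots> \<le> real d * (\<epsilon> * (1 / 2))"
      using lev by (intro mult_left_mono) auto
    also have "\<dots> = q0\<^sup>2 / 4" by (simp add: \<epsilon>_def)
    also have "\<dots> \<le> ?q\<^sup>2 / 4" using qx[OF x] q0 by (intro divide_right_mono power_mono) auto
    finally have 1: "(1 - Q (h + \<epsilon>) g x) ^ d - (1 - ?q / 2) ^ d \<le> ?q\<^sup>2 / 4" .
    have "(1 - (1 - ?q) ^ d) / 2 + ?q\<^sup>2 / 4 \<le> 1 - (1 - ?q / 2) ^ d"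
      using Q_surv_bounds[of h x] d_ge_2 by (intro half_power_gain)
    with 1 show "g x \<le> 1 - (1 - Q (h + \<epsilon>) g x) ^ d"
      unfolding g_def surv_fixed[of h x] by linarith
  qed simp
  moreover have "0 < g (h + \<epsilon>)"
  proof -
    have "(1 - Q h (surv h) (h + \<epsilon>)) ^ d \<le> (1 - q0) ^ d"
      using qx[of "h + \<epsilon>"] \<epsilon> Q_surv_bounds[of h] by (intro power_mono) auto
    also have "\<dots> < 1" using q0 by (intro power_strict_mono[of "1 - q0" 1 d, simplified]) auto
    finally show ?thesis unfolding g_def by (subst surv_fixed) simp
  qed
  ultimately have "surv (h + \<epsilon>) (h + \<epsilon>) > 0" by (meson order_refl order_less_le_trans)
  then have no: "h + \<epsilon> \<notin> subcrit" unfolding subcrit_def by (metis (mono_tags) less_irrefl mem_Collect_eq)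
  have "Inf subcrit < h + \<epsilon>" using \<epsilon> by (simp add: h_def h_star_eq)
  then obtain z where "z \<in> subcrit" "z < h + \<epsilon>"
    using cInf_lessD[OF subcrit_nonempty] by blast
  then show False using no subcrit_upward[of z "h + \<epsilon>"] by simp
qed

text \<open>A finite expected cluster size at the critical level would persist at slightly lower levels.\<close>
lemma no_supersolution_h_star:
  assumes adm: "adm (h_star d) B g" and mono: "\<And>x y. x \<le> y \<Longrightarrow> g x \<le> g y"
    and eq: "\<And>a. g a = \<kappa> + real d * Q (h_star d) g a" and \<kappa>: "0 < \<kappa>"
  shows False
proof -
  define h where "h = h_star d"
  have adm: "adm h B g" using adm by (simp add: h_def)
  have eq: "g a = \<kappa> + real d * Q h g a" for a using eq by (simp add: h_def)
  have g\<kappa>: "\<kappa> \<le> g a" for a using eq[of a] Q_nonneg[OF adm, of a] by simp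
  define K where "K = g h"
  have K: "K > 0" using g\<kappa>[of h] \<kappa> by (simp add: K_def)
  \<comment> \<open>Lowering the level by \<open>\<epsilon>\<close> costs at most
    \<open>d \<epsilon> K = \<kappa> / 2\<close>, half of the source term; rescaling by
    \<open>2 / \<kappa>\<close> restores a source of size 1.\<close>
  define \<epsilon> where "\<epsilon> = \<kappa> / (2 * real d * K)"
  have \<epsilon>: "\<epsilon> > 0" using \<kappa> K by (simp add: \<epsilon>_def)
  have adm': "adm (h - \<epsilon>) (\<bar>B\<bar> + K) g"
    unfolding adm_def
  proof (intro conjI allI impI)
    fix x assume "h - \<epsilon> \<le> x"
    show "0 \<le> g x" using g\<kappa>[of x] \<kappa> by linarith
    show "g x \<le> (\<bar>B\<bar> + K) * (1 + x\<^sup>2)"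
    proof (cases "h \<le> x")
      case True
      then have "g x \<le> B * (1 + x\<^sup>2)" using adm by (simp add: adm_def)
      also have "\<dots> \<le> (\<bar>B\<bar> + K) * (1 + x\<^sup>2)" using K by (intro mult_right_mono) auto
      finally show ?thesis .
    next
      case False
      then have "g x \<le> K * 1" unfolding K_def using mono by simp
      also have "\<dots> \<le> (\<bar>B\<bar> + K) * (1 + x\<^sup>2)" using K by (intro mult_mono) auto
      finally show ?thesis .
    qed
  qed (use adm in \<open>simp add: adm_def\<close>)
  have lev: "Q (h - \<epsilon>) g x \<le> Q h g x + \<epsilon> * K" for x
    using Q_change_level(2)[OF adm', of h K x] \<epsilon> mono[of _ h] by (simp add: K_def)
  have "surv (h - \<epsilon>) a = 0" for a
  proof (rule surv_eq_0_if_supersolution)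
    show "adm (h - \<epsilon>) (2 / \<kappa> * (\<bar>B\<bar> + K)) (\<lambda>x. 2 / \<kappa> * g x)"
      using adm' \<kappa> unfolding adm_def mult.assoc by (auto intro!: mult_left_mono divide_right_mono)
    fix x
    have "real d * Q (h - \<epsilon>) g x \<le> real d * (Q h g x + \<epsilon> * K)"
      using lev by (intro mult_left_mono) auto
    also have "\<dots> = g x - \<kappa> + \<kappa> / 2"
      using eq[of x] K by (simp add: algebra_simps \<epsilon>_def)
    finally have "2 / \<kappa> * (\<kappa> / 2 + real d * Q (h - \<epsilon>) g x) \<le> 2 / \<kappa> * g x"
      using \<kappa> by (intro mult_left_mono) auto
    then show "1 + real d * Q (h - \<epsilon>) (\<lambda>x. 2 / \<kappa> * g x) x \<le> 2 / \<kappa> * g x"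
      unfolding Q_cmult using \<kappa> by (simp add: algebra_simps)
  qed
  then have "h - \<epsilon> \<in> subcrit" by (simp add: subcrit_def)
  then have "h \<le> h - \<epsilon>" unfolding h_def h_star_eq by (rule cInf_lower[OF _ subcrit_bdd_below])
  then show False using \<epsilon> by simp
qed

end

section \<open>The principal eigenfunction\<close>

context tree_degree
begin

text \<open>Integral of \<open>H\<close> over two adjacent values of the stationary field, a
  symmetric law by detailed balance; extended values spare integrability questions.\<close>

definition dbl :: "(real \<Rightarrow> real \<Rightarrow> real) \<Rightarrow> ennreal" where
  "dbl H = (\<integral>\<^sup>+a. (\<integral>\<^sup>+x. ennreal (H a x * rho_Y d (x - a / real d)) \<partial>lborel) \<partial>nu d)"

lemma dbl_product:
  assumes "\<And>x. 0 \<le> f x" and [measurable]: "g \<in> borel_measurable borel"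
  shows "dbl (\<lambda>a x. f a * g x) = (\<integral>\<^sup>+a. ennreal (f a) * (\<integral>\<^sup>+x. ennreal (g x * rho_Y d (x - a / real d)) \<partial>lborel) \<partial>nu d)"
  unfolding dbl_def using assms(1)
  by (intro nn_integral_cong, subst nn_integral_cmult[symmetric]) (simp_all add: ennreal_mult' mult.assoc)

lemma dbl_swap:
  assumes "f \<in> borel_measurable borel" "g \<in> borel_measurable borel" "\<And>x. 0 \<le> f x" "\<And>x. 0 \<le> g x"
  shows "dbl (\<lambda>a x. f a * g x) = dbl (\<lambda>a x. g a * f x)"
  using kernel_swap[OF assms] assms by (simp add: dbl_product)

lemma dbl_add:
  assumes [measurable]: "case_prod H \<in> borel_measurable (borel \<Otimes>\<^sub>M borel)" "case_prod H' \<in> borel_measurable (borel \<Otimes>\<^sub>M borel)"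
    and nn: "\<And>a x. 0 \<le> H a x" "\<And>a x. 0 \<le> H' a x"
  shows "dbl (\<lambda>a x. H a x + H' a x) = dbl H + dbl H'"
proof -
  have "dbl (\<lambda>a x. H a x + H' a x) = (\<integral>\<^sup>+a. (\<integral>\<^sup>+x. ennreal (H a x * rho_Y d (x - a / real d)) \<partial>lborel) + (\<integral>\<^sup>+x. ennreal (H' a x * rho_Y d (x - a / real d)) \<partial>lborel) \<partial>nu d)"
    unfolding dbl_def using nn
    by (intro nn_integral_cong, subst nn_integral_add[symmetric]) (simp_all add: distrib_right)
  also have "\<dots> = dbl H + dbl H'"
    unfolding dbl_def by (rule nn_integral_add) measurable
  finally show ?thesis .
qed

lemma L_op_eq: "L_op d h g a = indicator {h..} a * (real d * Q h g a)"
  by (simp add: L_op_def Q_def)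

lemma norm_nu_scale: "norm_nu d (\<lambda>x. c * g x) = \<bar>c\<bar> * norm_nu d g"
  unfolding norm_nu_def by (simp add: power_mult_distrib real_sqrt_mult)

text \<open>A non-integrable integrand makes the left side 0 by convention, so the bound needs no
  growth condition on \<open>g\<close>.\<close>

lemma Q_le_nn_integral:
  "ennreal \<bar>Q h g a\<bar> \<le> (\<integral>\<^sup>+x. ennreal (indicator {h..} x * \<bar>g x\<bar> * rho_Y d (x - a / real d)) \<partial>lborel)"
proof (cases "integrable lborel (\<lambda>x. indicator {h..} x * g x * rho_Y d (x - a / real d))")
  case True
  from integral_norm_bound_ennreal[OF this] show ?thesis
    by (simp add: Q_eq abs_mult)
qed (simp add: Q_eq not_integrable_integral_eq)

section \<open>Consequences of a positive fixed point: norm one and uniqueness\<close>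

context
  fixes h B :: real and f :: "real \<Rightarrow> real"
  assumes f_adm: "adm h B f" and f_pos: "\<And>x. 0 < f x"
    and f_fix: "\<And>a. f a = real d * Q h f a"
begin

lemma f_meas: "f \<in> borel_measurable borel" by (rule adm_measurable[OF f_adm])

lemma kernel_f:
  "(\<integral>\<^sup>+x. ennreal (indicator {h..} x * f x * rho_Y d (x - a / real d)) \<partial>lborel) = ennreal (f a / real d)"
  using f_fix[of a] nn_integral_Q[OF f_adm, of a] by simp

lemma dbl_f:
  assumes [measurable]: "g \<in> borel_measurable borel"
  shows "dbl (\<lambda>a x. (indicator {h..} a * (g a)\<^sup>2 / f a) * (indicator {h..} x * f x))
     = ennreal (1 / real d) * (\<integral>\<^sup>+a. ennreal (indicator {h..} a * (g a)\<^sup>2) \<partial>nu d)"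
proof -
  note [measurable] = f_meas
  have f0: "0 \<le> f x" for x using f_pos[of x] by simp
  have "dbl (\<lambda>a x. (indicator {h..} a * (g a)\<^sup>2 / f a) * (indicator {h..} x * f x))
      = (\<integral>\<^sup>+a. ennreal (indicator {h..} a * (g a)\<^sup>2 / f a) * ennreal (f a / real d) \<partial>nu d)"
    by (subst dbl_product) (simp_all add: f0 kernel_f)
  also have "\<dots> = (\<integral>\<^sup>+a. ennreal (1 / real d) * ennreal (indicator {h..} a * (g a)\<^sup>2) \<partial>nu d)"
  proof (rule nn_integral_cong)
    fix a
    show "ennreal (indicator {h..} a * (g a)\<^sup>2 / f a) * ennreal (f a / real d) = ennreal (1 / real d) * ennreal (indicator {h..} a * (g a)\<^sup>2)"
      using f_pos[of a] by (simp add: ennreal_mult'[symmetric] f0 ennreal_mult''[symmetric])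
  qed
  also have "\<dots> = ennreal (1 / real d) * (\<integral>\<^sup>+a. ennreal (indicator {h..} a * (g a)\<^sup>2) \<partial>nu d)"
    by (rule nn_integral_cmult) measurable
  finally show ?thesis .
qed

text \<open>Schur test with the positive fixed point as test function.\<close>
lemma L_op_contraction:
  assumes [measurable]: "g \<in> borel_measurable borel"
  shows "(\<integral>\<^sup>+a. ennreal ((L_op d h g a)\<^sup>2) \<partial>nu d) \<le> (\<integral>\<^sup>+a. ennreal ((g a)\<^sup>2) \<partial>nu d)"
proof -
  note [measurable] = f_meas
  have f0: "0 \<le> f x" for x using f_pos[of x] by simp
  let ?r = "\<lambda>x. indicator {h..} x * (g x)\<^sup>2 / f x"
  let ?F = "\<lambda>x. indicator {h..} x * f x"
  have pt: "ennreal ((L_op d h g a)\<^sup>2) \<le> ennreal (real d) * (ennreal (?F a) * (\<integral>\<^sup>+x. ennreal (?r x * rho_Y d (x - a / real d)) \<partial>lborel))" for a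
  proof (cases "h \<le> a")
    case True
    \<comment> \<open>Cauchy-Schwarz for the product of \<open>sqrt (f rho)\<close> and
      \<open>sqrt (g^2 rho / f)\<close>: the square of the first factor integrates to
      \<open>f a / d\<close> by the fixed-point equation.\<close>
    let ?s = "\<lambda>x. ennreal (sqrt (?F x * rho_Y d (x - a / real d)))"
    let ?t = "\<lambda>x. ennreal (sqrt (?r x * rho_Y d (x - a / real d)))"
    have st: "ennreal (indicator {h..} x * \<bar>g x\<bar> * rho_Y d (x - a / real d)) = ?s x * ?t x" for x
    proof -
      let ?v = "indicator {h..} x * \<bar>g x\<bar> * rho_Y d (x - a / real d)"
      have "?F x * rho_Y d (x - a / real d) * (?r x * rho_Y d (x - a / real d)) = ?v\<^sup>2"
        using f_pos[of x] by (simp add: indicator_def power2_eq_square)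
      then have "sqrt (?F x * rho_Y d (x - a / real d)) * sqrt (?r x * rho_Y d (x - a / real d)) = \<bar>?v\<bar>"
        by (simp only: real_sqrt_mult[symmetric] real_sqrt_abs)
      also have "\<bar>?v\<bar> = ?v" by simp
      finally show ?thesis by (subst ennreal_mult'[symmetric]) (simp_all add: f0)
    qed
    have s2: "?s x ^ 2 = ennreal (?F x * rho_Y d (x - a / real d))" for x
      by (simp add: ennreal_power f0)
    have t2: "?t x ^ 2 = ennreal (?r x * rho_Y d (x - a / real d))" for x
      by (simp add: ennreal_power f0)
    have "ennreal ((Q h g a)\<^sup>2) = (ennreal \<bar>Q h g a\<bar>)\<^sup>2" by (simp add: ennreal_power)
    also have "\<dots> \<le> (\<integral>\<^sup>+x. ?s x * ?t x \<partial>lborel)\<^sup>2"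
      using Q_le_nn_integral[of h g a] unfolding st by (rule power_mono) simp
    also have "\<dots> \<le> (\<integral>\<^sup>+x. ?s x ^ 2 \<partial>lborel) * (\<integral>\<^sup>+x. ?t x ^ 2 \<partial>lborel)"
      by (rule Cauchy_Schwarz_nn_integral) measurable
    also have "\<dots> = ennreal (f a / real d) * (\<integral>\<^sup>+x. ennreal (?r x * rho_Y d (x - a / real d)) \<partial>lborel)"
      unfolding s2 t2 kernel_f ..
    finally have "ennreal ((real d)\<^sup>2) * ennreal ((Q h g a)\<^sup>2) \<le> ennreal ((real d)\<^sup>2) * (ennreal (f a / real d) * (\<integral>\<^sup>+x. ennreal (?r x * rho_Y d (x - a / real d)) \<partial>lborel))"
      by (rule mult_left_mono) simp
    also have "\<dots> = ennreal (real d) * (ennreal (f a) * (\<integral>\<^sup>+x. ennreal (?r x * rho_Y d (x - a / real d)) \<partial>lborel))"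
    proof -
      have "ennreal ((real d)\<^sup>2) * ennreal (f a / real d) = ennreal (real d) * ennreal (f a)"
        using f0[of a] by (simp add: ennreal_mult'[symmetric] power2_eq_square)
      then show ?thesis by (simp only: mult.assoc[symmetric])
    qed
    finally show ?thesis using True
      by (simp add: L_op_eq power_mult_distrib ennreal_mult')
  qed (simp add: L_op_eq)
  have "(\<integral>\<^sup>+a. ennreal ((L_op d h g a)\<^sup>2) \<partial>nu d)
     \<le> (\<integral>\<^sup>+a. ennreal (real d) * (ennreal (?F a) * (\<integral>\<^sup>+x. ennreal (?r x * rho_Y d (x - a / real d)) \<partial>lborel)) \<partial>nu d)"
    by (rule nn_integral_mono) (rule pt)
  also have "\<dots> = ennreal (real d) * dbl (\<lambda>a x. ?F a * ?r x)"
    by (subst nn_integral_cmult, measurable) (subst dbl_product, simp_all add: f0)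
  also have "dbl (\<lambda>a x. ?F a * ?r x) = dbl (\<lambda>a x. ?r a * ?F x)"
    by (rule dbl_swap) (simp_all add: f0)
  also have "ennreal (real d) * \<dots> = (\<integral>\<^sup>+a. ennreal (indicator {h..} a * (g a)\<^sup>2) \<partial>nu d)"
    unfolding dbl_f[OF assms] by (simp add: mult.assoc[symmetric] ennreal_mult'[symmetric])
  also have "\<dots> \<le> (\<integral>\<^sup>+a. ennreal ((g a)\<^sup>2) \<partial>nu d)"
    by (intro nn_integral_mono ennreal_leI) (auto simp: indicator_def)
  finally show ?thesis .
qed

abbreviation (input) "restr \<equiv> \<lambda>x. indicator {h..} x * f x"

lemma restr_L2: "integrable (nu d) (\<lambda>x. (restr x)\<^sup>2)"
proof (rule Bochner_Integration.integrable_bound)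
  note [measurable] = f_meas
  show "integrable (nu d) (\<lambda>x. B\<^sup>2 * (1 + x\<^sup>2) ^ 2)" using integrable_nu_weight by simp
  show "AE x in nu d. norm ((restr x)\<^sup>2) \<le> norm (B\<^sup>2 * (1 + x\<^sup>2) ^ 2)"
  proof (intro AE_I2)
    fix x
    have "(f x)\<^sup>2 \<le> (B * (1 + x\<^sup>2))\<^sup>2" if "h \<le> x"
      using f_adm that f_pos[of x] by (intro power_mono) (auto simp: adm_def)
    then show "norm ((restr x)\<^sup>2) \<le> norm (B\<^sup>2 * (1 + x\<^sup>2) ^ 2)"
      by (auto simp: indicator_def power_mult_distrib)
  qed
qed (use f_meas in simp)

lemma norm_restr_pos: "norm_nu d restr > 0"
proof -
  note [measurable] = f_meas
  have "(\<integral>x. (restr x)\<^sup>2 \<partial>nu d) \<noteq> 0"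
  proof
    assume "(\<integral>x. (restr x)\<^sup>2 \<partial>nu d) = 0"
    then have "AE x in nu d. (restr x)\<^sup>2 = 0"
      using integral_nonneg_eq_0_iff_AE[OF restr_L2] by simp
    then have "AE x in lborel. (restr x)\<^sup>2 = 0" by (simp only: nu_AE_iff)
    then have "AE x in lborel. x \<notin> {h..h + 1}"
      by (rule eventually_mono) (use f_pos in \<open>auto simp: indicator_def less_le split: if_splits\<close>)
    then have "emeasure lborel {h..h + 1} = 0"
      by (subst (asm) AE_iff_measurable[of "{h..h + 1}"]) auto
    then show False by simp
  qed
  moreover have "(\<integral>x. (restr x)\<^sup>2 \<partial>nu d) \<ge> 0" by (rule integral_nonneg_AE) simp
  ultimately have "(\<integral>x. (restr x)\<^sup>2 \<partial>nu d) > 0" by linarith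
  then show ?thesis unfolding norm_nu_def by simp
qed

lemma L_op_restr: "L_op d h (\<lambda>x. c * restr x) a = c * restr a"
proof -
  have "Q h (\<lambda>x. c * restr x) a = c * Q h f a"
    unfolding Q_cmult by (rule arg_cong[where f="\<lambda>x. c * x"]) (rule Q_cong, simp)
  then have "L_op d h (\<lambda>x. c * restr x) a = indicator {h..} a * (c * (real d * Q h f a))"
    unfolding L_op_eq by simp
  then show ?thesis unfolding f_fix[of a, symmetric] by simp
qed

text \<open>The contraction bounds the supremum by 1, and the normalised restriction of
  \<open>f\<close> attains it.\<close>

lemma lambda_h_eq_1: "lambda_h d h = 1"
  unfolding lambda_h_def
proof (rule cSup_eq_maximum)
  note [measurable] = f_meas
  let ?c = "1 / norm_nu d restr"
  have n1: "norm_nu d (\<lambda>x. ?c * restr x) = 1"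
    unfolding norm_nu_scale using norm_restr_pos by simp
  have "L2nu d (\<lambda>x. ?c * restr x)"
    using restr_L2 by (simp add: L2nu_def power_mult_distrib power_divide)
  moreover have "norm_nu d (L_op d h (\<lambda>x. ?c * restr x)) = 1"
    using n1 L_op_restr[of ?c] by presburger
  ultimately show "1 \<in> {norm_nu d (L_op d h g) |g. L2nu d g \<and> norm_nu d g = 1}"
    using n1 by (intro CollectI exI[of _ "\<lambda>x. ?c * restr x"]) presburger
  fix y assume "y \<in> {norm_nu d (L_op d h g) |g. L2nu d g \<and> norm_nu d g = 1}"
  then obtain g where g: "y = norm_nu d (L_op d h g)" "L2nu d g" "norm_nu d g = 1" by blast
  have [measurable]: "g \<in> borel_measurable borel" using g(2) by (simp add: L2nu_def)
  have Lm[measurable]: "L_op d h g \<in> borel_measurable borel"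
    unfolding L_op_eq[abs_def] by measurable
  have int: "integrable (nu d) (\<lambda>x. (g x)\<^sup>2)" using g(2) by (simp add: L2nu_def)
  have "(\<integral>x. (L_op d h g x)\<^sup>2 \<partial>nu d) = enn2real (\<integral>\<^sup>+x. ennreal ((L_op d h g x)\<^sup>2) \<partial>nu d)"
    by (rule integral_eq_nn_integral) auto
  also have "\<dots> \<le> enn2real (\<integral>\<^sup>+x. ennreal ((g x)\<^sup>2) \<partial>nu d)"
    using L_op_contraction[of g] int by (intro enn2real_mono) (auto simp: nn_integral_eq_integral)
  also have "\<dots> = (\<integral>x. (g x)\<^sup>2 \<partial>nu d)"
    by (rule integral_eq_nn_integral[symmetric]) auto
  finally show "y \<le> 1" using g(3) unfolding g(1) norm_nu_def by simp
qed

text \<open>Equality case of the Schur test. The two mixed integrals of \<open>f\<close> and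
  \<open>g^2 / f\<close> together exceed twice the integral of \<open>g a * g x\<close> by that of
  the complete square \<open>?D\<close>. Each mixed integral equals \<open>m / d\<close>, and that
  of \<open>g a * g x\<close> is at least \<open>m / d\<close>, so the square vanishes.\<close>

lemma eigenfunction_unique:
  assumes g: "L2nu d g" "\<And>a. 0 \<le> g a" "\<And>a. L_op d h g a = g a"
  shows "\<exists>c\<ge>0. \<forall>a. g a = c * restr a"
proof -
  note [measurable] = f_meas
  have [measurable]: "g \<in> borel_measurable borel" using g(1) by (simp add: L2nu_def)
  have f0: "0 \<le> f x" for x using f_pos[of x] by simp
  let ?r = "\<lambda>x. indicator {h..} x * (g x)\<^sup>2 / f x"
  let ?D = "\<lambda>a x. indicator {h..} a * indicator {h..} x * ((f a * g x - g a * f x)\<^sup>2 / (f a * f x)) :: real"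
  have gQ: "g a = indicator {h..} a * real d * Q h g a" for a
    using g(3)[of a] by (simp add: L_op_eq)
  have g_off: "indicator {h..} a * g a = g a" for a
    using gQ[of a] by (auto simp: indicator_def)
  have int: "integrable (nu d) (\<lambda>x. (g x)\<^sup>2)" using g(1) by (simp add: L2nu_def)
  define m where "m = (\<integral>x. (g x)\<^sup>2 \<partial>nu d)"
  have m0: "0 \<le> m" unfolding m_def by (rule integral_nonneg_AE) simp
  have nn_m: "(\<integral>\<^sup>+a. ennreal ((g a)\<^sup>2) \<partial>nu d) = ennreal m"
    unfolding m_def by (rule nn_integral_eq_integral[OF int]) simp
  have ind_sq: "indicator {h..} a * (g a)\<^sup>2 = (g a)\<^sup>2" for a
    using g_off[of a] by (auto simp: indicator_def split: if_splits)
  have A: "dbl (\<lambda>a x. ?r a * restr x) = ennreal (m / real d)"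
  proof -
    have "dbl (\<lambda>a x. ?r a * restr x) = ennreal (1 / real d) * (\<integral>\<^sup>+a. ennreal (indicator {h..} a * (g a)\<^sup>2) \<partial>nu d)"
      by (rule dbl_f) simp
    also have "\<dots> = ennreal (m / real d)"
      unfolding ind_sq nn_m using m0 by (simp add: ennreal_mult'[symmetric])
    finally show ?thesis .
  qed
  have A': "dbl (\<lambda>a x. restr a * ?r x) = ennreal (m / real d)"
    unfolding A[symmetric] by (rule dbl_swap) (simp_all add: f0)
  have C: "ennreal (m / real d) \<le> dbl (\<lambda>a x. g a * g x)"
  proof -
    have "ennreal (m / real d) = ennreal (1 / real d) * (\<integral>\<^sup>+a. ennreal ((g a)\<^sup>2) \<partial>nu d)"
      unfolding nn_m using m0 by (simp add: ennreal_mult'[symmetric])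
    also have "\<dots> = (\<integral>\<^sup>+a. ennreal (1 / real d) * ennreal ((g a)\<^sup>2) \<partial>nu d)"
      by (rule nn_integral_cmult[symmetric]) measurable
    also have "\<dots> \<le> (\<integral>\<^sup>+a. ennreal (g a) * (\<integral>\<^sup>+x. ennreal (g x * rho_Y d (x - a / real d)) \<partial>lborel) \<partial>nu d)"
    proof (rule nn_integral_mono)
      fix a
      have "ennreal (1 / real d) * ennreal ((g a)\<^sup>2) = ennreal (g a) * ennreal (g a / real d)"
        using g(2)[of a] by (simp add: ennreal_mult'[symmetric] power2_eq_square)
      also have "\<dots> \<le> ennreal (g a) * (\<integral>\<^sup>+x. ennreal (g x * rho_Y d (x - a / real d)) \<partial>lborel)"
      proof (rule mult_left_mono)
        have "g a / real d \<le> \<bar>Q h g a\<bar>" using gQ[of a] by (auto simp: indicator_def)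
        then have "ennreal (g a / real d) \<le> ennreal \<bar>Q h g a\<bar>" by (rule ennreal_leI)
        also have "\<dots> \<le> (\<integral>\<^sup>+x. ennreal (indicator {h..} x * \<bar>g x\<bar> * rho_Y d (x - a / real d)) \<partial>lborel)"
          by (rule Q_le_nn_integral)
        finally show "ennreal (g a / real d) \<le> (\<integral>\<^sup>+x. ennreal (g x * rho_Y d (x - a / real d)) \<partial>lborel)"
          using g(2) g_off by simp
      qed simp
      finally show "ennreal (1 / real d) * ennreal ((g a)\<^sup>2) \<le> ennreal (g a) * (\<integral>\<^sup>+x. ennreal (g x * rho_Y d (x - a / real d)) \<partial>lborel)" .
    qed
    also have "\<dots> = dbl (\<lambda>a x. g a * g x)" using g(2) by (subst dbl_product) auto
    finally show ?thesis .
  qed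
  have pt: "restr a * ?r x + ?r a * restr x = (g a * g x + g a * g x) + ?D a x" for a x
  proof (cases "h \<le> a \<and> h \<le> x")
    case True
    have "f a * ((g x)\<^sup>2 / f x) + (g a)\<^sup>2 / f a * f x = g a * g x + g a * g x + (f a * g x - g a * f x)\<^sup>2 / (f a * f x)"
      using f_pos[of a] f_pos[of x] by (simp add: field_simps power2_eq_square)
    then show ?thesis using True by simp
  next
    case False
    then have "g a * g x = 0" using g_off[of a] g_off[of x] by (auto simp: indicator_def)
    then show ?thesis using False by (auto simp: indicator_def)
  qed
  have "ennreal (m / real d) + ennreal (m / real d) = dbl (\<lambda>a x. restr a * ?r x + ?r a * restr x)"
  proof -
    have "dbl (\<lambda>a x. restr a * ?r x + ?r a * restr x) = dbl (\<lambda>a x. restr a * ?r x) + dbl (\<lambda>a x. ?r a * restr x)"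
      by (rule dbl_add) (measurable, simp_all add: f0)
    then show ?thesis by (simp only: A A')
  qed
  also have "\<dots> = dbl (\<lambda>a x. (g a * g x + g a * g x) + ?D a x)" unfolding pt ..
  also have "\<dots> = dbl (\<lambda>a x. g a * g x) + dbl (\<lambda>a x. g a * g x) + dbl ?D"
  proof -
    have "dbl (\<lambda>a x. g a * g x + g a * g x) = dbl (\<lambda>a x. g a * g x) + dbl (\<lambda>a x. g a * g x)"
      by (rule dbl_add) (use g(2) in auto)
    moreover have "dbl (\<lambda>a x. (g a * g x + g a * g x) + ?D a x) = dbl (\<lambda>a x. g a * g x + g a * g x) + dbl ?D"
    proof (rule dbl_add)
      show "0 \<le> ?D a x" for a x by (simp add: f0)
      show "0 \<le> g a * g x + g a * g x" for a x by (simp add: g(2))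
    qed measurable
    ultimately show ?thesis by (simp only:)
  qed
  also have "\<dots> \<ge> ennreal (m / real d) + ennreal (m / real d) + dbl ?D"
    by (intro add_mono C order_refl)
  finally have "ennreal (m / real d) + ennreal (m / real d) + dbl ?D \<le> ennreal (m / real d) + ennreal (m / real d) + 0"
    by simp
  \<comment> \<open>Cancellation is legitimate because \<open>m\<close> is finite, \<open>g\<close>
    being square integrable.\<close>
  then have "dbl ?D \<le> 0"
    by (subst (asm) ennreal_add_left_cancel_le) (simp add: ennreal_add_eq_top)
  then have "dbl ?D = 0" by simp
  then have "AE a in nu d. (\<integral>\<^sup>+x. ennreal (?D a x * rho_Y d (x - a / real d)) \<partial>lborel) = 0"
    unfolding dbl_def by (subst (asm) nn_integral_0_iff_AE) measurable
  then have AE1: "AE a in lborel. (\<integral>\<^sup>+x. ennreal (?D a x * rho_Y d (x - a / real d)) \<partial>lborel) = 0"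
    by (simp only: nu_AE_iff)
  \<comment> \<open>One such \<open>a\<close> is enough: the kernel is positive, so \<open>g\<close>
    and \<open>f\<close> are proportional almost everywhere in \<open>x\<close>.\<close>
  have "\<exists>a\<ge>h. (\<integral>\<^sup>+x. ennreal (?D a x * rho_Y d (x - a / real d)) \<partial>lborel) = 0"
  proof (rule ccontr)
    assume "\<not> ?thesis"
    then have "AE x in lborel. x \<notin> {h..h + 1}"
      by (intro eventually_mono[OF AE1]) auto
    then have "emeasure lborel {h..h + 1} = 0"
      by (subst (asm) AE_iff_measurable[of "{h..h + 1}"]) auto
    then show False by simp
  qed
  then obtain a where a: "h \<le> a" "(\<integral>\<^sup>+x. ennreal (?D a x * rho_Y d (x - a / real d)) \<partial>lborel) = 0" by blast
  then have "AE x in lborel. ennreal (?D a x * rho_Y d (x - a / real d)) = 0"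
    by (subst (asm) nn_integral_0_iff_AE) measurable
  then have ae: "AE x in lborel. h \<le> x \<longrightarrow> g x = g a / f a * f x"
  proof (rule eventually_mono, intro impI)
    fix x assume x: "ennreal (?D a x * rho_Y d (x - a / real d)) = 0" "h \<le> x"
    have "0 \<le> ?D a x * rho_Y d (x - a / real d)" by (simp add: f0)
    then have "?D a x * rho_Y d (x - a / real d) = 0" using x(1) by (simp add: ennreal_eq_0_iff)
    then have "(f a * g x - g a * f x)\<^sup>2 / (f a * f x) = 0"
      using a(1) x(2) rho_pos[of "x - a / real d"] by simp
    then have "(f a * g x - g a * f x)\<^sup>2 = 0" using f_pos[of a] f_pos[of x] by auto
    then have "f a * g x = g a * f x" by simp
    then show "g x = g a / f a * f x" using f_pos[of a] by (simp add: field_simps)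
  qed
  \<comment> \<open>The eigenvalue equation carries proportionality from almost every point to every
    point and produces the cutoff below \<open>h\<close>.\<close>
  have gb: "g b = g a / f a * restr b" for b
  proof -
    have "Q h g b = Q h (\<lambda>x. g a / f a * f x) b"
      by (rule Q_cong_AE) (use ae in auto)
    then have "Q h g b = g a / f a * Q h f b" by (simp only: Q_cmult)
    then have "g b = indicator {h..} b * (g a / f a * (real d * Q h f b))" unfolding gQ[of b] by simp
    then show ?thesis unfolding f_fix[of b, symmetric] by simp
  qed
  have "0 \<le> g a / f a" using g(2)[of a] f0[of a] by simp
  with gb show ?thesis by blast
qed

text \<open>Resolves the definite description: existence from the normalised fixed point, uniqueness
  from proportionality and the unit norm.\<close>

lemma chi_h_eq: "chi_h d h = (\<lambda>a. restr a / norm_nu d restr)"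
  unfolding chi_h_def lambda_h_eq_1 mult_1_left
proof (rule the_equality)
  note [measurable] = f_meas
  let ?c = "1 / norm_nu d restr"
  have 1: "(\<lambda>a. restr a / norm_nu d restr) = (\<lambda>a. ?c * restr a)" by simp
  have "L2nu d (\<lambda>x. ?c * restr x)"
    using restr_L2 by (simp add: L2nu_def power_mult_distrib power_divide)
  moreover have "norm_nu d (\<lambda>x. ?c * restr x) = 1"
    unfolding norm_nu_scale using norm_restr_pos by simp
  moreover have "0 \<le> ?c * restr a" for a
    using f_pos[of a] norm_restr_pos by simp
  ultimately show "L2nu d (\<lambda>a. restr a / norm_nu d restr) \<and> (\<forall>a. 0 \<le> restr a / norm_nu d restr) \<and>
      norm_nu d (\<lambda>a. restr a / norm_nu d restr) = 1 \<and>
      (\<forall>a. L_op d h (\<lambda>a. restr a / norm_nu d restr) a = restr a / norm_nu d restr)"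
    unfolding 1 using L_op_restr[of ?c] by simp
next
  fix g assume g: "L2nu d g \<and> (\<forall>a. 0 \<le> g a) \<and> norm_nu d g = 1 \<and> (\<forall>a. L_op d h g a = g a)"
  then obtain c where c: "c \<ge> 0" "\<And>a. g a = c * restr a"
    using eigenfunction_unique[of g] by blast
  have gc: "g = (\<lambda>a. c * restr a)" using c by blast
  have "c * norm_nu d restr = 1"
    using g c(1) unfolding gc norm_nu_scale by simp
  then show "g = (\<lambda>a. restr a / norm_nu d restr)"
    unfolding gc using norm_restr_pos by (auto simp: field_simps)
qed

end

end

section \<open>Compactness of the normalised Laplace transforms\<close>

text \<open>An exact remainder instead of an estimate. As \<open>q\<close> tends to 0 the double sum
  counts the pairs \<open>j < i < n\<close>, hence tends to \<open>n (n - 1) / 2\<close>.\<close>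

lemma power_second_order:
  fixes q :: real
  shows "real n * q - (1 - (1 - q) ^ n) = q\<^sup>2 * (\<Sum>i<n. \<Sum>j<i. (1 - q) ^ j)"
proof -
  have *: "1 - (1 - q) ^ i = q * (\<Sum>j<i. (1 - q) ^ j)" for i
    using one_diff_power_eq[of "1 - q" i] by simp
  have "real n * q - (1 - (1 - q) ^ n) = q * (\<Sum>i<n. 1 - (1 - q) ^ i)"
    unfolding *[of n] by (simp add: sum_subtractf algebra_simps)
  also have "\<dots> = q\<^sup>2 * (\<Sum>i<n. \<Sum>j<i. (1 - q) ^ j)"
    unfolding * by (simp add: sum_distrib_left[symmetric] power2_eq_square)
  finally show ?thesis .
qed

text \<open>Separates the killing \<open>1 - z\<close> from a term with factor \<open>q\<close>, so
  that the equation can be divided by a normalisation and passed to the limit term by term.\<close>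

lemma one_minus_scaled_power:
  fixes q z :: real
  shows "1 - z * (1 - q) ^ n = (1 - z) * (1 - q) ^ n + q * (\<Sum>j<n. (1 - q) ^ j)"
  using one_diff_power_eq[of "1 - q" n] by (simp add: algebra_simps)

lemma frac_mono: "(0::real) \<le> x \<Longrightarrow> x \<le> y \<Longrightarrow> x / (1 + x) \<le> y / (1 + y)"
  by (simp add: field_simps)

context tree_degree
begin

section \<open>The Laplace functional as \<open>s\<close> tends to 0\<close>

abbreviation (input) "hc \<equiv> h_star d"

lemma exp_neg_unit: "0 < s \<Longrightarrow> 0 \<le> exp (- s)" "0 < s \<Longrightarrow> exp (- s) \<le> (1::real)"
  by auto

lemma lap_props:
  assumes s: "0 < s"
  shows lap_fixed: "lap s h a = 1 - exp (- s) * (1 - Q h (lap s h) a) ^ d"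
    and adm_lap: "adm h 1 (lap s h)"
    and lap_mono: "a \<le> b \<Longrightarrow> lap s h a \<le> lap s h b"
    and lap_le_1: "lap s h a \<le> 1"
    and lap_ge: "1 - exp (- s) \<le> lap s h a"
    and lap_pos: "0 < lap s h a"
    and Q_lap: "0 \<le> Q h (lap s h) a" "Q h (lap s h) a \<le> 1"
    and lap_isCont: "isCont (lap s h) a"
    and lap_le_linear: "lap s h a \<le> (1 - exp (- s)) + real d * Q h (lap s h) a"
proof -
  note z = exp_neg_unit[OF s]
  show fx: "lap s h a = 1 - exp (- s) * (1 - Q h (lap s h) a) ^ d" for a
    by (rule Ulim_fixed) (use z in auto)
  show adm: "adm h 1 (lap s h)" by (rule adm_Ulim) (use z in auto)
  show mono: "a \<le> b \<Longrightarrow> lap s h a \<le> lap s h b" for a b by (rule Ulim_mono) (use z in auto)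
  show le1: "lap s h a \<le> 1" for a by (rule Ulim_bounds) (use z in auto)
  show q: "0 \<le> Q h (lap s h) a" "Q h (lap s h) a \<le> 1" for a by (rule Q_Ulim_bounds; use z in auto)+
  have "exp (- s) * (1 - Q h (lap s h) a) ^ d \<le> exp (- s) * 1"
    using q[of a] by (intro mult_left_mono power_le_one) auto
  then show ge: "1 - exp (- s) \<le> lap s h a" using fx[of a] by simp
  show "0 < lap s h a" using ge s by (smt (verit) exp_less_one_iff)
  have "isCont (Q h (lap s h)) a"
    by (rule Q_isCont) (use adm_measurable[OF adm] le1 mono adm in \<open>auto simp: adm_def\<close>)
  then have "isCont (\<lambda>a. 1 - exp (- s) * (1 - Q h (lap s h) a) ^ d) a" by (intro continuous_intros)
  then show "isCont (lap s h) a" unfolding fx[symmetric] by simp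
  have "lap s h a = (1 - exp (- s)) + exp (- s) * (1 - (1 - Q h (lap s h) a) ^ d)"
    using fx[of a] by (simp add: algebra_simps)
  moreover have "exp (- s) * (1 - (1 - Q h (lap s h) a) ^ d) \<le> 1 * (real d * Q h (lap s h) a)"
    using Bernoulli_inequality[of "- Q h (lap s h) a" d] q[of a] z
    by (intro mult_mono) (auto intro: power_le_one)
  ultimately show "lap s h a \<le> (1 - exp (- s)) + real d * Q h (lap s h) a" by simp
qed

lemma lap_mono_s:
  assumes "0 < s" "s \<le> t" shows "lap s h a \<le> lap t h a"
proof -
  have "0 < t" using assms by simp
  note zs = exp_neg_unit[OF assms(1)] and zt = exp_neg_unit[OF \<open>0 < t\<close>]
  have "U (exp (- s)) 1 h n a \<le> U (exp (- t)) 1 h n a" for n a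
  proof (induction n arbitrary: a)
    case (Suc n)
    have as: "adm h 1 (U (exp (- s)) 1 h n)" and at: "adm h 1 (U (exp (- t)) 1 h n)"
      by (rule adm_U; use zs zt in auto)+
    have "Q h (U (exp (- s)) 1 h n) a \<le> Q h (U (exp (- t)) 1 h n) a"
      by (rule Q_mono[OF as at]) (rule Suc.IH)
    moreover have "Q h (U (exp (- t)) 1 h n) a \<le> 1"
      by (rule Q_le_const[OF at]) (use U_props[of "exp (- t)" 1 h n] zt in auto)
    ultimately have "exp (- t) * (1 - Q h (U (exp (- t)) 1 h n) a) ^ d \<le> exp (- s) * (1 - Q h (U (exp (- s)) 1 h n) a) ^ d"
      using assms by (intro mult_mono power_mono) auto
    then show ?case by simp
  qed simp
  then show ?thesis
    by (intro LIMSEQ_le[OF U_tendsto U_tendsto]) (use zs zt in auto)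
qed

text \<open>The decreasing limit along \<open>1 / (n + 1)\<close> solves the survival equation,
  hence lies below \<open>surv\<close>, which vanishes at the critical level. Points below that
  level follow by monotonicity in \<open>a\<close>.\<close>

lemma lap_tendsto_0: "((\<lambda>s. lap s hc a) \<longlongrightarrow> 0) (at_right 0)"
proof -
  define t where "t n = 1 / real (Suc n)" for n
  have t: "0 < t n" "t (Suc n) \<le> t n" for n by (auto simp: t_def field_simps)
  define v where "v a = lim (\<lambda>n. lap (t n) hc a)" for a
  have lim: "(\<lambda>n. lap (t n) hc a) \<longlonglongrightarrow> v a" for a
  proof -
    have "monoseq (\<lambda>n. lap (t n) hc a)"
      unfolding monoseq_Suc using lap_mono_s[OF t(1) t(2)] by blast
    moreover have "Bseq (\<lambda>n. lap (t n) hc a)"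
      using lap_pos[OF t(1)] lap_le_1[OF t(1)] by (intro BseqI'[of _ 1]) (auto simp: abs_of_pos)
    ultimately show ?thesis
      unfolding v_def by (metis Bseq_monoseq_convergent convergent_LIMSEQ_iff)
  qed
  have vm: "v \<in> borel_measurable borel"
    by (rule borel_measurable_LIMSEQ_real[OF lim]) (use adm_measurable[OF adm_lap[OF t(1)]] in auto)
  have v01: "0 \<le> v a" "v a \<le> 1" for a
    using less_imp_le[OF lap_pos[OF t(1), of _ hc a]] lap_le_1[OF t(1), of _ hc a]
    by (auto intro!: LIMSEQ_le_const[OF lim] LIMSEQ_le_const2[OF lim])
  have Qlim: "(\<lambda>n. Q hc (lap (t n) hc) a) \<longlonglongrightarrow> Q hc v a" for a
    by (rule Q_tendsto[OF adm_lap[OF t(1)] vm]) (simp add: lim)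
  have t0: "t \<longlonglongrightarrow> 0" unfolding t_def using LIMSEQ_inverse_real_of_nat by (simp add: inverse_eq_divide)
  have vfix: "v a = 1 - (1 - Q hc v a) ^ d" for a
  proof (rule LIMSEQ_unique[OF lim])
    have "(\<lambda>n. 1 - exp (- t n) * (1 - Q hc (lap (t n) hc) a) ^ d) \<longlonglongrightarrow> 1 - exp (- 0) * (1 - Q hc v a) ^ d"
      by (intro tendsto_intros Qlim t0)
    then show "(\<lambda>n. lap (t n) hc a) \<longlonglongrightarrow> 1 - (1 - Q hc v a) ^ d"
      unfolding lap_fixed[OF t(1), symmetric] by simp
  qed
  have vs: "v x \<le> surv hc x" if "hc \<le> x" for x
    by (rule subsolution_le_surv[OF vm _ _ that]) (use v01 vfix in \<open>auto intro: eq_refl\<close>)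
  have v0: "v x = 0" if "hc \<le> x" for x
    using vs[OF that] v01(1)[of x] surv_h_star[of x] by simp
  have va: "v a = 0"
  proof -
    have "v a \<le> v (max a hc)"
      by (rule LIMSEQ_le[OF lim lim]) (use lap_mono[OF t(1)] in auto)
    then show ?thesis using v0[of "max a hc"] v01(1)[of a] by simp
  qed
  show ?thesis
  proof (rule order_tendstoI)
    fix c :: real assume "c < 0"
    have "eventually (\<lambda>s::real. 0 < s) (at_right 0)" by (simp add: eventually_at_right_less)
    then show "eventually (\<lambda>s. c < lap s hc a) (at_right 0)"
      by eventually_elim (use lap_pos[of _ hc a] \<open>c < 0\<close> in force)
  next
    fix c :: real assume "0 < c"
    then have "eventually (\<lambda>n. lap (t n) hc a < c) sequentially"
      using order_tendstoD(2)[OF lim[of a]] va by simp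
    then obtain n where n: "lap (t n) hc a < c" by (auto simp: eventually_sequentially)
    have "eventually (\<lambda>s. s \<in> {0<..<t n}) (at_right 0)"
      by (rule eventually_at_right_real) (rule t)
    then show "eventually (\<lambda>s. lap s hc a < c) (at_right 0)"
    proof eventually_elim
      case (elim s)
      then show ?case using lap_mono_s[of s "t n" hc a] n by simp
    qed
  qed
qed

text \<open>A Harnack-type bound: the quadratic weight is contracted by the operator far from the origin.\<close>
lemma lap_harnack:
  obtains A where "h \<le> A" "\<And>s x. 0 < s \<Longrightarrow> h \<le> x \<Longrightarrow> lap s h x \<le> 4 * lap s h A * (1 + x\<^sup>2)"
proof
  \<comment> \<open>For \<open>x > A\<close> one has \<open>2 d + 1 \<le> x^2 / 4\<close> and
    \<open>x^2 / d \<le> x^2 / 2\<close>, which gives the contraction factor 3/4; on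
    \<open>[h, A]\<close> monotonicity bounds the function by its value at \<open>A\<close>.\<close>
  define A where "A = max h (4 * (2 * real d + 1))"
  show "h \<le> A" by (simp add: A_def)
  fix s x :: real assume s: "0 < s" and x: "h \<le> x"
  let ?u = "lap s h"
  \<comment> \<open>The supremum is finite because \<open>?u\<close> is at most 1, but this alone
    says nothing relative to \<open>?u A\<close>. The contraction, with the killing
    \<open>1 - exp (- s)\<close> absorbed into \<open>?u A\<close>, turns it into
    \<open>M \<le> ?u A + 3 / 4 * M\<close>.\<close>
  define S where "S = (\<lambda>x. ?u x / (1 + x\<^sup>2)) ` {h..}"
  define M where "M = Sup S"
  have w: "0 < 1 + x\<^sup>2" for x :: real by (simp add: add_pos_nonneg)
  have u0: "0 < ?u x" for x by (rule lap_pos[OF s])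
  have "bdd_above S"
  proof (rule bdd_aboveI)
    fix y assume "y \<in> S"
    then obtain x where "y = ?u x / (1 + x\<^sup>2)" by (auto simp: S_def)
    moreover have "?u x \<le> 1 + x\<^sup>2" using lap_le_1[OF s, of h x] by (simp add: add_increasing2)
    ultimately show "y \<le> 1" using w[of x] by simp
  qed
  then have M: "?u x \<le> M * (1 + x\<^sup>2)" if "h \<le> x" for x
    using cSup_upper[of "?u x / (1 + x\<^sup>2)" S] that w[of x] by (auto simp: M_def S_def divide_le_eq)
  have M0: "0 \<le> M"
  proof -
    have "0 < M * (1 + h\<^sup>2)" using M[of h] u0[of h] by simp
    then show ?thesis using w[of h] by (simp add: zero_less_mult_iff)
  qed
  have adm: "adm h M ?u" using M u0 adm_measurable[OF adm_lap[OF s]] by (auto simp: adm_def intro: less_imp_le)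
  have bound: "?u x \<le> (?u A + 3 / 4 * M) * (1 + x\<^sup>2)" if "h \<le> x" for x
  proof (cases "x \<le> A")
    case True
    have "?u x * 1 \<le> (?u A + 3 / 4 * M) * (1 + x\<^sup>2)"
      using lap_mono[OF s True, of h] M0 u0[of A] u0[of x] by (intro mult_mono) auto
    then show ?thesis by simp
  next
    case False
    have d: "real d \<ge> 2" using d_ge_2 by simp
    have "real d * Q h ?u x \<le> real d * (M * (1 + sigma_Y2 d + (x / real d)\<^sup>2))"
      by (intro mult_left_mono Q_le_weight[OF adm]) auto
    also have "\<dots> = M * (2 * real d + 1 + x\<^sup>2 / real d)"
      using d by (simp add: sigma_Y2_def field_simps power2_eq_square)
    also have "\<dots> \<le> M * (3 / 4 * (1 + x\<^sup>2))"
    proof (rule mult_left_mono[OF _ M0])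
      have aux: "D + Y \<le> 3 / 4 * (1 + W)" if "Y \<le> W / 2" "4 * D \<le> W" for D Y W :: real
        using that by (simp add: field_simps)
      have "x\<^sup>2 / real d \<le> x\<^sup>2 / 2" using d by (intro divide_left_mono) auto
      moreover have "4 * (2 * real d + 1) \<le> x\<^sup>2"
      proof -
        have "1 \<le> x" "4 * (2 * real d + 1) \<le> x" using False d by (auto simp: A_def)
        then show ?thesis using mult_mono[of 1 x "4 * (2 * real d + 1)" x] d by (simp add: power2_eq_square)
      qed
      ultimately show "2 * real d + 1 + x\<^sup>2 / real d \<le> 3 / 4 * (1 + x\<^sup>2)" by (rule aux)
    qed
    finally have "?u x \<le> ?u A + 3 / 4 * M * (1 + x\<^sup>2)"
      using lap_le_linear[OF s, of h x] lap_ge[OF s, of h A] mult.assoc[of "3 / 4" M "1 + x\<^sup>2"]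
      by (simp only: mult.left_commute[of M])
    also have "?u A \<le> ?u A * (1 + x\<^sup>2)" using u0[of A] by (simp add: algebra_simps)
    finally show ?thesis by (simp add: algebra_simps)
  qed
  have "M \<le> ?u A + 3 / 4 * M" unfolding M_def
  proof (rule cSup_least)
    show "S \<noteq> {}" by (auto simp: S_def)
    fix y assume "y \<in> S"
    then show "y \<le> ?u A + 3 / 4 * Sup S"
      using bound w by (auto simp: S_def M_def divide_le_eq)
  qed
  then have "M \<le> 4 * ?u A" by simp
  then have "M * (1 + x\<^sup>2) \<le> 4 * ?u A * (1 + x\<^sup>2)" using w[of x] by (intro mult_right_mono) auto
  with M[OF x] show "?u x \<le> 4 * ?u A * (1 + x\<^sup>2)" by linarith
qed

text \<open>Helly gives convergence almost everywhere only; the smoothing by \<open>Q\<close> in the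
  equation upgrades it to every point. The limit solves the linearised equation with a source
  \<open>\<kappa>\<close>, which must vanish at the critical level.\<close>

lemma lap_subsequence:
  assumes A: "hc \<le> A" "\<And>s x. 0 < s \<Longrightarrow> hc \<le> x \<Longrightarrow> lap s hc x \<le> 4 * lap s hc A * (1 + x\<^sup>2)"
    and s: "\<And>n. 0 < s n" "s \<longlonglongrightarrow> 0"
  shows "\<exists>r f. strict_mono r \<and> adm hc 4 f \<and> (\<forall>x. 0 < f x) \<and> (\<forall>a. f a = real d * Q hc f a) \<and>
    (\<forall>a. (\<lambda>n. Q hc (lap (s (r n)) hc) a / lap (s (r n)) hc A) \<longlonglongrightarrow> Q hc f a)"
proof -
  define m where "m n = lap (s n) hc A" for n
  have m: "0 < m n" for n unfolding m_def by (rule lap_pos[OF s(1)])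
  define F where "F n x = lap (s n) hc x / m n" for n x
  \<comment> \<open>Killing relative to the normalisation; it is at most 1 because
    \<open>lap (s n) hc A\<close> is at least \<open>1 - exp (- s n)\<close>.\<close>
  define k where "k n = (1 - exp (- s n)) / m n" for n
  have F0: "0 < F n x" for n x using lap_pos[OF s(1)] m by (simp add: F_def)
  have Fle: "F n x \<le> 4 * (1 + x\<^sup>2)" if "hc \<le> x" for n x
    using A(2)[OF s(1)[of n] that] m[of n] by (simp add: F_def m_def field_simps)
  have Fmono: "F n x \<le> F n y" if "x \<le> y" for n x y
    unfolding F_def using lap_mono[OF s(1) that] m by (intro divide_right_mono) (auto intro: less_imp_le)
  have Fm: "F n \<in> borel_measurable borel" for n
    unfolding F_def using adm_measurable[OF adm_lap[OF s(1)]] by simp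
  have Fadm: "adm hc 4 (F n)" for n
    using Fle F0 Fm by (auto simp: adm_def intro: less_imp_le)
  have k01: "k n \<in> {0..1}" for n
    using lap_ge[OF s(1), of n hc A] m[of n] s(1)[of n] by (simp add: k_def m_def)
  have "bounded (range k)" by (rule bounded_subset[of "{0..1}"]) (use k01 in auto)
  then obtain \<kappa> r1 where r1: "strict_mono r1" "(k \<circ> r1) \<longlonglongrightarrow> \<kappa>"
    using bounded_imp_convergent_subsequence by blast
  have "\<kappa> \<ge> 0" using r1(2) k01 by (intro LIMSEQ_le_const[of _ \<kappa>]) auto
  \<comment> \<open>Helly's theorem needs a uniform bound, which \<open>F\<close> lacks; the
    increasing map \<open>y / (1 + y)\<close> provides it and is inverted below by
    \<open>y / (1 - y)\<close>.\<close>
  define g where "g n x = F (r1 n) x / (1 + F (r1 n) x)" for n x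
  have "\<exists>r. strict_mono r \<and> (\<exists>G. (\<forall>x. continuous (at_right x) G) \<and> mono G \<and> (\<forall>x. \<bar>G x\<bar> \<le> 1) \<and>
      (\<forall>x. continuous (at x) G \<longrightarrow> (\<lambda>n. g (r n) x) \<longlonglongrightarrow> G x))"
  proof (rule Helly_selection)
    show "continuous (at_right x) (g n)" for n x
    proof (rule continuous_within_subset[of _ UNIV])
      have "1 + F (r1 n) x \<noteq> 0" using F0[of "r1 n" x] by simp
      then show "continuous (at x within UNIV) (g n)" unfolding g_def F_def
        using m[of "r1 n"] by (intro continuous_intros lap_isCont s(1)) auto
    qed simp
    show "mono (g n)" for n
      unfolding g_def using F0 Fmono by (intro monoI frac_mono) (auto intro: less_imp_le)
    show "\<bar>g n x\<bar> \<le> 1" for n x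
      using F0[of "r1 n" x] by (simp add: g_def)
  qed
  then obtain r2 G where r2: "strict_mono r2" "mono G"
    "\<And>x. continuous (at x) G \<Longrightarrow> (\<lambda>n. g (r2 n) x) \<longlonglongrightarrow> G x" by blast
  define r where "r = r1 \<circ> r2"
  have r: "strict_mono r" unfolding r_def using r1(1) r2(1) by (rule strict_mono_o)
  have gr: "g (r2 n) x = F (r n) x / (1 + F (r n) x)" for n x by (simp add: g_def r_def)
  define \<Phi> where "\<Phi> x = G x / (1 - G x)" for x
  have Gm: "G \<in> borel_measurable borel" using r2(2) by (rule borel_measurable_mono)
  have \<Phi>m[measurable]: "\<Phi> \<in> borel_measurable borel" unfolding \<Phi>_def using Gm by measurable
  have "AE x in lborel. x \<notin> {x. \<not> isCont G x}"
    by (intro AE_not_in countable_imp_null_set_lborel mono_ctble_discont r2(2))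
  then have FAE: "AE x in lborel. hc \<le> x \<longrightarrow> (\<lambda>n. F (r n) x) \<longlonglongrightarrow> \<Phi> x"
  proof (rule eventually_mono, intro impI)
    fix x assume "x \<notin> {x. \<not> isCont G x}" and x: "hc \<le> x"
    then have lim: "(\<lambda>n. g (r2 n) x) \<longlonglongrightarrow> G x" using r2(3) by simp
    have w: "0 < 1 + x\<^sup>2" by (simp add: add_pos_nonneg)
    \<comment> \<open>The Harnack bound keeps \<open>G x\<close> away from 1, where the inverse map
      is singular.\<close>
    have "g (r2 n) x \<le> (4 * (1 + x\<^sup>2)) / (1 + 4 * (1 + x\<^sup>2))" for n
      unfolding gr using F0[of "r n" x] Fle[OF x, of "r n"] by (intro frac_mono) auto
    then have "G x \<le> (4 * (1 + x\<^sup>2)) / (1 + 4 * (1 + x\<^sup>2))" by (intro LIMSEQ_le_const2[OF lim]) auto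
    also have "\<dots> < 1" using w by simp
    finally have "1 - G x \<noteq> 0" by simp
    then have "(\<lambda>n. g (r2 n) x / (1 - g (r2 n) x)) \<longlonglongrightarrow> \<Phi> x"
      unfolding \<Phi>_def by (intro tendsto_intros lim)
    moreover have "g (r2 n) x / (1 - g (r2 n) x) = F (r n) x" for n
      unfolding gr using F0[of "r n" x] by (simp add: field_simps)
    ultimately show "(\<lambda>n. F (r n) x) \<longlonglongrightarrow> \<Phi> x" by simp
  qed
  have Qlim: "(\<lambda>n. Q hc (F (r n)) a) \<longlonglongrightarrow> Q hc \<Phi> a" for a
    by (rule Q_tendsto[OF Fadm \<Phi>m FAE])
  have QF: "Q hc (F n) a = Q hc (lap (s n) hc) a / m n" for n a
    unfolding F_def by (rule Q_divide)
  have sr: "filterlim (\<lambda>n. s (r n)) (at_right 0) sequentially"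
    using LIMSEQ_subseq_LIMSEQ[OF s(2) r] s(1) less_imp_neq[OF s(1), THEN not_sym]
    by (auto simp: filterlim_at comp_def)
  have q0: "(\<lambda>n. Q hc (lap (s (r n)) hc) a) \<longlonglongrightarrow> 0" for a
  proof -
    have "(\<lambda>n. Q hc (lap (s (r n)) hc) a) \<longlonglongrightarrow> Q hc (\<lambda>_. 0) a"
      by (rule Q_tendsto[OF adm_lap[OF s(1)]]) (auto intro!: filterlim_compose[OF lap_tendsto_0 sr])
    then show ?thesis by (simp add: Q_eq)
  qed
  have kr: "(\<lambda>n. k (r n)) \<longlonglongrightarrow> \<kappa>"
    using LIMSEQ_subseq_LIMSEQ[OF r1(2) r2(1)] by (simp add: r_def comp_def)
  \<comment> \<open>\<open>\<Phi>\<close> is the limit almost everywhere above \<open>hc\<close>;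
    \<open>f\<close> is its version given by the limiting equation at every point.\<close>
  define f where "f a = \<kappa> + real d * Q hc \<Phi> a" for a
  have Flim: "(\<lambda>n. F (r n) a) \<longlonglongrightarrow> f a" for a
  proof -
    have eq: "F n a = k n * (1 - Q hc (lap (s n) hc) a) ^ d
       + Q hc (F n) a * (\<Sum>j<d. (1 - Q hc (lap (s n) hc) a) ^ j)" for n
    proof -
      have "F n a = ((1 - exp (- s n)) * (1 - Q hc (lap (s n) hc) a) ^ d
         + Q hc (lap (s n) hc) a * (\<Sum>j<d. (1 - Q hc (lap (s n) hc) a) ^ j)) / m n"
        unfolding F_def lap_fixed[OF s(1), of n hc a] one_minus_scaled_power[symmetric] ..
      then show ?thesis unfolding QF k_def by (simp add: add_divide_distrib)
    qed
    have "(\<lambda>n. k (r n) * (1 - Q hc (lap (s (r n)) hc) a) ^ d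
       + Q hc (F (r n)) a * (\<Sum>j<d. (1 - Q hc (lap (s (r n)) hc) a) ^ j))
       \<longlonglongrightarrow> \<kappa> * (1 - 0) ^ d + Q hc \<Phi> a * (\<Sum>j<d. (1 - 0) ^ j)"
      by (intro tendsto_intros kr q0 Qlim)
    then show ?thesis unfolding eq[symmetric] f_def by (simp add: mult.commute)
  qed
  have fm[measurable]: "f \<in> borel_measurable borel" unfolding f_def by measurable
  have f\<Phi>: "AE x in lborel. hc \<le> x \<longrightarrow> \<Phi> x = f x"
    using FAE by (rule eventually_mono) (auto intro: LIMSEQ_unique[OF _ Flim])
  have Qf: "Q hc \<Phi> a = Q hc f a" for a by (rule Q_cong_AE[OF \<Phi>m fm f\<Phi>])
  have ffix: "f a = \<kappa> + real d * Q hc f a" for a unfolding f_def[of a] Qf ..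
  have f0: "0 \<le> f x" for x by (rule LIMSEQ_le_const[OF Flim]) (use F0 in \<open>auto intro: less_imp_le\<close>)
  have fadm: "adm hc 4 f"
    unfolding adm_def using f0 Fle by (auto intro: LIMSEQ_le_const2[OF Flim])
  have fmono: "f x \<le> f y" if "x \<le> y" for x y
    by (rule LIMSEQ_le[OF Flim Flim]) (use Fmono[OF that] in auto)
  \<comment> \<open>A positive source would amount to a finite expected cluster size at the critical
    level.\<close>
  have "\<kappa> = 0"
    using no_supersolution_h_star[OF fadm fmono ffix] \<open>\<kappa> \<ge> 0\<close> by fastforce
  then have ffix: "f a = real d * Q hc f a" for a using ffix[of a] by simp
  \<comment> \<open>Normalisation at \<open>A\<close> prevents the limit from being zero;
    monotonicity and the positive kernel then make it positive everywhere.\<close>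
  have "F n A = 1" for n using m[of n] by (simp add: F_def m_def)
  then have fA: "f A = 1" using LIMSEQ_unique[OF Flim[of A]] by simp
  have "0 < Q hc f a" for a
    by (rule Q_pos[OF fadm, of A]) (use fmono[of A] fA in force)
  then have "0 < f a" for a using ffix[of a] by simp
  then show ?thesis
    using r fadm ffix Qlim unfolding Qf QF m_def by blast
qed

section \<open>Integration against the stationary law\<close>

lemma nu_integrable:
  assumes [measurable]: "g \<in> borel_measurable borel" and "\<And>x. h \<le> x \<Longrightarrow> \<bar>g x\<bar> \<le> C * (1 + x\<^sup>2) ^ k"
  shows "integrable (nu d) (\<lambda>x. indicator {h..} x * g x)"
proof (rule Bochner_Integration.integrable_bound)
  show "integrable (nu d) (\<lambda>x. C * (1 + x\<^sup>2) ^ k)" using integrable_nu_weight by simp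
  show "AE x in nu d. norm (indicator {h..} x * g x) \<le> norm (C * (1 + x\<^sup>2) ^ k)"
  proof (intro AE_I2)
    fix x
    show "norm (indicator {h..} x * g x) \<le> norm (C * (1 + x\<^sup>2) ^ k)"
      using assms(2)[of x] by (cases "h \<le> x") (auto simp: indicator_def)
  qed
qed measurable

lemma nu_dominated_convergence:
  assumes [measurable]: "\<And>n. g n \<in> borel_measurable borel" "f \<in> borel_measurable borel"
    and bd: "\<And>n x. h \<le> x \<Longrightarrow> \<bar>g n x\<bar> \<le> C * (1 + x\<^sup>2) ^ k"
    and lim: "\<And>x. h \<le> x \<Longrightarrow> (\<lambda>n::nat. g n x) \<longlonglongrightarrow> f x"
  shows "(\<lambda>n. \<integral>x. indicator {h..} x * g n x \<partial>nu d) \<longlonglongrightarrow> (\<integral>x. indicator {h..} x * f x \<partial>nu d)"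
proof (rule integral_dominated_convergence)
  show "integrable (nu d) (\<lambda>x. \<bar>C * (1 + x\<^sup>2) ^ k\<bar>)" using integrable_nu_weight by simp
  show "AE x in nu d. (\<lambda>n. indicator {h..} x * g n x) \<longlonglongrightarrow> indicator {h..} x * f x"
    using lim by (intro AE_I2) (auto simp: indicator_def)
  show "AE x in nu d. norm (indicator {h..} x * g n x) \<le> \<bar>C * (1 + x\<^sup>2) ^ k\<bar>" for n
  proof (intro AE_I2)
    fix x
    show "norm (indicator {h..} x * g n x) \<le> \<bar>C * (1 + x\<^sup>2) ^ k\<bar>"
      using bd[of x n] by (cases "h \<le> x") (auto simp: indicator_def)
  qed
qed measurable

lemma nu_integral_pos:
  fixes g :: "real \<Rightarrow> real"
  assumes int: "integrable (nu d) (\<lambda>x. indicator {h..} x * g x)" and pos: "\<And>x. 0 < g x"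
  shows "0 < (\<integral>x. indicator {h..} x * g x \<partial>nu d)"
proof -
  have nn: "AE x in nu d. 0 \<le> indicator {h..} x * g x"
    using pos by (intro AE_I2) (auto simp: indicator_def intro: less_imp_le)
  have "(\<integral>x. indicator {h..} x * g x \<partial>nu d) \<noteq> 0"
  proof
    assume "(\<integral>x. indicator {h..} x * g x \<partial>nu d) = 0"
    then have "AE x in nu d. indicator {h..} x * g x = 0"
      using integral_nonneg_eq_0_iff_AE[OF int nn] by simp
    then have "AE x in lborel. indicator {h..} x * g x = 0" by (simp only: nu_AE_iff)
    then have "AE x in lborel. x \<notin> {h..h + 1}"
      by (rule eventually_mono) (use pos in \<open>auto simp: indicator_def less_le split: if_splits\<close>)
    then have "emeasure lborel {h..h + 1} = 0"
      by (subst (asm) AE_iff_measurable[of "{h..h + 1}"]) auto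
    then show False by simp
  qed
  moreover have "0 \<le> (\<integral>x. indicator {h..} x * g x \<partial>nu d)" by (rule integral_nonneg_AE[OF nn])
  ultimately show ?thesis by linarith
qed

end

section \<open>Second order expansion and the tail\<close>

lemma asymp_equiv_of_sqrt_limit:
  fixes T :: "real \<Rightarrow> real"
  assumes "((\<lambda>t. sqrt t * T t) \<longlongrightarrow> c) at_top" "c \<noteq> 0"
  shows "T \<sim>[at_top] (\<lambda>t. c * t powr (-1/2))"
proof (rule asymp_equivI')
  have "((\<lambda>t. sqrt t * T t / c) \<longlongrightarrow> c / c) at_top"
    by (intro tendsto_divide assms tendsto_const)
  then have "((\<lambda>t. sqrt t * T t / c) \<longlongrightarrow> 1) at_top" using assms(2) by simp
  then show "((\<lambda>t. T t / (c * t powr (-1/2))) \<longlongrightarrow> 1) at_top"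
  proof (rule Lim_transform_eventually)
    show "eventually (\<lambda>t. sqrt t * T t / c = T t / (c * t powr (-1/2))) at_top"
      using eventually_gt_at_top[of 0]
      by eventually_elim (simp add: powr_minus powr_half_sqrt field_simps)
  qed
qed

context tree_degree
begin

text \<open>Above the critical level \<open>f = N chi\<close>, so \<open>I1 / I3\<close> is
  \<open>N^(-2)\<close> times the ratio formed with \<open>chi\<close>, and the left side depends on
  \<open>chi\<close> only. The factor \<open>sqrt pi\<close> undoes the
  \<open>1 / Gamma (1/2)\<close> in \<open>C1\<close>.\<close>

lemma chi_scaling:
  assumes fadm: "adm hc B f" and fpos: "\<And>x. 0 < f x" and ffix: "\<And>a. f a = real d * Q hc f a"
    and a: "hc \<le> a"
  defines "I1 \<equiv> \<integral>x. indicator {hc..} x * f x \<partial>nu d" and "I3 \<equiv> \<integral>x. indicator {hc..} x * f x ^ 3 \<partial>nu d"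
  shows "f a * sqrt (2 * real d / (real d - 1) * (I1 / I3)) = C1 d * sqrt pi * chi d a"
    and "0 < chi d a"
proof -
  define N where "N = norm_nu d (\<lambda>x. indicator {hc..} x * f x)"
  have N: "0 < N" unfolding N_def by (rule norm_restr_pos[OF fadm fpos ffix])
  have chi: "chi d x = indicator {hc..} x * f x / N" for x
    unfolding chi_def N_def by (simp only: chi_h_eq[OF fadm fpos ffix])
  show "0 < chi d a" using fpos[of a] N a by (simp add: chi)
  have 1: "(\<integral>x. chi d x \<partial>nu d) = I1 / N" unfolding chi I1_def by simp
  have 3: "(\<integral>x. chi d x * (chi d x)\<^sup>2 \<partial>nu d) = I3 / N ^ 3"
  proof -
    have "chi d x * (chi d x)\<^sup>2 = indicator {hc..} x * f x ^ 3 / N ^ 3" for x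
      by (auto simp: chi indicator_def power3_eq_cube power2_eq_square)
    then show ?thesis unfolding I3_def by simp
  qed
  have eq: "2 * real d / (real d - 1) * ((I1 / N) / (I3 / N ^ 3)) = N\<^sup>2 * (2 * real d / (real d - 1) * (I1 / I3))"
    using N by (simp add: power2_eq_square power3_eq_cube)
  have "C1 d = 1 / sqrt pi * (N * sqrt (2 * real d / (real d - 1) * (I1 / I3)))"
    unfolding C1_def 1 3 Gamma_one_half_real eq
    by (simp only: real_sqrt_mult real_sqrt_abs abs_of_pos[OF N])
  then show "f a * sqrt (2 * real d / (real d - 1) * (I1 / I3)) = C1 d * sqrt pi * chi d a"
    using N a by (simp add: chi)
qed

text \<open>The equation for \<open>lap s h\<close> is tested against \<open>f\<close>.
  Self-adjointness and \<open>f = d Q f\<close> turn \<open>d\<close> times the integral of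
  \<open>f q\<close> into that of \<open>f\<close> times \<open>lap s h\<close>, so the linear terms
  cancel and killing balances the quadratic remainder exactly.\<close>

lemma lap_identity:
  assumes s: "0 < s" and fadm: "adm h B f" and ffix: "\<And>a. f a = real d * Q h f a"
  defines "q \<equiv> Q h (lap s h)"
  shows "(1 - exp (- s)) * (\<integral>x. indicator {h..} x * (f x * (1 - q x) ^ d) \<partial>nu d)
    = (\<integral>x. indicator {h..} x * (f x * ((q x)\<^sup>2 * (\<Sum>i<d. \<Sum>j<i. (1 - q x) ^ j))) \<partial>nu d)"
proof -
  have [measurable]: "f \<in> borel_measurable borel" by (rule adm_measurable[OF fadm])
  have um[measurable]: "lap s h \<in> borel_measurable borel" by (rule adm_measurable[OF adm_lap[OF s]])
  have qm[measurable]: "q \<in> borel_measurable borel" unfolding q_def by measurable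
  have q: "0 \<le> q x" "q x \<le> 1" for x unfolding q_def by (rule Q_lap[OF s])+
  have int: "integrable (nu d) (\<lambda>x. indicator {h..} x * (f x * g x))"
    if [measurable]: "g \<in> borel_measurable borel" and g: "\<And>x. \<bar>g x\<bar> \<le> 1" for g
  proof (rule nu_integrable[where C=B and k=1])
    show "\<bar>f x * g x\<bar> \<le> B * (1 + x\<^sup>2) ^ 1" if "h \<le> x" for x
    proof -
      have "\<bar>f x\<bar> * \<bar>g x\<bar> \<le> \<bar>f x\<bar> * 1" using g by (intro mult_left_mono) auto
      also have "\<dots> \<le> B * (1 + x\<^sup>2)" using fadm that by (simp add: adm_def)
      finally show ?thesis by (simp add: abs_mult)
    qed
  qed measurable
  have p: "0 \<le> (1 - q x) ^ d" "(1 - q x) ^ d \<le> 1" for x using q[of x] by (auto intro: power_le_one)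
  have i1: "integrable (nu d) (\<lambda>x. indicator {h..} x * (f x * (1 - q x) ^ d))"
    by (rule int) (use p in auto)
  have i2: "integrable (nu d) (\<lambda>x. indicator {h..} x * (f x * (1 - (1 - q x) ^ d)))"
    by (rule int) (use p in auto)
  have i3: "integrable (nu d) (\<lambda>x. indicator {h..} x * (f x * q x))"
    by (rule int) (use q in auto)
  have "(\<integral>x. indicator {h..} x * (f x * q x) \<partial>nu d) = (\<integral>x. indicator {h..} x * (lap s h x * Q h f x) \<partial>nu d)"
    unfolding q_def by (rule Q_symmetric[OF fadm adm_lap[OF s]])
  also have "\<dots> = (\<integral>x. (1 / real d) * (indicator {h..} x * (f x * lap s h x)) \<partial>nu d)"
  proof (rule Bochner_Integration.integral_cong[OF refl])
    fix x
    have "Q h f x = f x / real d" using ffix[of x] by (simp add: field_simps)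
    then show "indicator {h..} x * (lap s h x * Q h f x) = (1 / real d) * (indicator {h..} x * (f x * lap s h x))"
      by simp
  qed
  finally have sym: "real d * (\<integral>x. indicator {h..} x * (f x * q x) \<partial>nu d) = (\<integral>x. indicator {h..} x * (f x * lap s h x) \<partial>nu d)"
    by simp
  have lap_eq: "lap s h x = (1 - exp (- s)) * (1 - q x) ^ d + (1 - (1 - q x) ^ d)" for x
    using lap_fixed[OF s, of h x] by (simp add: q_def algebra_simps)
  have "(\<integral>x. indicator {h..} x * (f x * lap s h x) \<partial>nu d)
     = (\<integral>x. (1 - exp (- s)) * (indicator {h..} x * (f x * (1 - q x) ^ d)) + indicator {h..} x * (f x * (1 - (1 - q x) ^ d)) \<partial>nu d)"
    by (intro Bochner_Integration.integral_cong refl) (subst lap_eq, simp add: algebra_simps)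
  also have "\<dots> = (1 - exp (- s)) * (\<integral>x. indicator {h..} x * (f x * (1 - q x) ^ d) \<partial>nu d) + (\<integral>x. indicator {h..} x * (f x * (1 - (1 - q x) ^ d)) \<partial>nu d)"
    using i1 i2 by simp
  finally have "(1 - exp (- s)) * (\<integral>x. indicator {h..} x * (f x * (1 - q x) ^ d) \<partial>nu d)
     = real d * (\<integral>x. indicator {h..} x * (f x * q x) \<partial>nu d) - (\<integral>x. indicator {h..} x * (f x * (1 - (1 - q x) ^ d)) \<partial>nu d)"
    unfolding sym by linarith
  also have "\<dots> = (\<integral>x. real d * (indicator {h..} x * (f x * q x)) - indicator {h..} x * (f x * (1 - (1 - q x) ^ d)) \<partial>nu d)"
    using i2 i3 by simp
  also have "\<dots> = (\<integral>x. indicator {h..} x * (f x * ((q x)\<^sup>2 * (\<Sum>i<d. \<Sum>j<i. (1 - q x) ^ j))) \<partial>nu d)"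
    unfolding power_second_order[symmetric]
    by (intro Bochner_Integration.integral_cong refl) (simp add: algebra_simps)
  finally show ?thesis .
qed

text \<open>Dividing the exact identity by \<open>m^2\<close> makes both sides converge: the
  integral next to the killing factor tends to \<open>I1\<close>, the quadratic side to
  \<open>(d - 1) / (2 d) * I3\<close>. Solving for \<open>m / sqrt s\<close> gives the
  constant.\<close>

lemma lap_second_order:
  assumes s: "\<And>n. 0 < s n" "s \<longlonglongrightarrow> 0"
    and A: "\<And>s x. 0 < s \<Longrightarrow> hc \<le> x \<Longrightarrow> lap s hc x \<le> 4 * lap s hc A * (1 + x\<^sup>2)"
    and fadm: "adm hc B f" and fpos: "\<And>x. 0 < f x" and ffix: "\<And>a. f a = real d * Q hc f a"
    and Qlim: "\<And>a. (\<lambda>n. Q hc (lap (s n) hc) a / lap (s n) hc A) \<longlonglongrightarrow> Q hc f a"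
  defines "I1 \<equiv> \<integral>x. indicator {hc..} x * f x \<partial>nu d" and "I3 \<equiv> \<integral>x. indicator {hc..} x * f x ^ 3 \<partial>nu d"
  shows "(\<lambda>n. lap (s n) hc A / sqrt (s n)) \<longlonglongrightarrow> sqrt (2 * real d / (real d - 1) * (I1 / I3))"
proof -
  define m where "m n = lap (s n) hc A" for n
  have m: "0 < m n" for n unfolding m_def by (rule lap_pos[OF s(1)])
  define q where "q n = Q hc (lap (s n) hc)" for n
  define \<eta> where "\<eta> y = (\<Sum>i<d. \<Sum>j<i. (1 - y) ^ j)" for y :: real
  have [measurable]: "f \<in> borel_measurable borel" by (rule adm_measurable[OF fadm])
  have um[measurable]: "lap (s n) hc \<in> borel_measurable borel" for n by (rule adm_measurable[OF adm_lap[OF s(1)]])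
  have qm[measurable]: "q n \<in> borel_measurable borel" for n unfolding q_def by measurable
  have [measurable]: "\<eta> \<in> borel_measurable borel" unfolding \<eta>_def by measurable
  have q01: "0 \<le> q n x" "q n x \<le> 1" for n x unfolding q_def by (rule Q_lap[OF s(1)])+
  have fB: "0 \<le> f x" "f x \<le> B * (1 + x\<^sup>2)" if "hc \<le> x" for x using fadm that by (auto simp: adm_def)
  have sr: "filterlim s (at_right 0) sequentially"
    using s(2) s(1) less_imp_neq[OF s(1), THEN not_sym] by (auto simp: filterlim_at)
  have q0: "(\<lambda>n. q n a) \<longlonglongrightarrow> 0" for a
  proof -
    have "(\<lambda>n. Q hc (lap (s n) hc) a) \<longlonglongrightarrow> Q hc (\<lambda>_. 0) a"
      by (rule Q_tendsto[OF adm_lap[OF s(1)]]) (auto intro!: filterlim_compose[OF lap_tendsto_0 sr])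
    then show ?thesis by (simp add: Q_eq q_def)
  qed
  have \<eta>_bd: "0 \<le> \<eta> y" "\<eta> y \<le> real (d * d)" if "0 \<le> y" "y \<le> 1" for y
  proof -
    show "0 \<le> \<eta> y" unfolding \<eta>_def using that by (intro sum_nonneg) auto
    have "\<eta> y \<le> (\<Sum>i<d. \<Sum>j<i. 1)" unfolding \<eta>_def using that by (intro sum_mono power_le_one) auto
    also have "\<dots> \<le> (\<Sum>i<d. real d)" by (intro sum_mono) auto
    finally show "\<eta> y \<le> real (d * d)" by simp
  qed
  have \<eta>0: "\<eta> 0 = real d * (real d - 1) / 2"
  proof -
    have "(\<Sum>i<n. real i) = real n * (real n - 1) / 2" for n by (induction n) (auto simp: field_simps)
    then show ?thesis by (simp add: \<eta>_def)
  qed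
  have a_lim: "(\<lambda>n. \<integral>x. indicator {hc..} x * (f x * (1 - q n x) ^ d) \<partial>nu d) \<longlonglongrightarrow> I1"
    unfolding I1_def
  proof (rule nu_dominated_convergence[where C=B and k=1])
    show "\<bar>f x * (1 - q n x) ^ d\<bar> \<le> B * (1 + x\<^sup>2) ^ 1" if "hc \<le> x" for n x
    proof -
      have "f x * (1 - q n x) ^ d \<le> f x * 1"
        using q01[of n x] fB[OF that] by (intro mult_left_mono power_le_one) auto
      moreover have "0 \<le> f x * (1 - q n x) ^ d" using q01[of n x] fB[OF that] by simp
      ultimately show ?thesis using fB[OF that] by simp
    qed
    show "(\<lambda>n. f x * (1 - q n x) ^ d) \<longlonglongrightarrow> f x" for x
    proof -
      have "(\<lambda>n. f x * (1 - q n x) ^ d) \<longlonglongrightarrow> f x * (1 - 0) ^ d" by (intro tendsto_intros q0)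
      then show ?thesis by simp
    qed
  qed measurable
  \<comment> \<open>The Harnack bound passes through \<open>Q\<close>, so \<open>q n / m n\<close>
    has quadratic growth uniformly in \<open>n\<close>.\<close>
  define c where "c = 4 * (2 + sigma_Y2 d)"
  have qm_bd: "q n x / m n \<le> c * (1 + x\<^sup>2)" "0 \<le> q n x / m n" for n x
  proof -
    have "adm hc (4 * m n) (lap (s n) hc)"
      using A[OF s(1)] lap_pos[OF s(1)] by (auto simp: adm_def m_def intro: less_imp_le)
    then have "q n x \<le> (4 * m n) * (1 + sigma_Y2 d + (x / real d)\<^sup>2)"
      unfolding q_def by (rule Q_le_weight)
    also have "\<dots> \<le> (4 * m n) * ((2 + sigma_Y2 d) * (1 + x\<^sup>2))"
    proof (rule mult_left_mono)
      have "(x / real d)\<^sup>2 \<le> x\<^sup>2"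
        using d_ge_2 by (simp add: power_divide divide_le_eq mult_le_cancel_left1 one_le_power)
      then show "1 + sigma_Y2 d + (x / real d)\<^sup>2 \<le> (2 + sigma_Y2 d) * (1 + x\<^sup>2)"
        using sigma_pos by (simp add: algebra_simps) (smt (verit) mult_nonneg_nonneg zero_le_power2)
    qed (use m[of n] in simp)
    finally show "q n x / m n \<le> c * (1 + x\<^sup>2)"
      using m[of n] by (simp add: c_def divide_le_eq) (simp add: algebra_simps)
    show "0 \<le> q n x / m n" using q01[of n x] m[of n] by simp
  qed
  \<comment> \<open>The dominating function is the third power of the weight: one factor from
    \<open>f\<close>, two from the square of \<open>q n / m n\<close>.\<close>
  have b_lim: "(\<lambda>n. \<integral>x. indicator {hc..} x * (f x * ((q n x / m n)\<^sup>2 * \<eta> (q n x))) \<partial>nu d)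
      \<longlonglongrightarrow> (\<integral>x. indicator {hc..} x * ((real d - 1) / (2 * real d) * f x ^ 3) \<partial>nu d)"
  proof (rule nu_dominated_convergence[where C="B * (c\<^sup>2 * real (d * d))" and k=3])
    show "\<bar>f x * ((q n x / m n)\<^sup>2 * \<eta> (q n x))\<bar> \<le> B * (c\<^sup>2 * real (d * d)) * (1 + x\<^sup>2) ^ 3" if "hc \<le> x" for n x
    proof -
      have "f x * ((q n x / m n)\<^sup>2 * \<eta> (q n x)) \<le> (B * (1 + x\<^sup>2)) * ((c * (1 + x\<^sup>2))\<^sup>2 * real (d * d))"
        using fB[OF that] qm_bd[of n x] \<eta>_bd[OF q01] by (intro mult_mono power_mono) auto
      also have "\<dots> = B * (c\<^sup>2 * real (d * d)) * (1 + x\<^sup>2) ^ 3"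
        by (simp only: power_mult_distrib power2_eq_square power3_eq_cube mult_ac)
      finally have up: "f x * ((q n x / m n)\<^sup>2 * \<eta> (q n x)) \<le> B * (c\<^sup>2 * real (d * d)) * (1 + x\<^sup>2) ^ 3" .
      have nn: "0 \<le> f x * ((q n x / m n)\<^sup>2 * \<eta> (q n x))"
        using fB[OF that] \<eta>_bd[OF q01] by simp
      show ?thesis unfolding abs_of_nonneg[OF nn] by (rule up)
    qed
    show "(\<lambda>n. f x * ((q n x / m n)\<^sup>2 * \<eta> (q n x))) \<longlonglongrightarrow> (real d - 1) / (2 * real d) * f x ^ 3" for x
    proof -
      have "(\<lambda>n. \<eta> (q n x)) \<longlonglongrightarrow> \<eta> 0" unfolding \<eta>_def by (intro tendsto_intros q0)
      then have "(\<lambda>n. f x * ((q n x / m n)\<^sup>2 * \<eta> (q n x))) \<longlonglongrightarrow> f x * ((Q hc f x)\<^sup>2 * \<eta> 0)"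
        using Qlim[of x] unfolding q_def m_def by (intro tendsto_intros)
      moreover have "Q hc f x = f x / real d" using ffix[of x] by (simp add: field_simps)
      moreover have "f x * ((f x / real d)\<^sup>2 * \<eta> 0) = (real d - 1) / (2 * real d) * f x ^ 3"
        unfolding \<eta>0 by (simp add: power2_eq_square power3_eq_cube field_simps)
      ultimately show ?thesis by simp
    qed
  qed measurable
  have I1: "0 < I1" unfolding I1_def
  proof (rule nu_integral_pos)
    show "integrable (nu d) (\<lambda>x. indicator {hc..} x * f x)"
      by (rule nu_integrable[where C=B and k=1]) (use fB in auto)
  qed (rule fpos)
  have I3: "0 < I3" unfolding I3_def
  proof (rule nu_integral_pos)
    show "integrable (nu d) (\<lambda>x. indicator {hc..} x * f x ^ 3)"
    proof (rule nu_integrable[where C="B ^ 3" and k=3])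
      show "\<bar>f x ^ 3\<bar> \<le> B ^ 3 * (1 + x\<^sup>2) ^ 3" if "hc \<le> x" for x
        using fB[OF that] power_mono[of "f x" "B * (1 + x\<^sup>2)" 3] by (simp add: power_mult_distrib)
    qed measurable
  qed (use fpos in simp)
  have "(\<lambda>n. (1 - exp (- s n)) / (m n)\<^sup>2) \<longlonglongrightarrow> ((real d - 1) / (2 * real d) * I3) / I1"
  proof -
    have "(\<lambda>n. (\<integral>x. indicator {hc..} x * (f x * ((q n x / m n)\<^sup>2 * \<eta> (q n x))) \<partial>nu d) / (\<integral>x. indicator {hc..} x * (f x * (1 - q n x) ^ d) \<partial>nu d))
       \<longlonglongrightarrow> (\<integral>x. indicator {hc..} x * ((real d - 1) / (2 * real d) * f x ^ 3) \<partial>nu d) / I1"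
      using I1 by (intro tendsto_divide a_lim b_lim) auto
    moreover have "(\<integral>x. indicator {hc..} x * ((real d - 1) / (2 * real d) * f x ^ 3) \<partial>nu d) = (real d - 1) / (2 * real d) * I3"
      unfolding I3_def by (simp only: mult.left_commute[of "indicator _ _"] integral_mult_right_zero)
    moreover have "eventually (\<lambda>n. (\<integral>x. indicator {hc..} x * (f x * ((q n x / m n)\<^sup>2 * \<eta> (q n x))) \<partial>nu d) / (\<integral>x. indicator {hc..} x * (f x * (1 - q n x) ^ d) \<partial>nu d) = (1 - exp (- s n)) / (m n)\<^sup>2) sequentially"
      using order_tendstoD(1)[OF a_lim I1]
    proof eventually_elim
      case (elim n)
      have "(\<integral>x. indicator {hc..} x * (f x * ((q n x / m n)\<^sup>2 * \<eta> (q n x))) \<partial>nu d)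
         = (\<integral>x. (1 / (m n)\<^sup>2) * (indicator {hc..} x * (f x * ((q n x)\<^sup>2 * \<eta> (q n x)))) \<partial>nu d)"
        by (intro Bochner_Integration.integral_cong refl) (simp add: power_divide)
      also have "\<dots> = (1 / (m n)\<^sup>2) * ((1 - exp (- s n)) * (\<integral>x. indicator {hc..} x * (f x * (1 - q n x) ^ d) \<partial>nu d))"
        unfolding q_def \<eta>_def lap_identity[OF s(1) fadm ffix] by (rule integral_mult_right_zero)
      finally show ?case using elim by simp
    qed
    ultimately show ?thesis by (simp add: Lim_transform_eventually)
  qed
  moreover have "(\<lambda>n. s n / (1 - exp (- s n))) \<longlonglongrightarrow> 1"
  proof (rule filterlim_compose[OF _ sr])
    show "((\<lambda>s::real. s / (1 - exp (- s))) \<longlongrightarrow> 1) (at_right 0)" by real_asymp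
  qed
  ultimately have "(\<lambda>n. s n / (1 - exp (- s n)) * ((1 - exp (- s n)) / (m n)\<^sup>2)) \<longlonglongrightarrow> 1 * (((real d - 1) / (2 * real d) * I3) / I1)"
    by (intro tendsto_mult)
  then have "(\<lambda>n. inverse (s n / (1 - exp (- s n)) * ((1 - exp (- s n)) / (m n)\<^sup>2))) \<longlonglongrightarrow> inverse (1 * (((real d - 1) / (2 * real d) * I3) / I1))"
    using I1 I3 d_ge_2 by (intro tendsto_inverse) auto
  then have "(\<lambda>n. sqrt (inverse (s n / (1 - exp (- s n)) * ((1 - exp (- s n)) / (m n)\<^sup>2)))) \<longlonglongrightarrow> sqrt (inverse (1 * (((real d - 1) / (2 * real d) * I3) / I1)))"
    by (rule tendsto_real_sqrt)
  moreover have "sqrt (inverse (s n / (1 - exp (- s n)) * ((1 - exp (- s n)) / (m n)\<^sup>2))) = m n / sqrt (s n)" for n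
  proof -
    have "1 - exp (- s n) \<noteq> 0" using s(1)[of n] by simp
    then have "inverse (s n / (1 - exp (- s n)) * ((1 - exp (- s n)) / (m n)\<^sup>2)) = (m n)\<^sup>2 / s n" by simp
    then show ?thesis using m[of n] by (simp add: real_sqrt_divide)
  qed
  moreover have "inverse (1 * (((real d - 1) / (2 * real d) * I3) / I1)) = 2 * real d / (real d - 1) * (I1 / I3)"
    by (simp add: field_simps)
  ultimately show ?thesis unfolding m_def by simp
qed

text \<open>Every sequence tending to 0 has a subsequence along which the quotient converges, and
  the limit, written with \<open>chi\<close>, no longer refers to the subsequence; hence the whole
  family converges.\<close>

lemma Q_lap_asymptotics:
  assumes a: "hc \<le> a"
  shows "((\<lambda>s. Q hc (lap s hc) a / sqrt s) \<longlongrightarrow> C1 d * sqrt pi * chi d a / real d) (at_right 0)"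
    and "0 < C1 d * sqrt pi * chi d a"
proof -
  obtain A where A: "hc \<le> A" "\<And>s x. 0 < s \<Longrightarrow> hc \<le> x \<Longrightarrow> lap s hc x \<le> 4 * lap s hc A * (1 + x\<^sup>2)"
    using lap_harnack[of hc] by metis
  \<comment> \<open>Positivity of the constant is carried along because it is read off from
    \<open>f\<close>, which is obtained together with the subsequence.\<close>
  have sub: "\<exists>r. strict_mono r \<and> (\<lambda>n. Q hc (lap (s (r n)) hc) a / sqrt (s (r n))) \<longlonglongrightarrow> C1 d * sqrt pi * chi d a / real d
      \<and> 0 < C1 d * sqrt pi * chi d a"
    if s: "\<And>n. 0 < s n" "s \<longlonglongrightarrow> 0" for s :: "nat \<Rightarrow> real"
  proof -
    obtain r f where r: "strict_mono r" and f: "adm hc 4 f" "\<And>x. 0 < f x" "\<And>a. f a = real d * Q hc f a"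
      and lim: "\<And>a. (\<lambda>n. Q hc (lap (s (r n)) hc) a / lap (s (r n)) hc A) \<longlonglongrightarrow> Q hc f a"
      using lap_subsequence[OF A s] by blast
    have sr: "(\<lambda>n. s (r n)) \<longlonglongrightarrow> 0" using LIMSEQ_subseq_LIMSEQ[OF s(2) r] by (simp add: comp_def)
    let ?R = "sqrt (2 * real d / (real d - 1) * ((\<integral>x. indicator {hc..} x * f x \<partial>nu d) / (\<integral>x. indicator {hc..} x * f x ^ 3 \<partial>nu d)))"
    have lim2: "(\<lambda>n. lap (s (r n)) hc A / sqrt (s (r n))) \<longlonglongrightarrow> ?R"
      by (rule lap_second_order[OF s(1) sr A(2) f lim])
    have "(\<lambda>n. Q hc (lap (s (r n)) hc) a / lap (s (r n)) hc A * (lap (s (r n)) hc A / sqrt (s (r n)))) \<longlonglongrightarrow> Q hc f a * ?R"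
      by (intro tendsto_mult lim lim2)
    moreover have "Q hc (lap (s (r n)) hc) a / lap (s (r n)) hc A * (lap (s (r n)) hc A / sqrt (s (r n))) = Q hc (lap (s (r n)) hc) a / sqrt (s (r n))" for n
      using lap_pos[OF s(1), of "r n" hc A] by simp
    moreover have "Q hc f a * ?R = C1 d * sqrt pi * chi d a / real d"
      using chi_scaling(1)[OF f a] f(3)[of a] by (simp add: field_simps)
    ultimately have "(\<lambda>n. Q hc (lap (s (r n)) hc) a / sqrt (s (r n))) \<longlonglongrightarrow> C1 d * sqrt pi * chi d a / real d" by (simp only:)
    moreover have "0 < C1 d * sqrt pi * chi d a"
    proof -
      have fB: "0 \<le> f x" "f x \<le> 4 * (1 + x\<^sup>2)" if "hc \<le> x" for x using f(1) that by (auto simp: adm_def)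
      have fm: "f \<in> borel_measurable borel" by (rule adm_measurable[OF f(1)])
      have 1: "0 < (\<integral>x. indicator {hc..} x * f x \<partial>nu d)"
        by (rule nu_integral_pos[OF nu_integrable[where C=4 and k=1]]) (use fB f(2) fm in auto)
      have 3: "0 < (\<integral>x. indicator {hc..} x * f x ^ 3 \<partial>nu d)"
      proof (rule nu_integral_pos[OF nu_integrable[where C="4 ^ 3" and k=3]])
        show "\<bar>f x ^ 3\<bar> \<le> 4 ^ 3 * (1 + x\<^sup>2) ^ 3" if "hc \<le> x" for x
        proof -
          have "f x ^ 3 \<le> (4 * (1 + x\<^sup>2)) ^ 3" using fB[OF that] by (intro power_mono)
          then show ?thesis using fB(1)[OF that] unfolding power_mult_distrib by simp
        qed
      qed (use f(2) fm in auto)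
      have "0 < f a * ?R" using f(2)[of a] 1 3 d_ge_2 by (intro mult_pos_pos real_sqrt_gt_zero divide_pos_pos) auto
      then show ?thesis using chi_scaling(1)[OF f a] by simp
    qed
    ultimately show ?thesis using r by blast
  qed
  show "0 < C1 d * sqrt pi * chi d a"
    using sub[of "\<lambda>n. 1 / real (Suc n)"] LIMSEQ_inverse_real_of_nat by (auto simp: inverse_eq_divide)
  show "((\<lambda>s. Q hc (lap s hc) a / sqrt s) \<longlongrightarrow> C1 d * sqrt pi * chi d a / real d) (at_right 0)"
  proof (rule tendsto_at_right_sequentially[of 0 1])
    fix s :: "nat \<Rightarrow> real" assume s: "\<And>n. 0 < s n" "s \<longlonglongrightarrow> 0"
    let ?L = "C1 d * sqrt pi * chi d a / real d" and ?X = "\<lambda>n. Q hc (lap (s n) hc) a / sqrt (s n)"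
    show "?X \<longlonglongrightarrow> ?L"
    proof (rule ccontr)
      assume "\<not> ?X \<longlonglongrightarrow> ?L"
      then obtain e where e: "e > 0" "\<not> eventually (\<lambda>n. dist (?X n) ?L < e) sequentially"
        unfolding tendsto_iff by blast
      then have "frequently (\<lambda>n. \<not> dist (?X n) ?L < e) sequentially" by (simp add: not_eventually)
      then have "\<exists>r::nat \<Rightarrow> nat. strict_mono r \<and> (\<forall>n. \<not> dist (?X (r n)) ?L < e)"
        using infinite_enumerate[of "{n. \<not> dist (?X n) ?L < e}"]
        by (auto simp: cofinite_eq_sequentially[symmetric] frequently_cofinite)
      then obtain r :: "nat \<Rightarrow> nat" where r: "strict_mono r" "\<And>n. \<not> dist (?X (r n)) ?L < e" by blast
      have sr: "(\<lambda>n. s (r n)) \<longlonglongrightarrow> 0" using LIMSEQ_subseq_LIMSEQ[OF s(2) r(1)] by (simp add: comp_def)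
      obtain r' where "(\<lambda>n. ?X (r (r' n))) \<longlonglongrightarrow> ?L" using sub[of "\<lambda>n. s (r n)"] s(1) sr by blast
      then have "eventually (\<lambda>n. dist (?X (r (r' n))) ?L < e) sequentially" using e(1) by (simp add: tendsto_iff)
      then show False using r(2) by (auto simp: eventually_sequentially)
    qed
  qed simp
qed

text \<open>With \<open>k\<close> children at the root the transform is
  \<open>1 - exp (- s) (1 - q)^k\<close>, to first order \<open>k q\<close>, as
  \<open>1 - exp (- s)\<close> is negligible against \<open>sqrt s\<close>. This is the origin of
  the ratio \<open>k / d\<close>; Karamata's theorem removes the \<open>sqrt pi\<close> from
  \<open>L\<close>.\<close>

lemma tail_asymptotics:
  assumes a: "hc \<le> a" and k: "0 < k"
  shows "((\<lambda>t. sqrt t * tail k hc a t) \<longlongrightarrow> C1 d * (real k / real d) * chi d a) at_top"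
proof -
  let ?q = "\<lambda>s. Q hc (lap s hc) a"
  define L where "L = C1 d * sqrt pi * chi d a / real d"
  have L: "0 < L" using Q_lap_asymptotics(2)[OF a] by (simp add: L_def)
  have qs: "((\<lambda>s. ?q s / sqrt s) \<longlongrightarrow> L) (at_right 0)"
    unfolding L_def by (rule Q_lap_asymptotics(1)[OF a])
  have pos: "eventually (\<lambda>s::real. 0 < s) (at_right 0)" by (simp add: eventually_at_right_less)
  have q0: "(?q \<longlongrightarrow> 0) (at_right 0)"
  proof -
    have "((\<lambda>s. ?q s / sqrt s * sqrt s) \<longlongrightarrow> L * sqrt 0) (at_right 0)"
      by (intro tendsto_mult qs tendsto_real_sqrt tendsto_ident_at)
    then have "((\<lambda>s. ?q s / sqrt s * sqrt s) \<longlongrightarrow> 0) (at_right 0)"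
      by (simp only: real_sqrt_zero mult_zero_right)
    then show ?thesis
      by (rule Lim_transform_eventually) (rule eventually_mono[OF pos], simp)
  qed
  have "((\<lambda>s. (1 - exp (- s)) / sqrt s * (1 - ?q s) ^ k + ?q s / sqrt s * (\<Sum>j<k. (1 - ?q s) ^ j)) \<longlongrightarrow> 0 * (1 - 0) ^ k + L * (\<Sum>j<k. (1 - 0) ^ j)) (at_right 0)"
  proof (intro tendsto_intros qs q0)
    show "((\<lambda>s::real. (1 - exp (- s)) / sqrt s) \<longlongrightarrow> 0) (at_right 0)" by real_asymp
  qed
  then have lim: "((\<lambda>s. (1 - exp (- s)) / sqrt s * (1 - ?q s) ^ k + ?q s / sqrt s * (\<Sum>j<k. (1 - ?q s) ^ j)) \<longlongrightarrow> real k * L) (at_right 0)"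
    by (simp add: mult.commute)
  have "((\<lambda>t. sqrt t * tail k hc a t) \<longlongrightarrow> (real k * L) / sqrt pi) at_top"
  proof (rule karamata_tauberian_half)
    show "0 < real k * L" using L k by simp
    show "((\<lambda>s. sqrt s * (\<integral>t. indicator {0<..} t * exp (- (s * t)) * tail k hc a t \<partial>lborel)) \<longlongrightarrow> real k * L) (at_right 0)"
    proof (rule Lim_transform_eventually[OF lim])
      show "eventually (\<lambda>s. (1 - exp (- s)) / sqrt s * (1 - ?q s) ^ k + ?q s / sqrt s * (\<Sum>j<k. (1 - ?q s) ^ j)
          = sqrt s * (\<integral>t. indicator {0<..} t * exp (- (s * t)) * tail k hc a t \<partial>lborel)) (at_right 0)"
        using pos
      proof eventually_elim
        case (elim s)
        let ?I = "\<integral>t. indicator {0<..} t * exp (- (s * t)) * tail k hc a t \<partial>lborel"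
        have "s * ?I = (\<integral>t. indicator {0<..} t * (s * exp (- (s * t))) * tail k hc a t \<partial>lborel)"
          unfolding integral_mult_right_zero[symmetric]
          by (intro Bochner_Integration.integral_cong refl) simp
        also have "\<dots> = (1 - exp (- s)) * (1 - ?q s) ^ k + ?q s * (\<Sum>j<k. (1 - ?q s) ^ j)"
          unfolding tail_laplace[OF elim a] by (rule one_minus_scaled_power)
        finally have "(1 - exp (- s)) / sqrt s * (1 - ?q s) ^ k + ?q s / sqrt s * (\<Sum>j<k. (1 - ?q s) ^ j) = s * ?I / sqrt s"
          by (simp add: add_divide_distrib)
        also have "\<dots> = s / sqrt s * ?I" by (rule times_divide_eq_left[symmetric])
        also have "s / sqrt s = sqrt s" using elim by (intro real_div_sqrt) simp
        finally show ?case .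
      qed
    qed
  qed (use tail_props in auto)
  then show ?thesis by (simp add: L_def field_simps)
qed

end

theorem theorem2p3:
  fixes d :: nat and a :: real
  assumes "d \<ge> 2" and "a \<ge> h_star d"
  shows "(\<lambda>t. Pa d a (\<lambda>\<phi>. size_gt (cluster d (h_star d) \<phi> \<inter> T_plus d) t))
            \<sim>[at_top] (\<lambda>t. C1 d * chi d a * t powr (-1/2))
         \<and> (\<lambda>t. Pa d a (\<lambda>\<phi>. size_gt (cluster d (h_star d) \<phi>) t))
            \<sim>[at_top] (\<lambda>t. C1 d * ((real d + 1) / real d) * chi d a * t powr (-1/2))"
proof -
  interpret tree_degree d by unfold_locales (rule assms)
  have nz: "C1 d * chi d a \<noteq> 0" using Q_lap_asymptotics(2)[OF assms(2)] by auto
  have "((\<lambda>t. sqrt t * tail d (h_star d) a t) \<longlongrightarrow> C1 d * chi d a) at_top"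
    using tail_asymptotics[OF assms(2), of d] by simp
  then have "tail d (h_star d) a \<sim>[at_top] (\<lambda>t. C1 d * chi d a * t powr (-1/2))"
    using nz by (rule asymp_equiv_of_sqrt_limit)
  moreover have "((\<lambda>t. sqrt t * tail (Suc d) (h_star d) a t) \<longlongrightarrow> C1 d * ((real d + 1) / real d) * chi d a) at_top"
    using tail_asymptotics[OF assms(2), of "Suc d"] by (simp add: add.commute)
  then have "tail (Suc d) (h_star d) a \<sim>[at_top] (\<lambda>t. C1 d * ((real d + 1) / real d) * chi d a * t powr (-1/2))"
    by (rule asymp_equiv_of_sqrt_limit) (use nz in auto)
  ultimately show ?thesis unfolding Pa_cluster Pa_cluster_T_plus by simp
qed

end
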